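(* Let $R$ be a reward function and let $\mu<\bar\mu_\infty$. Then there exists a unique mean field equilibrium. Its cdf is $$F^*(x)=g^{-1}\Big(\big[R(1)+(\bar R-R(1))\,h(x)\big]\wedge R(0)\Big),$$ where $g^{-1}$ is the right-continuous inverse of $g$, and the equilibrium value function is $$u^*(x)=\big[R(1)+(\bar R-R(1))\,h(x)\big]\wedge R(0).$$ In particular, the equilibrium has compact support $[0,\bar x]$ for $\bar x=h^{-1}\Big(\frac{R(0)-R(1)}{\bar R-R(1)}\Big)$, and its atoms are in one-to-one correspondence with intervals where the reward $R$ is constant.
   Context: Increasing/decreasing are understood in the non-strict sense. A reward function is a right-continuous decreasing function $R:[0,1]\to[0,\infty)$ with $R(0)>R(1-)=R(1)$. Write $g(y):=R(1-y)$ and $\bar R:=\int_0^1R(r)\,dr$. The right-continuous inverse of $g$ is $g^{-1}(z)=\inf\{y\in[0,1]:g(y)>z\}$ for $z\in[R(1),R(0))$ and $g^{-1}(R(0)):=1$. Fix parameters $x_0\in(0,\infty)$, $\mu\in\mathbb R$, $\sigma\in(0,\infty)$. Set $$\bar\mu_\infty:=\frac{\sigma^2}{2x_0}\log\Big(\frac{R(0)-R(1)}{R(0)-\bar R}\Big)>0.$$ Let $X_t=x_0+\mu t+\sigma W_t$ ($W$ a standard Brownian motion) with absorption at $0$, and let $h$ be its normalized scale function: $h(x)=\frac{\exp(-2\mu x/\sigma^2)-1}{\exp(-2\mu x_0/\sigma^2)-1}$ if $\mu\ne0$ and $h(x)=x/x_0$ if $\mu=0$. $\mathcal F$ denotes the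 set of feasible distributions, i.e. laws on $[0,\infty)$ of $X_\tau$ for some (possibly randomized) finite stopping time $\tau$; it is known that $\mathcal F$ consists of all distributions $F$ on $[0,\infty)$ with $\int h\,dF=1$ if $\mu>0$, respectively $\int h\,dF\le1$ if $\mu\le0$. The same symbol is used for a distribution and its cdf. For a distribution $F$ on $[0,\infty)$, the payoff for stopping at $x\ge0$ when all other players use $F$ is $\xi^F(x)=g(F(x))$ if $F(x)=F(x-)$, and $\xi^F(x)=\frac1{F(x)-F(x-)}\int_{F(x-)}^{F(x)}g(y)\,dy$ if $F(x)>F(x-)$. $F\in\mathcal F$ is a mean field equilibrium if $\int\xi^F\,dF\ge\int\xi^F\,d\tilde F$ for all $\tilde F\in\mathcal F$. The associated value function $u(x)$ is the supremum expected reward $E[\xi^F(X_\tau)]$, over (possibly randomized) finite stopping times $\tau$, achievable for a player starting at level $x$ (instead of $x_0$) if all others use $F$; here $h$ keeps its normalization $h(x_0)=1$.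
   Formalization: The support equals [0,x̄] only if R is continuous (R=1 on [0,1/2), 0 on [1/2,1] gives support {0,x̄}); it is proved instead that the support is compact with convex hull [0,x̄], and that it equals [0,x̄] when R is continuous. *)

theory Defs
  imports "HOL-Probability.Probability"
begin

section \<open>Reward functions\<close>

definition left_lim :: "(real \<Rightarrow> real) \<Rightarrow> real \<Rightarrow> real" where
  "left_lim f x = Lim (at_left x) f"

text \<open>Only the values of \<open>R\<close> on the unit interval matter; ``decreasing'' is non-strict.\<close>

definition reward_function :: "(real \<Rightarrow> real) \<Rightarrow> bool" where
  "reward_function R \<longleftrightarrow>
     (\<forall>r\<in>{0..1}. 0 \<le> R r) \<and> antimono_on {0..1} R \<and>
     (\<forall>r\<in>{0..<1}. continuous (at_right r) R) \<and>
     R 0 > left_lim R 1 \<and> left_lim R 1 = R 1"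

definition rev_reward :: "(real \<Rightarrow> real) \<Rightarrow> real \<Rightarrow> real" where
  "rev_reward R y = R (1 - y)"

definition mean_reward :: "(real \<Rightarrow> real) \<Rightarrow> real" where
  "mean_reward R = (LBINT r:{0..1}. R r)"

text \<open>The right-continuous inverse of \<open>rev_reward R\<close>; meaningful for arguments in \<open>{R 1..R 0}\<close> only.\<close>

definition rev_reward_inv :: "(real \<Rightarrow> real) \<Rightarrow> real \<Rightarrow> real" where
  "rev_reward_inv R z = (if z = R 0 then 1 else Inf {y \<in> {0..1}. rev_reward R y > z})"

definition mu_bar :: "(real \<Rightarrow> real) \<Rightarrow> real \<Rightarrow> real \<Rightarrow> real" where
  "mu_bar R x0 \<sigma> = \<sigma>\<^sup>2 / (2 * x0) * ln ((R 0 - R 1) / (R 0 - mean_reward R))"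

text \<open>Maximal non-degenerate subintervals of the unit interval on which \<open>R\<close> is constant.\<close>

definition flat_interval :: "(real \<Rightarrow> real) \<Rightarrow> real set \<Rightarrow> bool" where
  "flat_interval R I \<longleftrightarrow>
     I \<subseteq> {0..1} \<and> is_interval I \<and> R constant_on I \<and> (\<exists>a\<in>I. \<exists>b\<in>I. a < b) \<and>
     (\<forall>J. J \<subseteq> {0..1} \<and> is_interval J \<and> R constant_on J \<and> I \<subseteq> J \<longrightarrow> J = I)"


section \<open>The controlled process\<close>

text \<open>
  A filtered probability space carrying a standard Brownian motion \<open>W\<close>, with times indexed by
  the extended half-line so that stopping times may take the value \<open>\<infinity>\<close>. The initial
  sigma-algebra carries a uniform random variable \<open>U\<close>, which is automatically independent of
  \<open>W\<close>: stopping times of this filtration are the randomized stopping times. The filtration need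
  not be complete or right-continuous.
\<close>

locale randomized_brownian_motion = prob_space M + filtration "space M" \<FF>
  for M :: "'w measure" and \<FF> :: "ennreal \<Rightarrow> 'w measure" +
  fixes W :: "real \<Rightarrow> 'w \<Rightarrow> real" and U :: "'w \<Rightarrow> real"
  assumes subalgebra_\<FF>: "\<And>t. subalgebra M (\<FF> t)"
    and W_adapted: "\<And>t. 0 \<le> t \<Longrightarrow> W t \<in> borel_measurable (\<FF> (ennreal t))"
    and W_zero: "\<And>\<omega>. \<omega> \<in> space M \<Longrightarrow> W 0 \<omega> = 0"
    and W_continuous: "\<And>\<omega>. \<omega> \<in> space M \<Longrightarrow> continuous_on {0..} (\<lambda>t. W t \<omega>)"
    and W_increment_normal: "\<And>s t. 0 \<le> s \<Longrightarrow> s < t \<Longrightarrow>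
          distributed M lborel (\<lambda>\<omega>. W t \<omega> - W s \<omega>) (normal_density 0 (sqrt (t - s)))"
    and W_increment_indep: "\<And>s t. 0 \<le> s \<Longrightarrow> s < t \<Longrightarrow>
          indep_set (sets (\<FF> (ennreal s)))
            {(\<lambda>\<omega>. W t \<omega> - W s \<omega>) -` A \<inter> space M | A. A \<in> sets borel}"
    and U_measurable: "U \<in> borel_measurable (\<FF> 0)"
    and U_uniform: "distributed M lborel U (indicator {0..1})"

text \<open>Drifted Brownian motion started at \<open>x\<close> and absorbed at 0.\<close>

definition absorbed_bm ::
  "(real \<Rightarrow> 'w \<Rightarrow> real) \<Rightarrow> real \<Rightarrow> real \<Rightarrow> real \<Rightarrow> real \<Rightarrow> 'w \<Rightarrow> real" where
  "absorbed_bm W \<mu> \<sigma> x t \<omega> =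
     (if \<exists>s\<in>{0..t}. x + \<mu> * s + \<sigma> * W s \<omega> = 0 then 0 else x + \<mu> * t + \<sigma> * W t \<omega>)"

definition scale_fun :: "real \<Rightarrow> real \<Rightarrow> real \<Rightarrow> real \<Rightarrow> real" where
  "scale_fun \<mu> \<sigma> x0 x =
     (if \<mu> = 0 then x / x0
      else (exp (- 2 * \<mu> * x / \<sigma>\<^sup>2) - 1) / (exp (- 2 * \<mu> * x0 / \<sigma>\<^sup>2) - 1))"

definition finite_stopping_times ::
  "'w measure \<Rightarrow> (ennreal \<Rightarrow> 'w measure) \<Rightarrow> ('w \<Rightarrow> ennreal) set" where
  "finite_stopping_times M \<FF> = {\<tau>. stopping_time \<FF> \<tau> \<and> (AE \<omega> in M. \<tau> \<omega> < \<infinity>)}"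

text \<open>On the null set where \<open>\<tau> = \<infinity>\<close> the conversion \<open>enn2real\<close> yields the irrelevant value 0.\<close>

definition stopped_value ::
  "(real \<Rightarrow> 'w \<Rightarrow> real) \<Rightarrow> real \<Rightarrow> real \<Rightarrow> real \<Rightarrow> ('w \<Rightarrow> ennreal) \<Rightarrow> 'w \<Rightarrow> real" where
  "stopped_value W \<mu> \<sigma> x \<tau> \<omega> = absorbed_bm W \<mu> \<sigma> x (enn2real (\<tau> \<omega>)) \<omega>"

text \<open>Distributions on the half-line are represented as Borel measures on the real line.\<close>

definition feasible_distributions ::
  "'w measure \<Rightarrow> (ennreal \<Rightarrow> 'w measure) \<Rightarrow> (real \<Rightarrow> 'w \<Rightarrow> real) \<Rightarrow> real \<Rightarrow> real \<Rightarrow> real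
    \<Rightarrow> real measure set" where
  "feasible_distributions M \<FF> W \<mu> \<sigma> x0 =
     (\<lambda>\<tau>. distr M borel (stopped_value W \<mu> \<sigma> x0 \<tau>)) ` finite_stopping_times M \<FF>"


section \<open>Payoffs and equilibrium\<close>

definition payoff :: "(real \<Rightarrow> real) \<Rightarrow> real measure \<Rightarrow> real \<Rightarrow> real" where
  "payoff R F x =
     (let b = cdf F x; a = left_lim (cdf F) x in
      if b = a then rev_reward R b
      else 1 / (b - a) * (LBINT y:{a..b}. rev_reward R y))"

definition mean_field_equilibrium ::
  "'w measure \<Rightarrow> (ennreal \<Rightarrow> 'w measure) \<Rightarrow> (real \<Rightarrow> 'w \<Rightarrow> real) \<Rightarrow> real \<Rightarrow> real \<Rightarrow> real
    \<Rightarrow> (real \<Rightarrow> real) \<Rightarrow> real measure \<Rightarrow> bool" where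
  "mean_field_equilibrium M \<FF> W \<mu> \<sigma> x0 R F \<longleftrightarrow>
     F \<in> feasible_distributions M \<FF> W \<mu> \<sigma> x0 \<and>
     (\<forall>F' \<in> feasible_distributions M \<FF> W \<mu> \<sigma> x0.
        (LINT x|F. payoff R F x) \<ge> (LINT x|F'. payoff R F x))"

definition value_function ::
  "'w measure \<Rightarrow> (ennreal \<Rightarrow> 'w measure) \<Rightarrow> (real \<Rightarrow> 'w \<Rightarrow> real) \<Rightarrow> real \<Rightarrow> real
    \<Rightarrow> (real \<Rightarrow> real) \<Rightarrow> real measure \<Rightarrow> real \<Rightarrow> real" where
  "value_function M \<FF> W \<mu> \<sigma> R F x =
     (SUP \<tau> \<in> finite_stopping_times M \<FF>.
        LINT \<omega>|M. payoff R F (stopped_value W \<mu> \<sigma> x \<tau> \<omega>))"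

definition topological_support :: "real measure \<Rightarrow> real set" where
  "topological_support F = {x. \<forall>V. open V \<and> x \<in> V \<longrightarrow> measure F V > 0}"

definition atoms :: "real measure \<Rightarrow> real set" where
  "atoms F = {x. measure F {x} > 0}"

end

theory Submission
  imports Defs
begin

text \<open>
  In the natural scale \<open>h\<close> the absorbed process is a nonnegative local martingale, so \<open>E h(X_\<tau>) \<le> h(x)\<close>
  for every finite stopping time. If \<open>F\<close> is an equilibrium, then exits from intervals around \<open>x0\<close> are
  not profitable, which bounds the payoff \<open>\<xi>\<^sup>F\<close> by an increasing affine function \<open>l\<close> of \<open>h\<close>;
  integrating against \<open>F\<close> gives \<open>\<xi>\<^sup>F = l\<close> almost everywhere. In terms of the quantile function \<open>q\<close> of
  \<open>F\<close> this reads \<open>g = l \<circ> q\<close> on the unit interval, where \<open>g y = R (1 - y)\<close>. Integrating and letting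
  \<open>y\<close> tend to \<open>0\<close> fixes \<open>l = R 1 + (mean_reward R - R 1) h\<close>, hence \<open>q\<close>. Conversely the law of \<open>l\<inverse>(g(Y))\<close>
  for uniform \<open>Y\<close> has \<open>h\<close>-mean \<open>1\<close>, is reached by exit from an interval with randomized end points,
  and its payoff is dominated by the concave function \<open>min l (R 0)\<close> of \<open>h\<close>, with equality on the support.
\<close>

section \<open>Optional stopping\<close>

text \<open>The condition on \<open>\<mu>\<close> is a range condition: \<open>ell\<close> must
  reach the top reward \<open>R 0\<close>, that is, \<open>z\<close> must lie in the range of
  \<open>h\<close>. For positive \<open>\<mu>\<close> the function \<open>h\<close> is bounded, and
  \<open>mu_bar\<close> is exactly the drift at which its supremum drops to \<open>z\<close>.

  Feasibility is defined through stopping times, so both directions rest on optional stopping. For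
  unbounded times only \<open>E h(X) \<le> 1\<close> survives; the supporting line has slope
  \<open>s \<ge> 0\<close>, which makes this inequality sufficient. Conversely, a single bounded law
  has to be embedded. The filtration need not be right-continuous, so the stopping times constructed
  here are first entrances into closed sets.

  The delicate point of uniqueness is that the payoff is an average at atoms and is known to equal
  \<open>l\<close> only almost everywhere. Continuity of \<open>l\<close> bounds
  \<open>g (F.C x)\<close> as well, which forces atoms onto flat pieces of \<open>g\<close> and
  upgrades the identity to every quantile level in the open unit interval.\<close>

lemma (in prob_space) tendsto_expectation_L2_bounded:
  fixes Y :: "nat \<Rightarrow> 'a \<Rightarrow> real"
  assumes [measurable]: "\<And>n. Y n \<in> borel_measurable M" "Z \<in> borel_measurable M"
    and lim: "\<And>\<omega>. \<omega> \<in> space M \<Longrightarrow> (\<lambda>n. Y n \<omega>) \<longlonglongrightarrow> Z \<omega>"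
    and sq: "\<And>n. integrable M (\<lambda>\<omega>. (Y n \<omega>)\<^sup>2)" and C: "\<And>n. expectation (\<lambda>\<omega>. (Y n \<omega>)\<^sup>2) \<le> C"
  shows "integrable M (\<lambda>\<omega>. (Z \<omega>)\<^sup>2)" "(\<lambda>n. expectation (Y n)) \<longlonglongrightarrow> expectation Z"
proof -
  have C0: "0 \<le> C"
    by (rule order_trans[OF _ C[of 0]]) simp
  \<comment> \<open>Fatou's lemma carries the uniform second-moment bound over to the limit.\<close>
  have "(\<integral>\<^sup>+\<omega>. ennreal ((Z \<omega>)\<^sup>2) \<partial>M) = (\<integral>\<^sup>+\<omega>. liminf (\<lambda>n. ennreal ((Y n \<omega>)\<^sup>2)) \<partial>M)"
    by (intro nn_integral_cong lim_imp_Liminf[symmetric] tendsto_ennrealI tendsto_power lim) simp_all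
  also have "\<dots> \<le> liminf (\<lambda>n. \<integral>\<^sup>+\<omega>. ennreal ((Y n \<omega>)\<^sup>2) \<partial>M)"
    by (rule nn_integral_liminf) simp
  also have "\<dots> \<le> liminf (\<lambda>n. ennreal C)"
    by (intro Liminf_mono always_eventually allI)
       (simp add: nn_integral_eq_integral[OF sq] C ennreal_leI)
  finally have Z: "(\<integral>\<^sup>+\<omega>. ennreal ((Z \<omega>)\<^sup>2) \<partial>M) \<le> ennreal C" by (simp add: Liminf_const)
  then show Zi: "integrable M (\<lambda>\<omega>. (Z \<omega>)\<^sup>2)"
    by (intro integrableI_nonneg) (auto intro: le_less_trans)
  have ZC: "expectation (\<lambda>\<omega>. (Z \<omega>)\<^sup>2) \<le> C"
    using Z C0 by (simp add: nn_integral_eq_integral[OF Zi])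
  note [simp] = square_integrable_imp_integrable[OF _ sq] square_integrable_imp_integrable[OF _ Zi] sq Zi
  show "(\<lambda>n. expectation (Y n)) \<longlonglongrightarrow> expectation Z"
  proof (rule LIMSEQ_I)
    fix r :: real assume r: "0 < r"
    \<comment> \<open>\<open>K\<close> truncates the difference \<open>d\<close>: beyond
      \<open>K\<close> one has \<open>\<bar>d\<bar> \<le> d\<^sup>2 / K\<close>, and the second
      moments then contribute at most \<open>4 * C / K\<close>, which this choice pushes below
      \<open>r / 2\<close>.\<close>
    define K where "K = 8 * C / r + 1"
    have K: "0 < K" "4 * C / K < r / 2"
      using r C0 by (auto simp: K_def field_simps add_pos_nonneg)
    have "(\<lambda>n. expectation (\<lambda>\<omega>. min \<bar>Y n \<omega> - Z \<omega>\<bar> K)) \<longlonglongrightarrow> expectation (\<lambda>\<omega>. 0)"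
    proof (rule integral_dominated_convergence[where w = "\<lambda>_. K"])
      show "AE \<omega> in M. (\<lambda>n. min \<bar>Y n \<omega> - Z \<omega>\<bar> K) \<longlonglongrightarrow> 0"
      proof (rule AE_I2)
        fix \<omega> assume "\<omega> \<in> space M"
        then have "(\<lambda>n. min \<bar>Y n \<omega> - Z \<omega>\<bar> K) \<longlonglongrightarrow> min \<bar>Z \<omega> - Z \<omega>\<bar> K"
          by (intro tendsto_min tendsto_rabs tendsto_diff lim tendsto_const)
        then show "(\<lambda>n. min \<bar>Y n \<omega> - Z \<omega>\<bar> K) \<longlonglongrightarrow> 0" using K by simp
      qed
    qed (use K in auto)
    then obtain n0 where n0: "\<And>n. n \<ge> n0 \<Longrightarrow> expectation (\<lambda>\<omega>. min \<bar>Y n \<omega> - Z \<omega>\<bar> K) < r / 2"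
      using LIMSEQ_D[of _ 0 "r/2"] r by fastforce
    have "norm (expectation (Y n) - expectation Z) < r" if "n \<ge> n0" for n
    proof -
      have "\<bar>expectation (Y n) - expectation Z\<bar> = \<bar>expectation (\<lambda>\<omega>. Y n \<omega> - Z \<omega>)\<bar>"
        by simp
      also have "\<dots> \<le> expectation (\<lambda>\<omega>. min \<bar>Y n \<omega> - Z \<omega>\<bar> K + (2 * (Y n \<omega>)\<^sup>2 + 2 * (Z \<omega>)\<^sup>2) / K)"
      proof (rule order_trans[OF integral_abs_bound], rule integral_mono)
        fix \<omega>
        have "\<bar>d\<bar> \<le> min \<bar>d\<bar> K + d\<^sup>2 / K" for d :: real
        proof (cases "\<bar>d\<bar> \<le> K")
          case False
          then have "\<bar>d\<bar> * K \<le> \<bar>d\<bar> * \<bar>d\<bar>" by (intro mult_left_mono) auto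
          then have "\<bar>d\<bar> \<le> d\<^sup>2 / K" using K by (simp add: field_simps power2_eq_square abs_mult[symmetric])
          then show ?thesis using K by linarith
        qed (use K in auto)
        from this[of "Y n \<omega> - Z \<omega>"]
        have "\<bar>Y n \<omega> - Z \<omega>\<bar> \<le> min \<bar>Y n \<omega> - Z \<omega>\<bar> K + (Y n \<omega> - Z \<omega>)\<^sup>2 / K" .
        also have "(Y n \<omega> - Z \<omega>)\<^sup>2 / K \<le> (2 * (Y n \<omega>)\<^sup>2 + 2 * (Z \<omega>)\<^sup>2) / K"
        proof (rule divide_right_mono)
          have "0 \<le> (Y n \<omega> + Z \<omega>)\<^sup>2" by simp
          then show "(Y n \<omega> - Z \<omega>)\<^sup>2 \<le> 2 * (Y n \<omega>)\<^sup>2 + 2 * (Z \<omega>)\<^sup>2"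
            unfolding power2_diff power2_sum by linarith
        qed (use K in simp)
        finally show "\<bar>Y n \<omega> - Z \<omega>\<bar> \<le> min \<bar>Y n \<omega> - Z \<omega>\<bar> K + (2 * (Y n \<omega>)\<^sup>2 + 2 * (Z \<omega>)\<^sup>2) / K" by simp
      qed (auto intro!: Bochner_Integration.integrable_add integrable_min integrable_abs)
      also have "\<dots> = expectation (\<lambda>\<omega>. min \<bar>Y n \<omega> - Z \<omega>\<bar> K)
          + (2 * expectation (\<lambda>\<omega>. (Y n \<omega>)\<^sup>2) + 2 * expectation (\<lambda>\<omega>. (Z \<omega>)\<^sup>2)) / K"
        by (subst Bochner_Integration.integral_add)
           (auto intro!: integrable_min integrable_abs)
      also have "\<dots> \<le> expectation (\<lambda>\<omega>. min \<bar>Y n \<omega> - Z \<omega>\<bar> K) + 4 * C / K"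
        using K C[of n] ZC by (intro add_left_mono divide_right_mono) auto
      also have "\<dots> < r" using n0[OF that] K(2) by linarith
      finally show ?thesis by simp
    qed
    then show "\<exists>no. \<forall>n\<ge>no. norm (expectation (Y n) - expectation Z) < r" by blast
  qed
qed

lemma ennreal_le_enn2real_min_iff:
  fixes x :: ennreal and c :: real and T :: nat
  assumes "0 \<le> c" "c < real T"
  shows "enn2real (min x (of_nat T)) \<le> c \<longleftrightarrow> x \<le> ennreal c"
  using assms by (cases x) (auto simp: min_def ennreal_of_nat_eq_real_of_nat top_unique)

lemma enn2real_min_of_nat_le: "enn2real (min x (of_nat T)) \<le> real T"
  by (intro enn2real_leI) (auto simp: ennreal_of_nat_eq_real_of_nat)

text \<open>The martingale property is tested on events of the past instead of being phrased with
  conditional expectations. The second-moment inequality bounds the values at rounded stopping times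
  uniformly, so that L2-boundedness plays the part of uniform integrability.\<close>

locale continuous_L2_martingale = prob_space M + filtration "space M" \<FF>
  for M :: "'w measure" and \<FF> :: "ennreal \<Rightarrow> 'w measure" +
  fixes N :: "real \<Rightarrow> 'w \<Rightarrow> real"
  assumes subalg: "\<And>t. subalgebra M (\<FF> t)"
    and adapted: "\<And>t. 0 \<le> t \<Longrightarrow> N t \<in> borel_measurable (\<FF> (ennreal t))"
    and cont: "\<And>\<omega>. \<omega> \<in> space M \<Longrightarrow> continuous_on {0..} (\<lambda>t. N t \<omega>)"
    and sq_int: "\<And>t. 0 \<le> t \<Longrightarrow> integrable M (\<lambda>\<omega>. (N t \<omega>)\<^sup>2)"
    and mart: "\<And>s t A. 0 \<le> s \<Longrightarrow> s \<le> t \<Longrightarrow> A \<in> sets (\<FF> (ennreal s)) \<Longrightarrow>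
       expectation (\<lambda>\<omega>. indicator A \<omega> * N s \<omega>) = expectation (\<lambda>\<omega>. indicator A \<omega> * N t \<omega>)"
    and submart: "\<And>s t A. 0 \<le> s \<Longrightarrow> s \<le> t \<Longrightarrow> A \<in> sets (\<FF> (ennreal s)) \<Longrightarrow>
       expectation (\<lambda>\<omega>. indicator A \<omega> * (N s \<omega>)\<^sup>2) \<le> expectation (\<lambda>\<omega>. indicator A \<omega> * (N t \<omega>)\<^sup>2)"
begin

lemma N_measurable[measurable]: "0 \<le> t \<Longrightarrow> N t \<in> borel_measurable M"
  using measurable_from_subalg[OF subalg adapted] .

lemma N_integrable: "0 \<le> t \<Longrightarrow> integrable M (N t)"
  using square_integrable_imp_integrable[OF N_measurable sq_int] .

lemma sets_F_M: "A \<in> sets (\<FF> t) \<Longrightarrow> A \<in> sets M"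
  using subalg[of t] by (auto simp: subalgebra_def)

lemma stopping_time_enn2real_sets:
  assumes \<rho>: "stopping_time \<FF> \<rho>" and "c \<le> c'" "0 \<le> c'"
  shows "{\<omega>\<in>space M. enn2real (min (\<rho> \<omega>) (of_nat T)) \<le> c} \<in> sets (\<FF> (ennreal c'))"
proof -
  consider "c < 0" | "0 \<le> c" "c < T" | "real T \<le> c" by linarith
  then show ?thesis
  proof cases
    case 1
    then have "{\<omega>\<in>space M. enn2real (min (\<rho> \<omega>) (of_nat T)) \<le> c} = {}"
      using order_trans[OF enn2real_nonneg] by fastforce
    then show ?thesis by (simp only: sets.empty_sets)
  next
    case 2
    then have "{\<omega>\<in>space M. enn2real (min (\<rho> \<omega>) (of_nat T)) \<le> c} = {\<omega>\<in>space M. \<rho> \<omega> \<le> ennreal c}"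
      by (auto simp: ennreal_le_enn2real_min_iff)
    then show ?thesis
      using stopping_time_le_const[OF \<rho>, of "ennreal c" "ennreal c'"] assms(2)
      by (simp add: pred_def space_F ennreal_leI)
  next
    case 3
    then have "{\<omega>\<in>space M. enn2real (min (\<rho> \<omega>) (of_nat T)) \<le> c} = space M"
      using enn2real_min_of_nat_le by (auto intro: order_trans)
    then show ?thesis by (metis sets.top space_F)
  qed
qed

text \<open>The bounded time is rounded up to the grid of mesh \<open>1 / Suc n\<close>; the rounded
  time takes finitely many values, so the martingale property applies level by level. Path
  continuity and the L2 bound then remove the rounding. The weight \<open>A\<close> from time 0
  later permits conditioning on randomized interval ends.\<close>

lemma optional_stopping_bounded:
  fixes T :: nat
  assumes \<rho>: "stopping_time \<FF> \<rho>" and A: "A \<in> sets (\<FF> 0)"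
  defines "r \<equiv> \<lambda>\<omega>. enn2real (min (\<rho> \<omega>) (of_nat T))"
  shows "(\<lambda>\<omega>. N (r \<omega>) \<omega>) \<in> borel_measurable M"
    and "integrable M (\<lambda>\<omega>. N (r \<omega>) \<omega>)"
    and "expectation (\<lambda>\<omega>. indicator A \<omega> * N (r \<omega>) \<omega>) = expectation (\<lambda>\<omega>. indicator A \<omega> * N 0 \<omega>)"
proof -
  \<comment> \<open>Rounding up, never down, keeps the event \<open>k n \<omega> = j\<close> in the
    information available at time \<open>j / Suc n\<close>.\<close>
  define k where "k n \<omega> = nat \<lceil>r \<omega> * real (Suc n)\<rceil>" for n \<omega>
  define rn where "rn n \<omega> = real (k n \<omega>) / real (Suc n)" for n \<omega>
  have r0: "0 \<le> r \<omega>" for \<omega> by (simp add: r_def)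
  have rT: "r \<omega> \<le> real T" for \<omega>
    by (simp add: r_def enn2real_min_of_nat_le)
  have k_le_iff: "k n \<omega> \<le> j \<longleftrightarrow> r \<omega> \<le> real j / real (Suc n)" for n \<omega> j
  proof -
    have "k n \<omega> \<le> j \<longleftrightarrow> r \<omega> * real (Suc n) \<le> real j"
      unfolding k_def by (simp add: nat_le_iff ceiling_le_iff del: of_nat_Suc)
    then show ?thesis by (simp add: pos_le_divide_eq del: of_nat_Suc)
  qed
  \<comment> \<open>\<open>T\<close> is an integer, hence a grid point, so rounding up cannot pass
    it.\<close>
  have kT: "k n \<omega> \<le> T * Suc n" for n \<omega>
    using rT[of \<omega>] by (simp add: k_le_iff del: of_nat_Suc mult_Suc_right)
  have sets_k: "{\<omega>\<in>space M. k n \<omega> = j} \<in> sets (\<FF> (ennreal (real j / real (Suc n))))" for n j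
  proof -
    have le: "{\<omega>\<in>space M. k n \<omega> \<le> i} \<in> sets (\<FF> (ennreal (real j / real (Suc n))))" if "i \<le> j" for i
      unfolding k_le_iff r_def using that
      by (intro stopping_time_enn2real_sets[OF \<rho>] divide_right_mono) auto
    show ?thesis
    proof (cases j)
      case 0
      then show ?thesis using le[of 0] by simp
    next
      case (Suc i)
      have "{\<omega>\<in>space M. k n \<omega> = j} = {\<omega>\<in>space M. k n \<omega> \<le> j} - {\<omega>\<in>space M. k n \<omega> \<le> i}"
        using Suc by auto
      then show ?thesis using le[of i] le[of j] Suc by auto
    qed
  qed
  have [measurable]: "{\<omega>\<in>space M. k n \<omega> = j} \<in> sets M" for n j
    using sets_F_M[OF sets_k] .
  have A_t: "A \<in> sets (\<FF> t)" for t using sets_F_mono[of 0 t] A by auto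
  note [measurable] = sets_F_M[OF A]
  \<comment> \<open>\<open>B\<close> carries the weight \<open>A\<close> for the identity of means;
    \<open>B'\<close> is the plain partition for the second moments.\<close>
  define B where "B n j = A \<inter> {\<omega>\<in>space M. k n \<omega> = j}" for n j
  define B' where "B' n j = {\<omega>\<in>space M. k n \<omega> = j}" for n j
  have Bm[measurable]: "B n j \<in> sets M" "B' n j \<in> sets M" for n j by (simp_all add: B_def B'_def)
  have decomp: "f (rn n \<omega>) \<omega> = (\<Sum>j\<le>T * Suc n. indicator (B' n j) \<omega> * f (real j / real (Suc n)) \<omega>)"
    if "\<omega> \<in> space M" for n \<omega> and f :: "real \<Rightarrow> 'w \<Rightarrow> real"
  proof -
    have "(\<Sum>j\<le>T * Suc n. indicator (B' n j) \<omega> * f (real j / real (Suc n)) \<omega>)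
        = (\<Sum>j\<le>T * Suc n. if j = k n \<omega> then f (real j / real (Suc n)) \<omega> else 0)"
      using that by (intro sum.cong) (auto simp: B'_def indicator_def)
    also have "\<dots> = f (rn n \<omega>) \<omega>" using kT[of n \<omega>] by (simp add: sum.delta rn_def)
    finally show ?thesis by simp
  qed
  have splitA: "indicator A \<omega> * f (rn n \<omega>) \<omega> = (\<Sum>j\<le>T * Suc n. indicator (B n j) \<omega> * f (real j / real (Suc n)) \<omega>)"
    if "\<omega> \<in> space M" for n \<omega> and f :: "real \<Rightarrow> 'w \<Rightarrow> real"
  proof -
    have "indicator A \<omega> * f (rn n \<omega>) \<omega> = (\<Sum>j\<le>T * Suc n. indicator A \<omega> * (indicator (B' n j) \<omega> * f (real j / real (Suc n)) \<omega>))"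
      by (subst decomp[OF that]) (rule sum_distrib_left)
    also have "\<dots> = (\<Sum>j\<le>T * Suc n. indicator (B n j) \<omega> * f (real j / real (Suc n)) \<omega>)"
      using that by (intro sum.cong) (auto simp: B_def B'_def indicator_def)
    finally show ?thesis .
  qed
  have j_le: "real j / real (Suc n) \<le> real T" if "j \<le> T * Suc n" for j n
  proof -
    have "real j \<le> real (T * Suc n)" using that by (rule of_nat_mono)
    then show ?thesis by (simp add: pos_divide_le_eq del: of_nat_Suc mult_Suc_right)
  qed
  have [measurable]: "(\<lambda>\<omega>. N (rn n \<omega>) \<omega>) \<in> borel_measurable M" for n
    by (subst measurable_cong[OF decomp[of _ N]]) (assumption, measurable)
  have int_ind: "integrable M (\<lambda>\<omega>. indicator S \<omega> * (N t \<omega>)\<^sup>2)" "integrable M (\<lambda>\<omega>. indicator S \<omega> * N t \<omega>)"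
    if "S \<in> sets M" "0 \<le> t" for S t
    using that integrable_mult_indicator[OF that(1) sq_int[OF that(2)]]
      integrable_mult_indicator[OF that(1) N_integrable[OF that(2)]] by auto
  have sq_n: "integrable M (\<lambda>\<omega>. (N (rn n \<omega>) \<omega>)\<^sup>2)" for n
    by (subst Bochner_Integration.integrable_cong[OF refl decomp[of _ "\<lambda>t \<omega>. (N t \<omega>)\<^sup>2"]])
       (assumption, intro Bochner_Integration.integrable_sum int_ind, auto)
  have sq_bound: "expectation (\<lambda>\<omega>. (N (rn n \<omega>) \<omega>)\<^sup>2) \<le> expectation (\<lambda>\<omega>. (N T \<omega>)\<^sup>2)" for n
  proof -
    have "expectation (\<lambda>\<omega>. (N (rn n \<omega>) \<omega>)\<^sup>2)
      = expectation (\<lambda>\<omega>. \<Sum>j\<le>T * Suc n. indicator (B' n j) \<omega> * (N (real j / real (Suc n)) \<omega>)\<^sup>2)"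
      by (rule Bochner_Integration.integral_cong[OF refl decomp[of _ "\<lambda>t \<omega>. (N t \<omega>)\<^sup>2"]])
    also have "\<dots> = (\<Sum>j\<le>T * Suc n. expectation (\<lambda>\<omega>. indicator (B' n j) \<omega> * (N (real j / real (Suc n)) \<omega>)\<^sup>2))"
      by (intro Bochner_Integration.integral_sum int_ind) auto
    also have "\<dots> \<le> (\<Sum>j\<le>T * Suc n. expectation (\<lambda>\<omega>. indicator (B' n j) \<omega> * (N T \<omega>)\<^sup>2))"
      unfolding B'_def by (intro sum_mono submart sets_k j_le) auto
    also have "\<dots> = expectation (\<lambda>\<omega>. \<Sum>j\<le>T * Suc n. indicator (B' n j) \<omega> * (N T \<omega>)\<^sup>2)"
      by (intro Bochner_Integration.integral_sum[symmetric] int_ind) auto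
    also have "\<dots> = expectation (\<lambda>\<omega>. (N T \<omega>)\<^sup>2)"
      by (rule Bochner_Integration.integral_cong[OF refl decomp[of _ "\<lambda>t \<omega>. (N T \<omega>)\<^sup>2", symmetric]])
    finally show ?thesis .
  qed
  have mean: "expectation (\<lambda>\<omega>. indicator A \<omega> * N (rn n \<omega>) \<omega>) = expectation (\<lambda>\<omega>. indicator A \<omega> * N T \<omega>)" for n
  proof -
    have "expectation (\<lambda>\<omega>. indicator A \<omega> * N (rn n \<omega>) \<omega>)
      = expectation (\<lambda>\<omega>. \<Sum>j\<le>T * Suc n. indicator (B n j) \<omega> * N (real j / real (Suc n)) \<omega>)"
      by (rule Bochner_Integration.integral_cong[OF refl splitA[of _ N]])
    also have "\<dots> = (\<Sum>j\<le>T * Suc n. expectation (\<lambda>\<omega>. indicator (B n j) \<omega> * N (real j / real (Suc n)) \<omega>))"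
      by (intro Bochner_Integration.integral_sum int_ind) auto
    \<comment> \<open>On each piece the grid time is moved forward to the common time
      \<open>T\<close>, where the pieces add up again.\<close>
    also have "\<dots> = (\<Sum>j\<le>T * Suc n. expectation (\<lambda>\<omega>. indicator (B n j) \<omega> * N T \<omega>))"
      unfolding B_def by (intro sum.cong refl mart sets.Int A_t sets_k j_le) auto
    also have "\<dots> = expectation (\<lambda>\<omega>. \<Sum>j\<le>T * Suc n. indicator (B n j) \<omega> * N T \<omega>)"
      by (intro Bochner_Integration.integral_sum[symmetric] int_ind) auto
    also have "\<dots> = expectation (\<lambda>\<omega>. indicator A \<omega> * N T \<omega>)"
      by (rule Bochner_Integration.integral_cong[OF refl splitA[of _ "\<lambda>t. N T", symmetric]])
    finally show ?thesis .
  qed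
  have rn_lim: "(\<lambda>n. rn n \<omega>) \<longlonglongrightarrow> r \<omega>" for \<omega>
  proof (rule tendsto_sandwich)
    show "\<forall>\<^sub>F n in sequentially. r \<omega> \<le> rn n \<omega>"
      using k_le_iff[THEN iffD1, OF order_refl] by (intro always_eventually allI) (simp add: rn_def)
    show "\<forall>\<^sub>F n in sequentially. rn n \<omega> \<le> r \<omega> + 1 / real (Suc n)"
    proof (intro always_eventually allI)
      fix n
      have "real (k n \<omega>) = of_int \<lceil>r \<omega> * real (Suc n)\<rceil>"
        using r0[of \<omega>] by (simp add: k_def del: of_nat_Suc)
      also have "\<dots> \<le> r \<omega> * real (Suc n) + 1" by linarith
      finally show "rn n \<omega> \<le> r \<omega> + 1 / real (Suc n)"
        by (simp add: rn_def field_simps del: of_nat_Suc)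
    qed
    show "(\<lambda>n. r \<omega> + 1 / real (Suc n)) \<longlonglongrightarrow> r \<omega>"
      using tendsto_add[OF tendsto_const LIMSEQ_inverse_real_of_nat, of "r \<omega>"]
      by (simp add: inverse_eq_divide)
  qed simp
  have lim: "(\<lambda>n. N (rn n \<omega>) \<omega>) \<longlonglongrightarrow> N (r \<omega>) \<omega>" if "\<omega> \<in> space M" for \<omega>
    by (rule continuous_on_tendsto_compose[OF cont[OF that] rn_lim])
       (auto simp: r0 rn_def)
  show meas[measurable]: "(\<lambda>\<omega>. N (r \<omega>) \<omega>) \<in> borel_measurable M"
    by (rule borel_measurable_LIMSEQ_real[OF lim]) auto
  have "integrable M (\<lambda>\<omega>. (N (r \<omega>) \<omega>)\<^sup>2)"
    by (rule tendsto_expectation_L2_bounded(1)[OF _ _ lim sq_n sq_bound]) auto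
  then show "integrable M (\<lambda>\<omega>. N (r \<omega>) \<omega>)"
    by (rule square_integrable_imp_integrable[OF meas])
  have "(\<lambda>n. expectation (\<lambda>\<omega>. indicator A \<omega> * N (rn n \<omega>) \<omega>)) \<longlonglongrightarrow> expectation (\<lambda>\<omega>. indicator A \<omega> * N (r \<omega>) \<omega>)"
  proof (rule tendsto_expectation_L2_bounded(2))
    show "integrable M (\<lambda>\<omega>. (indicator A \<omega> * N (rn n \<omega>) \<omega>)\<^sup>2)" for n
      by (rule Bochner_Integration.integrable_bound[OF sq_n[of n]]) (auto simp: indicator_def)
    show "expectation (\<lambda>\<omega>. (indicator A \<omega> * N (rn n \<omega>) \<omega>)\<^sup>2) \<le> expectation (\<lambda>\<omega>. (N T \<omega>)\<^sup>2)" for n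
      by (rule order_trans[OF integral_mono'[OF sq_n[of n]] sq_bound[of n]]) (auto simp: indicator_def)
    show "(\<lambda>n. indicator A \<omega> * N (rn n \<omega>) \<omega>) \<longlonglongrightarrow> indicator A \<omega> * N (r \<omega>) \<omega>" if "\<omega> \<in> space M" for \<omega>
      by (intro tendsto_mult tendsto_const lim that)
  qed measurable
  then have "expectation (\<lambda>\<omega>. indicator A \<omega> * N (r \<omega>) \<omega>) = expectation (\<lambda>\<omega>. indicator A \<omega> * N T \<omega>)"
    unfolding mean by (metis LIMSEQ_const_iff)
  also have "\<dots> = expectation (\<lambda>\<omega>. indicator A \<omega> * N 0 \<omega>)"
    using A by (intro mart[symmetric]) auto
  finally show "expectation (\<lambda>\<omega>. indicator A \<omega> * N (r \<omega>) \<omega>) = expectation (\<lambda>\<omega>. indicator A \<omega> * N 0 \<omega>)" .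
qed

end

section \<open>The scale function of Brownian motion with drift\<close>

lemma scale_fun_0 [simp]: "scale_fun \<mu> \<sigma> x0 0 = 0"
  by (simp add: scale_fun_def)

lemma scale_fun_base:
  assumes "0 < x0" "0 < \<sigma>"
  shows "scale_fun \<mu> \<sigma> x0 x0 = 1"
  using assms by (simp add: scale_fun_def)

lemma strict_mono_scale_fun:
  assumes "0 < x0" "0 < \<sigma>"
  shows "strict_mono (scale_fun \<mu> \<sigma> x0)"
proof (rule strict_monoI)
  fix x y :: real assume xy: "x < y"
  consider "\<mu> = 0" | "\<mu> < 0" | "0 < \<mu>" by linarith
  then show "scale_fun \<mu> \<sigma> x0 x < scale_fun \<mu> \<sigma> x0 y"
  proof cases
    case 1
    then show ?thesis using xy assms by (simp add: scale_fun_def divide_strict_right_mono)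
  next
    case 2
    have "- 2 * \<mu> * x / \<sigma>\<^sup>2 < - 2 * \<mu> * y / \<sigma>\<^sup>2" "0 < - 2 * \<mu> * x0 / \<sigma>\<^sup>2"
      using 2 xy assms by (auto simp: divide_simps mult_neg_pos)
    then show ?thesis using 2
      by (simp add: scale_fun_def divide_strict_right_mono)
  next
    case 3
    have "- 2 * \<mu> * y / \<sigma>\<^sup>2 < - 2 * \<mu> * x / \<sigma>\<^sup>2" "- 2 * \<mu> * x0 / \<sigma>\<^sup>2 < 0"
      using 3 xy assms by (auto simp: divide_simps)
    then show ?thesis using 3
      by (simp add: scale_fun_def divide_strict_right_mono_neg)
  qed
qed

lemma continuous_on_scale_fun: "continuous_on S (scale_fun \<mu> \<sigma> x0)"
proof (cases "\<mu> = 0")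
  case True
  have "continuous_on S (\<lambda>x. x * inverse x0)" by (intro continuous_intros)
  then show ?thesis using True by (simp add: scale_fun_def[abs_def] divide_inverse)
next
  case False
  have "continuous_on S (\<lambda>x. (exp (- 2 * \<mu> * x * inverse (\<sigma>\<^sup>2)) - 1) * inverse (exp (- 2 * \<mu> * x0 / \<sigma>\<^sup>2) - 1))"
    by (intro continuous_intros)
  then show ?thesis using False by (simp add: scale_fun_def[abs_def] divide_inverse)
qed

lemma scale_fun_measurable [measurable]: "scale_fun \<mu> \<sigma> x0 \<in> borel_measurable borel"
  by (intro borel_measurable_continuous_onI continuous_on_scale_fun)

section \<open>Hitting times\<close>

text \<open>Entrance into the closed half-line of nonpositive values serves both later uses:
  absorption applies it to \<open>\<bar>drift\<bar>\<close>, interval exit to the smaller of the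
  distances to the two ends.\<close>

definition hitting_time :: "(real \<Rightarrow> 'w \<Rightarrow> real) \<Rightarrow> 'w \<Rightarrow> ennreal" where
  "hitting_time Y \<omega> =
     (if \<exists>s\<ge>0. Y s \<omega> \<le> 0 then ennreal (Inf {s\<in>{0..}. Y s \<omega> \<le> 0}) else \<infinity>)"

lemma hitting_time_attained:
  assumes cont: "continuous_on {0..} (\<lambda>t. Y t \<omega>)" and fin: "hitting_time Y \<omega> < \<infinity>"
  shows "Y (enn2real (hitting_time Y \<omega>)) \<omega> \<le> 0"
proof -
  let ?S = "{s\<in>{0..}. Y s \<omega> \<le> 0}"
  have ex: "\<exists>s\<ge>0. Y s \<omega> \<le> 0" using fin by (auto simp: hitting_time_def split: if_splits)
  have "closed ?S" by (intro continuous_on_closed_Collect_le cont continuous_on_const closed_atLeast)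
  then have "Inf ?S \<in> ?S" using ex by (intro closed_contains_Inf) (auto intro!: bdd_belowI[of _ 0])
  then show ?thesis using ex by (simp add: hitting_time_def)
qed

lemma hitting_time_pos_before:
  assumes "0 \<le> s" "ennreal s < hitting_time Y \<omega>"
  shows "0 < Y s \<omega>"
proof (rule ccontr)
  assume *: "\<not> 0 < Y s \<omega>"
  then have "Inf {s\<in>{0..}. Y s \<omega> \<le> 0} \<le> s"
    using assms by (intro cInf_lower) (auto intro!: bdd_belowI[of _ 0])
  then have "hitting_time Y \<omega> \<le> ennreal s"
    using * assms by (auto simp: hitting_time_def intro!: ennreal_leI)
  with assms show False by simp
qed

text \<open>The set of hitting instants is closed, so its infimum is attained. Hence the event on
  the left is decided by the path up to time \<open>t\<close> alone.\<close>

lemma hitting_time_le_iff: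
  assumes cont: "continuous_on {0..} (\<lambda>t. Y t \<omega>)" and t: "0 \<le> t"
  shows "hitting_time Y \<omega> \<le> ennreal t \<longleftrightarrow> (\<exists>s\<in>{0..t}. Y s \<omega> \<le> 0)"
proof
  assume le: "hitting_time Y \<omega> \<le> ennreal t"
  then have "hitting_time Y \<omega> < \<infinity>" by (auto intro: le_less_trans)
  from hitting_time_attained[OF cont this] show "\<exists>s\<in>{0..t}. Y s \<omega> \<le> 0"
    using enn2real_leI[OF t le] by (intro bexI[of _ "enn2real (hitting_time Y \<omega>)"]) auto
next
  assume "\<exists>s\<in>{0..t}. Y s \<omega> \<le> 0"
  then obtain s where s: "0 \<le> s" "s \<le> t" "Y s \<omega> \<le> 0" by auto
  then have "\<not> ennreal s < hitting_time Y \<omega>" using hitting_time_pos_before[of s Y \<omega>] by auto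
  then show "hitting_time Y \<omega> \<le> ennreal t" using s by (auto intro: order_trans ennreal_leI simp: not_less)
qed

lemma hitting_time_zero:
  assumes cont: "continuous_on {0..} (\<lambda>t. Y t \<omega>)" and fin: "hitting_time Y \<omega> < \<infinity>" and "0 \<le> Y 0 \<omega>"
  shows "Y (enn2real (hitting_time Y \<omega>)) \<omega> = 0"
proof (rule ccontr)
  let ?T = "enn2real (hitting_time Y \<omega>)"
  assume "Y ?T \<omega> \<noteq> 0"
  then have neg: "Y ?T \<omega> < 0" using hitting_time_attained[OF cont fin] by simp
  \<comment> \<open>Half of a negative value is still negative and, by continuity, is taken strictly
    earlier, contradicting the choice of the first hitting time.\<close>
  have "\<exists>s\<ge>0. s \<le> ?T \<and> Y s \<omega> = Y ?T \<omega> / 2"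
    using neg assms(3)
    by (intro IVT2') (auto intro: continuous_on_subset[OF cont])
  then obtain s where s: "0 \<le> s" "s \<le> ?T" "Y s \<omega> = Y ?T \<omega> / 2" by blast
  then have "s < ?T" using neg by (cases "s = ?T") auto
  then have "ennreal s < hitting_time Y \<omega>"
    using fin s by (metis ennreal_enn2real ennreal_less_iff infinity_ennreal_def)
  then show False using hitting_time_pos_before[OF s(1), of Y \<omega>] s neg by simp
qed

text \<open>Turns an uncountable union into countable operations. The slack \<open>1 / Suc n\<close>
  is there because the level 0 may be touched at irrational times only; compactness turns
  arbitrarily small slack back into a genuine hit.\<close>

lemma exists_nonpos_iff_rational:
  fixes f :: "real \<Rightarrow> real"
  assumes cont: "continuous_on {0..t} f" and t: "0 \<le> t"
  shows "(\<exists>s\<in>{0..t}. f s \<le> 0) \<longleftrightarrow> (\<forall>n::nat. \<exists>q\<in>\<rat> \<inter> {0..t}. f q < 1 / real (Suc n))"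
proof
  assume "\<exists>s\<in>{0..t}. f s \<le> 0"
  then obtain s where s: "0 \<le> s" "s \<le> t" "f s \<le> 0" by auto
  show "\<forall>n::nat. \<exists>q\<in>\<rat> \<inter> {0..t}. f q < 1 / real (Suc n)"
  proof
    fix n :: nat
    obtain d where d: "d > 0" "\<And>q. q \<in> {0..t} \<Longrightarrow> dist q s < d \<Longrightarrow> dist (f q) (f s) < 1 / real (Suc n)"
      using cont[unfolded continuous_on_iff, rule_format, of s "1 / real (Suc n)"] s by auto
    have "\<exists>q\<in>\<rat> \<inter> {0..t}. dist q s < d"
    \<comment> \<open>For \<open>t = 0\<close> the interval has no interior, and 0 itself is the
      rational point.\<close>
    proof (cases "t = 0")
      case True
      then show ?thesis using s d by (intro bexI[of _ 0]) auto
    next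
      case False
      then have "max 0 (s - d) < min t (s + d)" using s d t by auto
      from Rats_dense_in_real[OF this] obtain q where "q \<in> \<rat>" "max 0 (s - d) < q" "q < min t (s + d)" by blast
      then show ?thesis by (intro bexI[of _ q]) (auto simp: dist_real_def)
    qed
    then obtain q where q: "q \<in> \<rat> \<inter> {0..t}" "dist q s < d" by blast
    then have "dist (f q) (f s) < 1 / real (Suc n)" using d(2)[of q] by auto
    then have "f q < 1 / real (Suc n)" using s by (auto simp: dist_real_def)
    then show "\<exists>q\<in>\<rat> \<inter> {0..t}. f q < 1 / real (Suc n)" using q by blast
  qed
next
  assume *: "\<forall>n::nat. \<exists>q\<in>\<rat> \<inter> {0..t}. f q < 1 / real (Suc n)"
  obtain s where s: "s \<in> {0..t}" "\<And>q. q \<in> {0..t} \<Longrightarrow> f s \<le> f q"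
    using continuous_attains_inf[OF compact_Icc _ cont] t by auto
  have "f s \<le> 1 / real (Suc n)" for n
  proof -
    obtain q where "q \<in> \<rat> \<inter> {0..t}" "f q < 1 / real (Suc n)" using * by blast
    then show ?thesis using s(2)[of q] by auto
  qed
  then have "f s \<le> 0"
    using LIMSEQ_le_const[OF LIMSEQ_inverse_real_of_nat, of "f s"] by (auto simp: inverse_eq_divide)
  then show "\<exists>s\<in>{0..t}. f s \<le> 0" using s by blast
qed

lemma stopping_time_hitting_time:
  fixes \<FF> :: "ennreal \<Rightarrow> 'a measure" and Y :: "real \<Rightarrow> 'a \<Rightarrow> real"
  assumes "filtration \<Omega> \<FF>"
  assumes adapted: "\<And>t. 0 \<le> t \<Longrightarrow> Y t \<in> borel_measurable (\<FF> (ennreal t))"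
    and cont: "\<And>\<omega>. \<omega> \<in> \<Omega> \<Longrightarrow> continuous_on {0..} (\<lambda>t. Y t \<omega>)"
  shows "stopping_time \<FF> (hitting_time Y)"
proof
  interpret filtration \<Omega> \<FF> by fact
  fix t :: ennreal
  show "Measurable.pred (\<FF> t) (\<lambda>\<omega>. hitting_time Y \<omega> \<le> t)"
  proof (cases t)
    case (real r)
    have [measurable]: "{\<omega>\<in>\<Omega>. Y q \<omega> < c} \<in> sets (\<FF> t)" if "q \<in> {0..r}" for q c
    proof -
      have "{\<omega>\<in>space (\<FF> (ennreal q)). Y q \<omega> < c} \<in> sets (\<FF> (ennreal q))"
        using adapted[of q] that by simp
      then show ?thesis
        using sets_F_mono[of "ennreal q" t] that real by (auto simp: space_F ennreal_leI)
    qed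
    have "{\<omega>\<in>\<Omega>. hitting_time Y \<omega> \<le> t} = {\<omega>\<in>\<Omega>. \<exists>s\<in>{0..r}. Y s \<omega> \<le> 0}"
      by (intro Collect_cong conj_cong refl) (use real in \<open>simp add: hitting_time_le_iff cont\<close>)
    also have "\<dots> = {\<omega>\<in>\<Omega>. \<forall>n::nat. \<exists>q\<in>\<rat> \<inter> {0..r}. Y q \<omega> < 1 / real (Suc n)}"
      by (intro Collect_cong conj_cong refl exists_nonpos_iff_rational continuous_on_subset[OF cont]) (use real in auto)
    also have "\<dots> = (\<Inter>n::nat. \<Union>q\<in>\<rat> \<inter> {0..r}. {\<omega>\<in>\<Omega>. Y q \<omega> < 1 / real (Suc n)})"
      by auto
    also have "\<dots> \<in> sets (\<FF> t)"
      by (intro sets.countable_INT' sets.countable_UN' image_subsetI countable_Int1 countable_rat) auto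
    finally show ?thesis by (simp add: pred_def space_F)
  next
    case top
    then show ?thesis by simp
  qed
qed

text \<open>The random time is approximated by grid times with countably many values, for which
  measurability is elementary; continuity of the paths gives the limit.\<close>

lemma measurable_continuous_process_at:
  fixes Y :: "real \<Rightarrow> 'w \<Rightarrow> real"
  assumes meas: "\<And>t. 0 \<le> t \<Longrightarrow> Y t \<in> borel_measurable M" and [measurable]: "r \<in> borel_measurable M"
    and r: "\<And>\<omega>. 0 \<le> r \<omega>"
    and cont: "\<And>\<omega>. \<omega> \<in> space M \<Longrightarrow> continuous_on {0..} (\<lambda>t. Y t \<omega>)"
  shows "(\<lambda>\<omega>. Y (r \<omega>) \<omega>) \<in> borel_measurable M"
proof (rule borel_measurable_LIMSEQ_real)
  fix n :: nat
  show "(\<lambda>\<omega>. Y (real (nat \<lceil>r \<omega> * real (Suc n)\<rceil>) / real (Suc n)) \<omega>) \<in> borel_measurable M"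
    by (rule measurable_compose_countable[where f = "\<lambda>i. Y (real i / real (Suc n))"])
       (auto intro: meas)
next
  fix \<omega> assume \<omega>: "\<omega> \<in> space M"
  have "(\<lambda>n. real (nat \<lceil>r \<omega> * real (Suc n)\<rceil>) / real (Suc n)) \<longlonglongrightarrow> r \<omega>"
  proof (rule tendsto_sandwich)
    have eq: "real (nat \<lceil>r \<omega> * real (Suc n)\<rceil>) = of_int \<lceil>r \<omega> * real (Suc n)\<rceil>" for n
      using r[of \<omega>] by (simp del: of_nat_Suc)
    show "\<forall>\<^sub>F n in sequentially. r \<omega> \<le> real (nat \<lceil>r \<omega> * real (Suc n)\<rceil>) / real (Suc n)"
      unfolding eq by (intro always_eventually allI) (simp add: pos_le_divide_eq del: of_nat_Suc)
    show "\<forall>\<^sub>F n in sequentially. real (nat \<lceil>r \<omega> * real (Suc n)\<rceil>) / real (Suc n) \<le> r \<omega> + 1 / real (Suc n)"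
    proof (unfold eq, intro always_eventually allI)
      fix n
      have "real_of_int \<lceil>r \<omega> * real (Suc n)\<rceil> \<le> r \<omega> * real (Suc n) + 1" by linarith
      then show "real_of_int \<lceil>r \<omega> * real (Suc n)\<rceil> / real (Suc n) \<le> r \<omega> + 1 / real (Suc n)"
        by (simp add: field_simps del: of_nat_Suc)
    qed
    show "(\<lambda>n. r \<omega> + 1 / real (Suc n)) \<longlonglongrightarrow> r \<omega>"
      using tendsto_add[OF tendsto_const LIMSEQ_inverse_real_of_nat, of "r \<omega>"]
      by (simp add: inverse_eq_divide)
  qed (rule tendsto_const)
  then show "(\<lambda>n. Y (real (nat \<lceil>r \<omega> * real (Suc n)\<rceil>) / real (Suc n)) \<omega>) \<longlonglongrightarrow> Y (r \<omega>) \<omega>"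
    by (rule continuous_on_tendsto_compose[OF cont[OF \<omega>]])
       (auto intro!: r always_eventually divide_nonneg_nonneg simp only: atLeast_iff of_nat_0_le_iff)
qed

section \<open>Brownian motion with drift\<close>

lemma (in prob_space) normal_exp_moment:
  assumes Z: "distributed M lborel Z (normal_density 0 s)" and s: "0 < s"
  shows "integrable M (\<lambda>\<omega>. exp (a * Z \<omega>))" "expectation (\<lambda>\<omega>. exp (a * Z \<omega>)) = exp (a\<^sup>2 * s\<^sup>2 / 2)"
proof -
  \<comment> \<open>Completing the square: the exponential factor only shifts the mean of the
    Gaussian density to \<open>a * s\<^sup>2\<close>.\<close>
  have *: "normal_density 0 s x * exp (a * x) = exp (a\<^sup>2 * s\<^sup>2 / 2) * normal_density (a * s\<^sup>2) s x" for x
  proof -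
    have "- x\<^sup>2 / (2 * s\<^sup>2) + a * x = a\<^sup>2 * s\<^sup>2 / 2 + - (x - a * s\<^sup>2)\<^sup>2 / (2 * s\<^sup>2)"
      using s by (simp add: field_simps power2_eq_square)
    then have "exp (- x\<^sup>2 / (2 * s\<^sup>2)) * exp (a * x) = exp (a\<^sup>2 * s\<^sup>2 / 2) * exp (- (x - a * s\<^sup>2)\<^sup>2 / (2 * s\<^sup>2))"
      unfolding exp_add[symmetric] by simp
    then show ?thesis by (simp add: normal_density_def)
  qed
  show "integrable M (\<lambda>\<omega>. exp (a * Z \<omega>))"
    using distributed_integrable[OF Z, of "\<lambda>x. exp (a * x)"] s by (simp add: *)
  show "expectation (\<lambda>\<omega>. exp (a * Z \<omega>)) = exp (a\<^sup>2 * s\<^sup>2 / 2)"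
    using distributed_integral[OF Z, of "\<lambda>x. exp (a * x)"] s by (simp add: *)
qed

lemma (in prob_space) normal_first_moments:
  assumes Z: "distributed M lborel Z (normal_density 0 s)" and s: "0 < s"
  shows "integrable M Z" "expectation Z = 0" "integrable M (\<lambda>\<omega>. (Z \<omega>)\<^sup>2)"
proof -
  show "integrable M Z"
    using distributed_integrable[OF Z, of "\<lambda>x. x"] integrable_normal_moment_nz_1[OF s, of 0] by simp
  show "expectation Z = 0"
    using distributed_integral[OF Z, of "\<lambda>x. x"] integral_normal_moment_nz_1[OF s, of 0] by simp
  show "integrable M (\<lambda>\<omega>. (Z \<omega>)\<^sup>2)"
    using distributed_integrable[OF Z, of "\<lambda>x. x\<^sup>2"] integrable_normal_moment[OF s, of 0 2] by simp
qed

lemma (in prob_space) indep_set_mono: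
  "indep_set P Q \<Longrightarrow> P' \<subseteq> P \<Longrightarrow> Q' \<subseteq> Q \<Longrightarrow> indep_set P' Q'"
  unfolding indep_sets2_eq by (meson subsetD subset_trans)

section \<open>Martingale increments from independent Gaussian increments\<close>

context randomized_brownian_motion
begin

lemma \<FF>_measurable_M: "f \<in> borel_measurable (\<FF> t) \<Longrightarrow> f \<in> borel_measurable M"
  using measurable_from_subalg[OF subalgebra_\<FF>] .

lemma W_measurable [measurable]: "0 \<le> t \<Longrightarrow> W t \<in> borel_measurable M"
  using \<FF>_measurable_M[OF W_adapted] .

lemma \<FF>_mono_measurable: "s \<le> t \<Longrightarrow> f \<in> borel_measurable (\<FF> s) \<Longrightarrow> f \<in> borel_measurable (\<FF> t)"
  using sets_F_mono[of s t] by (auto simp: measurable_def space_F)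

text \<open>The axiom speaks of the events generated by the increment and of those of
  \<open>\<FF> s\<close>. The events of \<open>f\<close> of the increment are among the former,
  those of \<open>Y\<close> among the latter, and independence is inherited by subfamilies.\<close>

lemma increment_independent:
  fixes Y :: "'w \<Rightarrow> real" and f :: "real \<Rightarrow> real"
  assumes st: "0 \<le> s" "s < t" and Y: "Y \<in> borel_measurable (\<FF> (ennreal s))" "integrable M Y"
    and f[measurable]: "f \<in> borel_measurable borel" and fi: "integrable M (\<lambda>\<omega>. f (W t \<omega> - W s \<omega>))"
  shows "integrable M (\<lambda>\<omega>. Y \<omega> * f (W t \<omega> - W s \<omega>))"
    "expectation (\<lambda>\<omega>. Y \<omega> * f (W t \<omega> - W s \<omega>)) = expectation Y * expectation (\<lambda>\<omega>. f (W t \<omega> - W s \<omega>))"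
proof -
  have [measurable]: "W s \<in> borel_measurable M" "W t \<in> borel_measurable M" "Y \<in> borel_measurable M"
    using st Y by auto
  have "indep_var borel Y borel (\<lambda>\<omega>. f (W t \<omega> - W s \<omega>))"
    unfolding indep_var_eq
  proof (intro conjI)
    have sub1: "sigma_sets (space M) {Y -` A \<inter> space M |A. A \<in> sets borel} \<subseteq> sets (\<FF> (ennreal s))"
    proof -
      have "sigma_sets (space (\<FF> (ennreal s))) {Y -` A \<inter> space M |A. A \<in> sets borel} \<subseteq> sets (\<FF> (ennreal s))"
        using measurable_sets[OF Y(1)] by (intro sets.sigma_sets_subset) (auto simp: space_F)
      then show ?thesis by (simp add: space_F)
    qed
    have sub2: "sigma_sets (space M) {(\<lambda>\<omega>. f (W t \<omega> - W s \<omega>)) -` A \<inter> space M |A. A \<in> sets borel}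
       \<subseteq> {(\<lambda>\<omega>. W t \<omega> - W s \<omega>) -` A \<inter> space M | A. A \<in> sets borel}"
    proof -
      let ?V = "vimage_algebra (space M) (\<lambda>\<omega>. W t \<omega> - W s \<omega>) borel"
      have V: "sets ?V = {(\<lambda>\<omega>. W t \<omega> - W s \<omega>) -` A \<inter> space M | A. A \<in> sets borel}"
        by (simp add: sets_vimage_algebra2)
      have "{(\<lambda>\<omega>. f (W t \<omega> - W s \<omega>)) -` A \<inter> space M |A. A \<in> sets borel} \<subseteq> sets ?V"
      proof (unfold V, safe)
        fix A :: "real set" assume "A \<in> sets borel"
        then have "f -` A \<in> sets borel" using measurable_sets[OF f] by simp
        then show "\<exists>B. (\<lambda>\<omega>. f (W t \<omega> - W s \<omega>)) -` A \<inter> space M = (\<lambda>\<omega>. W t \<omega> - W s \<omega>) -` B \<inter> space M \<and> B \<in> sets borel"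
          by (intro exI[of _ "f -` A"]) auto
      qed
      from sets.sigma_sets_subset[OF this] show ?thesis by (simp add: V)
    qed
    show "indep_set (sigma_sets (space M) {Y -` A \<inter> space M |A. A \<in> sets borel})
     (sigma_sets (space M) {(\<lambda>\<omega>. f (W t \<omega> - W s \<omega>)) -` A \<inter> space M |A. A \<in> sets borel})"
      by (rule indep_set_mono[OF W_increment_indep[OF st] sub1 sub2])
  qed measurable
  then show "integrable M (\<lambda>\<omega>. Y \<omega> * f (W t \<omega> - W s \<omega>))"
    "expectation (\<lambda>\<omega>. Y \<omega> * f (W t \<omega> - W s \<omega>)) = expectation Y * expectation (\<lambda>\<omega>. f (W t \<omega> - W s \<omega>))"
    using indep_var_integrable[OF _ Y(2) fi] indep_var_lebesgue_integral[OF _ Y(2) fi] by auto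
qed

text \<open>A common scheme for the additive case of zero drift and the multiplicative one of
  nonzero drift. The factor \<open>f\<close> is centred and independent of the past, so the added
  term has mean zero on \<open>A\<close>; in the square the cross term vanishes and a nonnegative
  term remains.\<close>

lemma martingale_step:
  fixes V Y :: "'w \<Rightarrow> real" and f :: "real \<Rightarrow> real"
  assumes st: "0 \<le> s" "s < t"
    and V: "V \<in> borel_measurable (\<FF> (ennreal s))" "integrable M (\<lambda>\<omega>. (V \<omega>)\<^sup>2)"
    and Y: "Y \<in> borel_measurable (\<FF> (ennreal s))" "integrable M (\<lambda>\<omega>. (Y \<omega>)\<^sup>2)"
    and f[measurable]: "f \<in> borel_measurable borel"
    and fi: "integrable M (\<lambda>\<omega>. (f (W t \<omega> - W s \<omega>))\<^sup>2)"
    and f0: "expectation (\<lambda>\<omega>. f (W t \<omega> - W s \<omega>)) = 0"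
    and A: "A \<in> sets (\<FF> (ennreal s))"
  shows "expectation (\<lambda>\<omega>. indicator A \<omega> * V \<omega>) = expectation (\<lambda>\<omega>. indicator A \<omega> * (V \<omega> + Y \<omega> * f (W t \<omega> - W s \<omega>)))"
    "expectation (\<lambda>\<omega>. indicator A \<omega> * (V \<omega>)\<^sup>2) \<le> expectation (\<lambda>\<omega>. indicator A \<omega> * (V \<omega> + Y \<omega> * f (W t \<omega> - W s \<omega>))\<^sup>2)"
proof -
  have [measurable]: "W s \<in> borel_measurable M" "W t \<in> borel_measurable M" "Y \<in> borel_measurable M" "V \<in> borel_measurable M"
    using st Y V \<FF>_measurable_M by auto
  have [measurable]: "A \<in> sets M" using A subalgebra_\<FF>[of "ennreal s"] by (auto simp: subalgebra_def)
  define D where "D \<omega> = f (W t \<omega> - W s \<omega>)" for \<omega>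
  have [measurable]: "D \<in> borel_measurable M" unfolding D_def[abs_def] by measurable
  have Vi: "integrable M V" and Yi: "integrable M Y" and Di: "integrable M D"
    using square_integrable_imp_integrable[OF _ V(2)] square_integrable_imp_integrable[OF _ Y(2)]
      square_integrable_imp_integrable[OF _ fi] by (simp_all add: D_def[abs_def])
  have VY: "integrable M (\<lambda>\<omega>. V \<omega> * Y \<omega>)"
  proof (rule Bochner_Integration.integrable_bound)
    show "integrable M (\<lambda>\<omega>. (V \<omega>)\<^sup>2 + (Y \<omega>)\<^sup>2)" using V Y by simp
    have "\<bar>v * y\<bar> \<le> v\<^sup>2 + y\<^sup>2" for v y :: real
    proof -
      have "2 * (\<bar>v\<bar> * \<bar>y\<bar>) \<le> \<bar>v\<bar>\<^sup>2 + \<bar>y\<bar>\<^sup>2"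
        using sum_squares_bound[of "\<bar>v\<bar>" "\<bar>y\<bar>"] by (simp add: mult.assoc)
      moreover have "0 \<le> \<bar>v\<bar> * \<bar>y\<bar>" by simp
      ultimately show ?thesis unfolding abs_mult power2_abs by linarith
    qed
    then show "AE \<omega> in M. norm (V \<omega> * Y \<omega>) \<le> norm ((V \<omega>)\<^sup>2 + (Y \<omega>)\<^sup>2)" by simp
  qed measurable
  note ind = integrable_mult_indicator[OF \<open>A \<in> sets M\<close>, where 'b = real, simplified]
  have step: "integrable M (\<lambda>\<omega>. indicator A \<omega> * Z \<omega> * D \<omega>)" "expectation (\<lambda>\<omega>. indicator A \<omega> * Z \<omega> * D \<omega>) = 0"
    if "Z \<in> borel_measurable (\<FF> (ennreal s))" "integrable M Z" for Z
    using increment_independent[OF st _ _ f Di[unfolded D_def[abs_def]], of "\<lambda>\<omega>. indicator A \<omega> * Z \<omega>"]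
      that A f0 ind[OF that(2)] by (auto simp: D_def)
  have YD: "integrable M (\<lambda>\<omega>. indicator A \<omega> * (Y \<omega>)\<^sup>2 * (D \<omega>)\<^sup>2)"
    using increment_independent(1)[OF st, of "\<lambda>\<omega>. indicator A \<omega> * (Y \<omega>)\<^sup>2" "\<lambda>x. (f x)\<^sup>2"]
      Y A fi ind[OF Y(2)] by (simp add: D_def)
  note s1 = step[OF Y(1) Yi] and s2 = step[of "\<lambda>\<omega>. V \<omega> * Y \<omega>", OF _ VY]
  have m2: "(\<lambda>\<omega>. V \<omega> * Y \<omega>) \<in> borel_measurable (\<FF> (ennreal s))" using V Y by simp
  have "expectation (\<lambda>\<omega>. indicator A \<omega> * (V \<omega> + Y \<omega> * D \<omega>)) = expectation (\<lambda>\<omega>. indicator A \<omega> * V \<omega> + indicator A \<omega> * Y \<omega> * D \<omega>)"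
    by (simp add: algebra_simps)
  also have "\<dots> = expectation (\<lambda>\<omega>. indicator A \<omega> * V \<omega>)"
    using s1 ind[OF Vi] by simp
  finally show "expectation (\<lambda>\<omega>. indicator A \<omega> * V \<omega>) = expectation (\<lambda>\<omega>. indicator A \<omega> * (V \<omega> + Y \<omega> * f (W t \<omega> - W s \<omega>)))"
    by (simp add: D_def)
  have "expectation (\<lambda>\<omega>. indicator A \<omega> * (V \<omega> + Y \<omega> * D \<omega>)\<^sup>2)
     = expectation (\<lambda>\<omega>. indicator A \<omega> * (V \<omega>)\<^sup>2 + (2 * (indicator A \<omega> * (V \<omega> * Y \<omega>) * D \<omega>) + indicator A \<omega> * (Y \<omega>)\<^sup>2 * (D \<omega>)\<^sup>2))"
    by (intro Bochner_Integration.integral_cong) (auto simp: power2_eq_square algebra_simps)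
  also have "\<dots> = expectation (\<lambda>\<omega>. indicator A \<omega> * (V \<omega>)\<^sup>2) + expectation (\<lambda>\<omega>. indicator A \<omega> * (Y \<omega>)\<^sup>2 * (D \<omega>)\<^sup>2)"
    using s2(1)[OF m2] s2(2)[OF m2] YD ind[OF V(2)] by simp
  also have "\<dots> \<ge> expectation (\<lambda>\<omega>. indicator A \<omega> * (V \<omega>)\<^sup>2)" by simp
  finally show "expectation (\<lambda>\<omega>. indicator A \<omega> * (V \<omega>)\<^sup>2) \<le> expectation (\<lambda>\<omega>. indicator A \<omega> * (V \<omega> + Y \<omega> * f (W t \<omega> - W s \<omega>))\<^sup>2)"
    by (simp add: D_def)
qed

end

section \<open>The martingale property in natural scale\<close>

locale drifted_brownian_motion = randomized_brownian_motion M \<FF> W U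
  for M :: "'w measure" and \<FF> :: "ennreal \<Rightarrow> 'w measure"
    and W :: "real \<Rightarrow> 'w \<Rightarrow> real" and U :: "'w \<Rightarrow> real" +
  fixes \<mu> \<sigma> x0 :: real
  assumes x0_pos: "0 < x0" and \<sigma>_pos: "0 < \<sigma>"
begin

definition drift :: "real \<Rightarrow> real \<Rightarrow> 'w \<Rightarrow> real" where
  "drift x t \<omega> = x + \<mu> * t + \<sigma> * W t \<omega>"

abbreviation h :: "real \<Rightarrow> real" where "h \<equiv> scale_fun \<mu> \<sigma> x0"

lemma h_less_iff [simp]: "h x < h y \<longleftrightarrow> x < y"
  using strict_mono_less[OF strict_mono_scale_fun[OF x0_pos \<sigma>_pos]] .

lemma h_le_iff [simp]: "h x \<le> h y \<longleftrightarrow> x \<le> y"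
  using strict_mono_less_eq[OF strict_mono_scale_fun[OF x0_pos \<sigma>_pos]] .

lemma h_eq_iff [simp]: "h x = h y \<longleftrightarrow> x = y"
  using strict_mono_eq[OF strict_mono_scale_fun[OF x0_pos \<sigma>_pos]] .

lemma h_base [simp]: "h x0 = 1"
  using scale_fun_base[OF x0_pos \<sigma>_pos] .

lemma h_nonneg_iff [simp]: "0 \<le> h x \<longleftrightarrow> 0 \<le> x"
  using h_le_iff[of 0 x] by simp

lemma drift_adapted: "0 \<le> t \<Longrightarrow> drift x t \<in> borel_measurable (\<FF> (ennreal t))"
  unfolding drift_def[abs_def] using W_adapted[of t] by measurable

lemma drift_measurable [measurable]: "0 \<le> t \<Longrightarrow> drift x t \<in> borel_measurable M"
  using \<FF>_measurable_M[OF drift_adapted] .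

lemma drift_zero [simp]: "\<omega> \<in> space M \<Longrightarrow> drift x 0 \<omega> = x"
  by (simp add: drift_def W_zero)

lemma drift_continuous: "\<omega> \<in> space M \<Longrightarrow> continuous_on {0..} (\<lambda>t. drift x t \<omega>)"
  unfolding drift_def by (intro continuous_intros W_continuous)

lemma exp_drift_integrable:
  assumes "0 \<le> t"
  shows "integrable M (\<lambda>\<omega>. exp (a * drift x t \<omega>))"
proof (cases "t = 0")
  case True
  have "integrable M (\<lambda>\<omega>. exp (a * x))" by simp
  then show ?thesis
    by (rule Bochner_Integration.integrable_cong[THEN iffD1, rotated 2]) (simp_all add: True)
next
  case False
  then have "integrable M (\<lambda>\<omega>. exp (a * (x + \<mu> * t)) * exp (a * \<sigma> * (W t \<omega> - W 0 \<omega>)))"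
    using assms
    by (intro integrable_mult_right normal_exp_moment(1)[OF W_increment_normal]) auto
  then show ?thesis
    by (rule Bochner_Integration.integrable_cong[THEN iffD1, rotated 2])
       (simp_all add: W_zero drift_def exp_add[symmetric] algebra_simps)
qed

lemma h_drift_sq_integrable:
  assumes "0 \<le> t"
  shows "integrable M (\<lambda>\<omega>. (h (drift x t \<omega>))\<^sup>2)"
proof (cases "\<mu> = 0")
  case False
  define k where "k = - 2 * \<mu> / \<sigma>\<^sup>2"
  define D where "D = exp (- 2 * \<mu> * x0 / \<sigma>\<^sup>2) - 1"
  have "(h y)\<^sup>2 = (exp (2 * k * y) - 2 * exp (k * y) + 1) / D\<^sup>2" for y
  proof -
    have "h y = (exp (k * y) - 1) / D" using False by (simp add: scale_fun_def k_def D_def)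
    moreover have "exp (2 * k * y) = (exp (k * y))\<^sup>2" by (simp add: exp_double[symmetric] algebra_simps)
    ultimately show ?thesis by (simp add: power_divide power2_diff)
  qed
  then show ?thesis using exp_drift_integrable[OF assms] by simp
next
  case True
  show ?thesis
  proof (cases "t = 0")
    case t: True
    have "integrable M (\<lambda>\<omega>. (h x)\<^sup>2)" by simp
    then show ?thesis
      by (rule Bochner_Integration.integrable_cong[THEN iffD1, rotated 2]) (simp_all add: t)
  next
    case False
    then have t: "0 < t" using assms by simp
    note n = normal_first_moments[OF W_increment_normal[OF order_refl t]]
    have i: "integrable M (\<lambda>\<omega>. (x\<^sup>2 + 2 * x * \<sigma> * (W t \<omega> - W 0 \<omega>) + \<sigma>\<^sup>2 * (W t \<omega> - W 0 \<omega>)\<^sup>2) / x0\<^sup>2)"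
      using n t by simp
    have e: "(x\<^sup>2 + 2 * x * \<sigma> * (W t \<omega> - W 0 \<omega>) + \<sigma>\<^sup>2 * (W t \<omega> - W 0 \<omega>)\<^sup>2) / x0\<^sup>2 = (h (drift x t \<omega>))\<^sup>2"
      if "\<omega> \<in> space M" for \<omega>
      unfolding scale_fun_def drift_def
      by (simp add: True W_zero[OF that] power_divide power2_eq_square algebra_simps)
    show ?thesis by (rule Bochner_Integration.integrable_cong[THEN iffD1, OF refl e i])
  qed
qed

lemma h_drift_increment:
  assumes st: "0 \<le> s" "s < t"
  obtains Y :: "'w \<Rightarrow> real" and f :: "real \<Rightarrow> real" where
    "Y \<in> borel_measurable (\<FF> (ennreal s))" "integrable M (\<lambda>\<omega>. (Y \<omega>)\<^sup>2)"
    "f \<in> borel_measurable borel" "integrable M (\<lambda>\<omega>. (f (W t \<omega> - W s \<omega>))\<^sup>2)"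
    "expectation (\<lambda>\<omega>. f (W t \<omega> - W s \<omega>)) = 0"
    "\<And>\<omega>. h (drift x t \<omega>) = h (drift x s \<omega>) + Y \<omega> * f (W t \<omega> - W s \<omega>)"
proof (cases "\<mu> = 0")
  case True
  note n = normal_first_moments[OF W_increment_normal[OF st]]
  have "h (drift x t \<omega>) = h (drift x s \<omega>) + \<sigma> / x0 * (W t \<omega> - W s \<omega>)" for \<omega>
    unfolding drift_def scale_fun_def by (simp add: True diff_divide_distrib add_divide_distrib algebra_simps)
  then show ?thesis
    using n st by (intro that[of "\<lambda>_. \<sigma> / x0" "\<lambda>x. x"]) simp_all
next
  case False
  define k where "k = - 2 * \<mu> / \<sigma>\<^sup>2"
  define D where "D = exp (- 2 * \<mu> * x0 / \<sigma>\<^sup>2) - 1"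
  define Y where "Y \<omega> = exp (k * drift x s \<omega>) / D" for \<omega>
  \<comment> \<open>\<open>exp (k * drift x t \<omega>)\<close> factors into its value at time
    \<open>s\<close> and an exponential of the increment; \<open>f\<close> is the latter minus its
    mean 1.\<close>
  define f where "f w = exp (k * \<mu> * (t - s)) * exp (k * \<sigma> * w) - 1" for w
  have pos: "0 < sqrt (t - s)" using st by simp
  note e = normal_exp_moment[OF W_increment_normal[OF st] pos]
  show ?thesis
  proof (rule that)
    show "Y \<in> borel_measurable (\<FF> (ennreal s))"
      unfolding Y_def[abs_def] using drift_adapted[OF st(1)] by measurable
    have "(Y \<omega>)\<^sup>2 = exp (2 * k * drift x s \<omega>) / D\<^sup>2" for \<omega>
      by (simp add: Y_def power_divide exp_double[symmetric] algebra_simps)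
    then show "integrable M (\<lambda>\<omega>. (Y \<omega>)\<^sup>2)" using exp_drift_integrable[OF st(1)] by simp
    show "f \<in> borel_measurable borel" unfolding f_def[abs_def] by measurable
    have "(f w)\<^sup>2 = exp (2 * (k * \<mu> * (t - s))) * exp (2 * k * \<sigma> * w) - 2 * exp (k * \<mu> * (t - s)) * exp (k * \<sigma> * w) + 1" for w
    proof -
      have "exp (2 * (k * \<mu> * (t - s))) = (exp (k * \<mu> * (t - s)))\<^sup>2"
        "exp (2 * k * \<sigma> * w) = (exp (k * \<sigma> * w))\<^sup>2"
        by (simp_all add: exp_double[symmetric] mult.assoc)
      then show ?thesis by (simp add: f_def power2_diff power_mult_distrib)
    qed
    then show "integrable M (\<lambda>\<omega>. (f (W t \<omega> - W s \<omega>))\<^sup>2)"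
      using e(1) by simp
    \<comment> \<open>This cancellation is the reason for the exponent \<open>k\<close> of the scale
      function: \<open>k * \<mu> + (k * \<sigma>)\<^sup>2 / 2 = 0\<close>.\<close>
    have "k * \<mu> * (t - s) + (k * \<sigma>)\<^sup>2 * (t - s) / 2 = 0"
      using \<sigma>_pos by (simp add: k_def field_simps power2_eq_square)
    then have "exp (k * \<mu> * (t - s)) * exp ((k * \<sigma>)\<^sup>2 * (sqrt (t - s))\<^sup>2 / 2) = 1"
      using st by (simp add: exp_add[symmetric])
    then show "expectation (\<lambda>\<omega>. f (W t \<omega> - W s \<omega>)) = 0"
      using e by (simp add: f_def prob_space)
    fix \<omega>
    have h: "h y = (exp (k * y) - 1) / D" for y
      using False by (simp add: scale_fun_def k_def D_def)
    have "exp (k * drift x t \<omega>) = exp (k * drift x s \<omega>) * (exp (k * \<mu> * (t - s)) * exp (k * \<sigma> * (W t \<omega> - W s \<omega>)))"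
      unfolding exp_add[symmetric] by (simp add: drift_def algebra_simps)
    then show "h (drift x t \<omega>) = h (drift x s \<omega>) + Y \<omega> * f (W t \<omega> - W s \<omega>)"
      unfolding h by (simp add: Y_def f_def diff_divide_distrib algebra_simps)
  qed
qed

lemma h_drift_martingale: "continuous_L2_martingale M \<FF> (\<lambda>t \<omega>. h (drift x t \<omega>))"
proof
  fix t show "subalgebra M (\<FF> t)" by (rule subalgebra_\<FF>)
next
  fix t :: real assume "0 \<le> t"
  then show "(\<lambda>\<omega>. h (drift x t \<omega>)) \<in> borel_measurable (\<FF> (ennreal t))"
    using drift_adapted[of t x] by measurable
next
  fix \<omega> assume "\<omega> \<in> space M"
  then show "continuous_on {0..} (\<lambda>t. h (drift x t \<omega>))"
    by (intro continuous_on_compose2[OF continuous_on_scale_fun[of UNIV] drift_continuous]) auto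
next
  fix t :: real assume "0 \<le> t"
  then show "integrable M (\<lambda>\<omega>. (h (drift x t \<omega>))\<^sup>2)" by (rule h_drift_sq_integrable)
next
  fix s t :: real and A assume st: "0 \<le> s" "s \<le> t" and A: "A \<in> sets (\<FF> (ennreal s))"
  have "expectation (\<lambda>\<omega>. indicator A \<omega> * h (drift x s \<omega>)) = expectation (\<lambda>\<omega>. indicator A \<omega> * h (drift x t \<omega>)) \<and>
    expectation (\<lambda>\<omega>. indicator A \<omega> * (h (drift x s \<omega>))\<^sup>2) \<le> expectation (\<lambda>\<omega>. indicator A \<omega> * (h (drift x t \<omega>))\<^sup>2)"
  proof (cases "s = t")
    case False
    then have lt: "s < t" using st by simp
    obtain Y f where *: "Y \<in> borel_measurable (\<FF> (ennreal s))" "integrable M (\<lambda>\<omega>. (Y \<omega>)\<^sup>2)"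
      "f \<in> borel_measurable borel" "integrable M (\<lambda>\<omega>. (f (W t \<omega> - W s \<omega>))\<^sup>2)"
      "expectation (\<lambda>\<omega>. f (W t \<omega> - W s \<omega>)) = 0"
      "\<And>\<omega>. h (drift x t \<omega>) = h (drift x s \<omega>) + Y \<omega> * f (W t \<omega> - W s \<omega>)"
      by (rule h_drift_increment[OF st(1) lt, where x = x]) (rule that)
    have V: "(\<lambda>\<omega>. h (drift x s \<omega>)) \<in> borel_measurable (\<FF> (ennreal s))"
      using drift_adapted[OF st(1), of x] by measurable
    show ?thesis
      unfolding *(6)
      using martingale_step[OF st(1) lt V h_drift_sq_integrable[OF st(1)] *(1-5) A] by blast
  qed simp
  then show "expectation (\<lambda>\<omega>. indicator A \<omega> * h (drift x s \<omega>)) = expectation (\<lambda>\<omega>. indicator A \<omega> * h (drift x t \<omega>))"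
    "expectation (\<lambda>\<omega>. indicator A \<omega> * (h (drift x s \<omega>))\<^sup>2) \<le> expectation (\<lambda>\<omega>. indicator A \<omega> * (h (drift x t \<omega>))\<^sup>2)"
    by blast+
qed

section \<open>Absorption at zero\<close>

lemma drift_at_measurable [measurable]:
  assumes [measurable]: "r \<in> borel_measurable M" and "\<And>\<omega>. 0 \<le> r \<omega>"
  shows "(\<lambda>\<omega>. drift x (r \<omega>) \<omega>) \<in> borel_measurable M"
  by (rule measurable_continuous_process_at) (use assms drift_continuous in auto)

text \<open>\<open>hitting_time\<close> looks for nonpositive values; the absolute value turns these
  into zeros, which is what \<open>absorbed_bm\<close> tests for.\<close>

definition absorption_time :: "real \<Rightarrow> 'w \<Rightarrow> ennreal" where
  "absorption_time x = hitting_time (\<lambda>t \<omega>. \<bar>drift x t \<omega>\<bar>)"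

lemma stopping_time_absorption_time: "stopping_time \<FF> (absorption_time x)"
  unfolding absorption_time_def
proof (rule stopping_time_hitting_time[where \<Omega> = "space M"])
  show "filtration (space M) \<FF>" by unfold_locales
  show "(\<lambda>\<omega>. \<bar>drift x t \<omega>\<bar>) \<in> borel_measurable (\<FF> (ennreal t))" if "0 \<le> t" for t
    using drift_adapted[OF that, of x] by measurable
  show "continuous_on {0..} (\<lambda>t. \<bar>drift x t \<omega>\<bar>)" if "\<omega> \<in> space M" for \<omega>
    by (intro continuous_on_rabs drift_continuous that)
qed

lemma stopping_time_measurable: "stopping_time \<FF> \<tau> \<Longrightarrow> \<tau> \<in> borel_measurable M"
  by (rule measurable_stopping_time[of \<FF> \<tau> M]) (use subalgebra_\<FF> in \<open>auto simp: subalgebra_def\<close>)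

lemma absorbed_eq_0_iff:
  assumes "\<omega> \<in> space M" "0 \<le> t"
  shows "(\<exists>s\<in>{0..t}. x + \<mu> * s + \<sigma> * W s \<omega> = 0) \<longleftrightarrow> absorption_time x \<omega> \<le> ennreal t"
  using hitting_time_le_iff[of "\<lambda>t \<omega>. \<bar>drift x t \<omega>\<bar>" \<omega> t, OF continuous_on_rabs[OF drift_continuous[OF assms(1)]] assms(2)]
  by (simp add: absorption_time_def drift_def)

lemma drift_absorption_time:
  assumes "\<omega> \<in> space M" "absorption_time x \<omega> < \<infinity>"
  shows "drift x (enn2real (absorption_time x \<omega>)) \<omega> = 0"
  using hitting_time_attained[of "\<lambda>t \<omega>. \<bar>drift x t \<omega>\<bar>" \<omega>, OF continuous_on_rabs[OF drift_continuous[OF assms(1)]]] assms(2)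
  by (simp add: absorption_time_def)

text \<open>The drifted path vanishes at its absorption time, so absorbing it is the same as
  stopping it there. Every stopped absorbed value thereby becomes a stopped value of the unabsorbed
  process, to which optional stopping applies.\<close>

lemma absorbed_bm_eq_drift:
  assumes "\<omega> \<in> space M" "0 \<le> t"
  shows "absorbed_bm W \<mu> \<sigma> x t \<omega> = drift x (enn2real (min (ennreal t) (absorption_time x \<omega>))) \<omega>"
proof (cases "absorption_time x \<omega> \<le> ennreal t")
  case True
  then have "absorption_time x \<omega> < \<infinity>" by (auto intro: le_less_trans)
  with drift_absorption_time[OF assms(1)] True show ?thesis
    by (simp add: absorbed_bm_def absorbed_eq_0_iff[OF assms] min_absorb2)
next
  case False
  then show ?thesis using assms
    by (simp add: absorbed_bm_def absorbed_eq_0_iff[OF assms] min_absorb1 drift_def)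
qed

text \<open>A negative value would, by the intermediate value theorem, require a zero strictly
  before \<open>t\<close>.\<close>

lemma drift_nonneg_before_absorption:
  assumes \<omega>: "\<omega> \<in> space M" and x: "0 \<le> x" and t: "0 \<le> t" "ennreal t \<le> absorption_time x \<omega>"
  shows "0 \<le> drift x t \<omega>"
proof (rule ccontr)
  assume neg: "\<not> 0 \<le> drift x t \<omega>"
  have "\<exists>s\<ge>0. s \<le> t \<and> drift x s \<omega> = 0"
    using neg x \<omega> t by (intro IVT2') (auto intro: continuous_on_subset[OF drift_continuous])
  then obtain s where s: "0 \<le> s" "s \<le> t" "drift x s \<omega> = 0" by blast
  then have "s < t" using neg by (cases "s = t") auto
  then have "ennreal s < absorption_time x \<omega>"
    using s(1) t by (intro less_le_trans[OF _ t(2)]) (simp add: ennreal_less_iff)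
  then show False
    using hitting_time_pos_before[OF s(1), of "\<lambda>t \<omega>. \<bar>drift x t \<omega>\<bar>"] s by (simp add: absorption_time_def)
qed

lemma stopped_value_eq_drift:
  assumes "\<omega> \<in> space M"
  shows "stopped_value W \<mu> \<sigma> x \<tau> \<omega> = drift x (enn2real (min (ennreal (enn2real (\<tau> \<omega>))) (absorption_time x \<omega>))) \<omega>"
  by (simp add: stopped_value_def absorbed_bm_eq_drift[OF assms])

lemma stopped_value_measurable [measurable]:
  assumes "stopping_time \<FF> \<tau>"
  shows "stopped_value W \<mu> \<sigma> x \<tau> \<in> borel_measurable M"
proof -
  note [measurable] = stopping_time_measurable[OF assms] stopping_time_measurable[OF stopping_time_absorption_time]
  show ?thesis
    by (subst measurable_cong[OF stopped_value_eq_drift]) (assumption, measurable)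
qed

lemma stopped_value_nonneg:
  assumes "\<omega> \<in> space M" "0 \<le> x"
  shows "0 \<le> stopped_value W \<mu> \<sigma> x \<tau> \<omega>"
  unfolding stopped_value_eq_drift[OF assms(1)]
proof (rule drift_nonneg_before_absorption[OF assms enn2real_nonneg])
  have fin: "min (ennreal (enn2real (\<tau> \<omega>))) (absorption_time x \<omega>) < top" by (simp add: min_less_iff_disj)
  show "ennreal (enn2real (min (ennreal (enn2real (\<tau> \<omega>))) (absorption_time x \<omega>))) \<le> absorption_time x \<omega>"
    by (simp only: ennreal_enn2real[OF fin] min.cobounded2)
qed

text \<open>Optional stopping gives equality at the truncated times
  \<open>min (\<rho> \<omega>) n\<close>. Nonnegativity up to absorption allows Fatou's lemma in the
  limit \<open>n \<rightarrow> \<infinity>\<close>, and this is where equality turns into an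
  inequality.\<close>

lemma scale_stopped_value_le:
  assumes \<tau>: "\<tau> \<in> finite_stopping_times M \<FF>" and x: "0 \<le> x"
  shows "integrable M (\<lambda>\<omega>. h (stopped_value W \<mu> \<sigma> x \<tau> \<omega>))"
    "expectation (\<lambda>\<omega>. h (stopped_value W \<mu> \<sigma> x \<tau> \<omega>)) \<le> h x"
proof -
  interpret N: continuous_L2_martingale M \<FF> "\<lambda>t \<omega>. h (drift x t \<omega>)" by (rule h_drift_martingale)
  have st: "stopping_time \<FF> \<tau>" and fin: "AE \<omega> in M. \<tau> \<omega> < \<infinity>" using \<tau> by (auto simp: finite_stopping_times_def)
  define \<rho> where "\<rho> \<omega> = min (\<tau> \<omega>) (absorption_time x \<omega>)" for \<omega>
  have st\<rho>: "stopping_time \<FF> \<rho>" unfolding \<rho>_def by (intro stopping_time_min st stopping_time_absorption_time)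
  have sets0: "space M \<in> sets (\<FF> 0)" by (metis sets.top space_F)
  note opt = N.optional_stopping_bounded[OF st\<rho> sets0]
  define Y where "Y n \<omega> = h (drift x (enn2real (min (\<rho> \<omega>) (of_nat n))) \<omega>)" for n \<omega>
  have Y_int: "integrable M (Y n)" for n using opt(2)[of n] by (simp add: Y_def[abs_def])
  have Y_nonneg: "0 \<le> Y n \<omega>" if "\<omega> \<in> space M" for n \<omega>
  proof -
    have fin: "min (\<rho> \<omega>) (of_nat n) < top" by (simp add: min_less_iff_disj ennreal_of_nat_eq_real_of_nat)
    have "ennreal (enn2real (min (\<rho> \<omega>) (of_nat n))) \<le> absorption_time x \<omega>"
      unfolding ennreal_enn2real[OF fin] by (simp add: \<rho>_def min_le_iff_disj)
    then show ?thesis unfolding Y_def by (simp add: drift_nonneg_before_absorption[OF that x])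
  qed
  have Y_exp: "expectation (Y n) = h x" for n
  proof -
    have "expectation (Y n) = expectation (\<lambda>\<omega>. indicator (space M) \<omega> * Y n \<omega>)"
      by (intro Bochner_Integration.integral_cong) auto
    also have "\<dots> = expectation (\<lambda>\<omega>. indicator (space M) \<omega> * h (drift x 0 \<omega>))"
      using opt(3)[of n] by (simp add: Y_def)
    also have "\<dots> = expectation (\<lambda>\<omega>. h x)"
      by (intro Bochner_Integration.integral_cong) auto
    finally show ?thesis by (simp add: prob_space)
  qed
  have lim: "AE \<omega> in M. (\<lambda>n. Y n \<omega>) \<longlonglongrightarrow> h (stopped_value W \<mu> \<sigma> x \<tau> \<omega>)"
    using fin AE_space
  proof eventually_elim
    case (elim \<omega>)
    then have \<rho>: "\<rho> \<omega> < top" by (auto simp: \<rho>_def min_less_iff_disj)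
    then obtain N :: nat where N: "\<rho> \<omega> < of_nat N" using ennreal_Ex_less_of_nat by blast
    \<comment> \<open>Once \<open>n\<close> exceeds the finite value of \<open>\<rho>\<close> the
      truncation is inactive, so the sequence is eventually constant.\<close>
    have "Y n \<omega> = h (stopped_value W \<mu> \<sigma> x \<tau> \<omega>)" if "n \<ge> N" for n
    proof -
      have "\<rho> \<omega> \<le> of_nat n" using N that by (meson less_imp_le of_nat_mono order_trans)
      then show ?thesis using elim
        by (simp add: Y_def stopped_value_eq_drift \<rho>_def min_absorb1)
    qed
    then show ?case by (intro tendsto_eventually) (auto simp: eventually_sequentially)
  qed
  have [measurable]: "Y n \<in> borel_measurable M" for n using Y_int by auto
  note [measurable] = stopped_value_measurable[OF st]
  have le: "(\<integral>\<^sup>+\<omega>. ennreal (h (stopped_value W \<mu> \<sigma> x \<tau> \<omega>)) \<partial>M) \<le> ennreal (h x)"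
  proof -
    have "(\<integral>\<^sup>+\<omega>. ennreal (h (stopped_value W \<mu> \<sigma> x \<tau> \<omega>)) \<partial>M) = (\<integral>\<^sup>+\<omega>. liminf (\<lambda>n. ennreal (Y n \<omega>)) \<partial>M)"
      using lim by (intro nn_integral_cong_AE)
         (auto elim!: eventually_mono intro!: lim_imp_Liminf[symmetric] tendsto_ennrealI)
    also have "\<dots> \<le> liminf (\<lambda>n. \<integral>\<^sup>+\<omega>. ennreal (Y n \<omega>) \<partial>M)" by (rule nn_integral_liminf) simp
    also have "\<dots> = liminf (\<lambda>n. ennreal (h x))"
      using Y_nonneg by (subst nn_integral_eq_integral[OF Y_int]) (auto simp: Y_exp)
    finally show ?thesis by (simp add: Liminf_const)
  qed
  have nonneg: "AE \<omega> in M. 0 \<le> h (stopped_value W \<mu> \<sigma> x \<tau> \<omega>)"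
    using stopped_value_nonneg[OF _ x] by simp
  show int: "integrable M (\<lambda>\<omega>. h (stopped_value W \<mu> \<sigma> x \<tau> \<omega>))"
    using le nonneg by (intro integrableI_nonneg) (auto intro: le_less_trans)
  show "expectation (\<lambda>\<omega>. h (stopped_value W \<mu> \<sigma> x \<tau> \<omega>)) \<le> h x"
    using le x by (simp add: nn_integral_eq_integral[OF int nonneg])
qed

end

section \<open>Exit from randomized intervals\<close>

text \<open>Length times the maximum of the density. As the standard deviation grows, windows of
  fixed length become negligible, which excludes staying in a bounded interval forever.\<close>

lemma (in prob_space) normal_interval_bound:
  assumes Z: "distributed M lborel Z (normal_density 0 s)" and s: "0 < s" and L: "0 \<le> L"
  shows "prob {\<omega>\<in>space M. Z \<omega> \<in> {c..c + L}} \<le> L / (sqrt (2 * pi) * s)"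
proof -
  have "emeasure M (Z -` {c..c + L} \<inter> space M) = (\<integral>\<^sup>+y. ennreal (normal_density 0 s y) * indicator {c..c + L} y \<partial>lborel)"
    by (rule distributed_emeasure[OF Z]) simp
  also have "\<dots> \<le> (\<integral>\<^sup>+y. ennreal (1 / (sqrt (2 * pi) * s)) * indicator {c..c + L} y \<partial>lborel)"
  proof (intro nn_integral_mono mult_right_mono ennreal_leI)
    fix y
    have "normal_density 0 s y \<le> 1 / sqrt (2 * pi * s\<^sup>2) * 1"
      unfolding normal_density_def by (intro mult_left_mono) auto
    then show "normal_density 0 s y \<le> 1 / (sqrt (2 * pi) * s)"
      using s by (simp add: real_sqrt_mult)
  qed simp
  also have "\<dots> = ennreal (L / (sqrt (2 * pi) * s))"
    using L s by (simp add: nn_integral_cmult_indicator ennreal_mult'[symmetric])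
  also have "Z -` {c..c + L} \<inter> space M = {\<omega>\<in>space M. Z \<omega> \<in> {c..c + L}}" by auto
  finally show ?thesis
    using s L by (simp add: emeasure_eq_measure)
qed

section \<open>Exit times of intervals with random end points\<close>

context drifted_brownian_motion
begin

text \<open>The ends may depend on \<open>\<omega>\<close>; taking them measurable at time 0 is the
  way in which \<open>U\<close> randomizes the stopping rule. Equal ends \<open>a = b = x\<close>
  encode immediate stopping.\<close>

definition exit_time :: "real \<Rightarrow> ('w \<Rightarrow> real) \<Rightarrow> ('w \<Rightarrow> real) \<Rightarrow> 'w \<Rightarrow> ennreal" where
  "exit_time x a b = hitting_time (\<lambda>t \<omega>. min (drift x t \<omega> - a \<omega>) (b \<omega> - drift x t \<omega>))"

lemma exit_continuous:
  "\<omega> \<in> space M \<Longrightarrow> continuous_on {0..} (\<lambda>t. min (drift x t \<omega> - a \<omega>) (b \<omega> - drift x t \<omega>))"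
  by (intro continuous_intros drift_continuous)

context
  fixes x B :: real and a b :: "'w \<Rightarrow> real"
  assumes a_meas: "a \<in> borel_measurable (\<FF> 0)" and b_meas: "b \<in> borel_measurable (\<FF> 0)"
    and ab: "\<And>\<omega>. \<omega> \<in> space M \<Longrightarrow> 0 \<le> a \<omega> \<and> a \<omega> \<le> x \<and> x \<le> b \<omega> \<and> b \<omega> \<le> B"
begin

lemma ab_measurable [measurable]: "a \<in> borel_measurable M" "b \<in> borel_measurable M"
  using \<FF>_measurable_M a_meas b_meas by auto

lemma B_nonneg: "0 \<le> B"
  using not_empty ab by fastforce

lemma stopping_time_exit_time: "stopping_time \<FF> (exit_time x a b)"
  unfolding exit_time_def
proof (rule stopping_time_hitting_time[where \<Omega> = "space M"])
  show "filtration (space M) \<FF>" by unfold_locales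
  show "(\<lambda>\<omega>. min (drift x t \<omega> - a \<omega>) (b \<omega> - drift x t \<omega>)) \<in> borel_measurable (\<FF> (ennreal t))" if "0 \<le> t" for t
    using drift_adapted[OF that, of x] \<FF>_mono_measurable[OF _ a_meas, of "ennreal t"]
      \<FF>_mono_measurable[OF _ b_meas, of "ennreal t"] by simp
qed (rule exit_continuous)

lemma before_exit:
  assumes "0 \<le> t" "ennreal t < exit_time x a b \<omega>"
  shows "a \<omega> < drift x t \<omega>" "drift x t \<omega> < b \<omega>"
  using hitting_time_pos_before[OF assms[unfolded exit_time_def]] by simp_all

text \<open>A path that never leaves has, at each time \<open>Suc n\<close>, its Brownian value in a
  window of fixed length \<open>B / \<sigma>\<close>, an event of probability of order
  \<open>1 / sqrt n\<close>.\<close>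

lemma exit_time_AE_finite: "AE \<omega> in M. exit_time x a b \<omega> < \<infinity>"
proof -
  note [measurable] = stopping_time_measurable[OF stopping_time_exit_time]
  let ?S = "{\<omega>\<in>space M. exit_time x a b \<omega> = \<infinity>}"
  have bound: "prob ?S \<le> B / \<sigma> / (sqrt (2 * pi) * sqrt (real (Suc n)))" for n
  proof -
    let ?t = "real (Suc n)"
    \<comment> \<open>The Brownian value at which \<open>drift\<close> is 0 at time
      \<open>?t\<close>: the lower end of the window matching drift values between 0 and
      \<open>B\<close>.\<close>
    define c where "c = (- x - \<mu> * ?t) / \<sigma>"
    have t: "0 < ?t" by simp
    have [measurable]: "W 0 \<in> borel_measurable M" "W ?t \<in> borel_measurable M" by (rule W_measurable, simp)+
    have "?S \<subseteq> {\<omega>\<in>space M. W ?t \<omega> - W 0 \<omega> \<in> {c..c + B / \<sigma>}}"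
    proof safe
      fix \<omega> assume \<omega>: "\<omega> \<in> space M" and "exit_time x a b \<omega> = \<infinity>"
      then have "0 \<le> drift x ?t \<omega>" "drift x ?t \<omega> \<le> B"
        using before_exit[of ?t \<omega>] ab[OF \<omega>] by (auto simp del: of_nat_Suc)
      then show "W ?t \<omega> - W 0 \<omega> \<in> {c..c + B / \<sigma>}"
        using \<sigma>_pos W_zero[OF \<omega>] by (auto simp: c_def drift_def field_simps simp del: of_nat_Suc)
    qed
    then have "prob ?S \<le> prob {\<omega>\<in>space M. W ?t \<omega> - W 0 \<omega> \<in> {c..c + B / \<sigma>}}"
      by (rule finite_measure_mono) measurable
    also have "\<dots> \<le> B / \<sigma> / (sqrt (2 * pi) * sqrt ?t)"
      using normal_interval_bound[OF W_increment_normal[OF order_refl t], of "B / \<sigma>" c] B_nonneg \<sigma>_pos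
      by simp
    finally show ?thesis .
  qed
  have "(\<lambda>n. B / \<sigma> / (sqrt (2 * pi) * sqrt (real (Suc n)))) \<longlonglongrightarrow> 0"
  proof -
    have "filterlim (\<lambda>n. sqrt (real (Suc n))) at_top sequentially"
      by (intro filterlim_compose[OF sqrt_at_top] filterlim_compose[OF filterlim_real_sequentially filterlim_Suc])
    then have "filterlim (\<lambda>n. sqrt (2 * pi) * sqrt (real (Suc n))) at_top sequentially"
      by (intro filterlim_tendsto_pos_mult_at_top[OF tendsto_const]) auto
    then show ?thesis
      by (intro tendsto_divide_0[OF tendsto_const] filterlim_at_top_imp_at_infinity)
  qed
  then have "prob ?S \<le> 0"
    using bound by (intro LIMSEQ_le_const) auto
  then have "prob ?S = 0" using measure_nonneg[of M ?S] by linarith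
  then have "AE \<omega> in M. \<omega> \<notin> ?S"
    by (subst (asm) prob_eq_0) auto
  then show ?thesis using AE_space by eventually_elim (auto simp: less_top)
qed

lemma exit_time_finite_stopping: "exit_time x a b \<in> finite_stopping_times M \<FF>"
  using stopping_time_exit_time exit_time_AE_finite by (simp add: finite_stopping_times_def)

lemma exit_zero:
  assumes \<omega>: "\<omega> \<in> space M" and fin: "exit_time x a b \<omega> < \<infinity>"
  defines "T \<equiv> enn2real (exit_time x a b \<omega>)"
  shows "min (drift x T \<omega> - a \<omega>) (b \<omega> - drift x T \<omega>) = 0"
  unfolding T_def exit_time_def
  by (rule hitting_time_zero[where Y = "\<lambda>t \<omega>. min (drift x t \<omega> - a \<omega>) (b \<omega> - drift x t \<omega>)"])
     (use exit_continuous[OF \<omega>] fin ab[OF \<omega>] \<omega> in \<open>auto simp: exit_time_def\<close>)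

lemma until_exit:
  assumes \<omega>: "\<omega> \<in> space M" and t: "0 \<le> t" "ennreal t \<le> exit_time x a b \<omega>"
  shows "a \<omega> \<le> drift x t \<omega>" "drift x t \<omega> \<le> b \<omega>"
proof -
  have "a \<omega> \<le> drift x t \<omega> \<and> drift x t \<omega> \<le> b \<omega>"
  proof (cases "ennreal t < exit_time x a b \<omega>")
    case True
    then show ?thesis using before_exit[OF t(1)] by (auto intro: less_imp_le)
  next
    case False
    then have eq: "exit_time x a b \<omega> = ennreal t" using t by simp
    then have "enn2real (exit_time x a b \<omega>) = t" using t by simp
    then show ?thesis
      using exit_zero[OF \<omega>] eq by (simp add: min_def split: if_splits)
  qed
  then show "a \<omega> \<le> drift x t \<omega>" "drift x t \<omega> \<le> b \<omega>" by auto
qed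

lemma drift_at_exit:
  assumes \<omega>: "\<omega> \<in> space M" and fin: "exit_time x a b \<omega> < \<infinity>"
  shows "drift x (enn2real (exit_time x a b \<omega>)) \<omega> \<in> {a \<omega>, b \<omega>}"
  using exit_zero[OF \<omega> fin] by (auto simp: min_def split: if_splits)

text \<open>Absorption cannot come strictly first: before exit the path stays strictly above
  \<open>a\<close>, and \<open>a\<close> is nonnegative.\<close>

lemma stopped_value_exit:
  assumes \<omega>: "\<omega> \<in> space M" and fin: "exit_time x a b \<omega> < \<infinity>"
  shows "stopped_value W \<mu> \<sigma> x (exit_time x a b) \<omega> = drift x (enn2real (exit_time x a b \<omega>)) \<omega>"
proof (cases "exit_time x a b \<omega> \<le> absorption_time x \<omega>")
  case True
  then show ?thesis using fin by (simp add: stopped_value_eq_drift[OF \<omega>] min_absorb1)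
next
  case False
  then have less: "absorption_time x \<omega> < exit_time x a b \<omega>" by simp
  then have afin: "absorption_time x \<omega> < \<infinity>" using fin by (auto intro: less_trans)
  then have "a \<omega> < drift x (enn2real (absorption_time x \<omega>)) \<omega>"
    using less by (intro before_exit) auto
  then have False using drift_absorption_time[OF \<omega> afin] ab[OF \<omega>] by simp
  then show ?thesis ..
qed

text \<open>Up to exit the scale values lie between 0 and \<open>h B\<close>, so dominated
  convergence preserves the equality of optional stopping. Letting \<open>A\<close> range over the
  events of time 0 makes this a statement conditional on the chosen ends.\<close>

lemma scale_at_exit:
  assumes A: "A \<in> sets (\<FF> 0)"
  shows "integrable M (\<lambda>\<omega>. h (stopped_value W \<mu> \<sigma> x (exit_time x a b) \<omega>))"
    "expectation (\<lambda>\<omega>. indicator A \<omega> * h (stopped_value W \<mu> \<sigma> x (exit_time x a b) \<omega>)) = prob A * h x"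
proof -
  interpret N: continuous_L2_martingale M \<FF> "\<lambda>t \<omega>. h (drift x t \<omega>)" by (rule h_drift_martingale)
  let ?T = "exit_time x a b"
  note opt = N.optional_stopping_bounded[OF stopping_time_exit_time A]
  have [measurable]: "A \<in> sets M" using A by (rule N.sets_F_M)
  obtain \<omega>0 where \<omega>0: "\<omega>0 \<in> space M" using not_empty by blast
  have x: "0 \<le> x" using ab[OF \<omega>0] by simp
  define Y where "Y n \<omega> = h (drift x (enn2real (min (?T \<omega>) (of_nat n))) \<omega>)" for n \<omega>
  have Y_m[measurable]: "Y n \<in> borel_measurable M" for n using opt(1)[of n] by (simp add: Y_def[abs_def])
  have Y_bound: "0 \<le> Y n \<omega>" "Y n \<omega> \<le> h B" if "\<omega> \<in> space M" for n \<omega>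
  proof -
    have fin: "min (?T \<omega>) (of_nat n) < top" by (simp add: min_less_iff_disj ennreal_of_nat_eq_real_of_nat)
    have "ennreal (enn2real (min (?T \<omega>) (of_nat n))) \<le> ?T \<omega>"
      unfolding ennreal_enn2real[OF fin] by simp
    from until_exit[OF that _ this] ab[OF that] show "0 \<le> Y n \<omega>" "Y n \<omega> \<le> h B"
      by (auto simp: Y_def)
  qed
  have lim: "AE \<omega> in M. (\<lambda>n. Y n \<omega>) \<longlonglongrightarrow> h (stopped_value W \<mu> \<sigma> x ?T \<omega>)"
    using exit_time_AE_finite AE_space
  proof eventually_elim
    case (elim \<omega>)
    then obtain N :: nat where N: "?T \<omega> < of_nat N" using ennreal_Ex_less_of_nat by auto
    have "Y n \<omega> = h (stopped_value W \<mu> \<sigma> x ?T \<omega>)" if "n \<ge> N" for n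
    proof -
      have "?T \<omega> \<le> of_nat n" using N that by (meson less_imp_le of_nat_mono order_trans)
      then show ?thesis using elim by (simp add: Y_def stopped_value_exit min_absorb1)
    qed
    then show ?case by (intro tendsto_eventually) (auto simp: eventually_sequentially)
  qed
  note [measurable] = stopped_value_measurable[OF stopping_time_exit_time]
  have Yi: "integrable M (Y n)" for n
    by (rule integrable_const_bound[where B = "h B"]) (use Y_bound in auto)
  show "integrable M (\<lambda>\<omega>. h (stopped_value W \<mu> \<sigma> x ?T \<omega>))"
    by (rule scale_stopped_value_le(1)[OF exit_time_finite_stopping x])
  have "(\<lambda>n. expectation (\<lambda>\<omega>. indicator A \<omega> * Y n \<omega>)) \<longlonglongrightarrow> expectation (\<lambda>\<omega>. indicator A \<omega> * h (stopped_value W \<mu> \<sigma> x ?T \<omega>))"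
  proof (rule integral_dominated_convergence[where w = "\<lambda>_. h B"])
    show "AE \<omega> in M. (\<lambda>n. indicator A \<omega> * Y n \<omega>) \<longlonglongrightarrow> indicator A \<omega> * h (stopped_value W \<mu> \<sigma> x ?T \<omega>)"
      using lim by eventually_elim (intro tendsto_mult tendsto_const)
    show "AE \<omega> in M. norm (indicator A \<omega> * Y n \<omega>) \<le> h B" for n
      using AE_space by eventually_elim (use Y_bound B_nonneg in \<open>auto simp: indicator_def\<close>)
  qed auto
  moreover have "expectation (\<lambda>\<omega>. indicator A \<omega> * Y n \<omega>) = prob A * h x" for n
  proof -
    have "expectation (\<lambda>\<omega>. indicator A \<omega> * Y n \<omega>) = expectation (\<lambda>\<omega>. indicator A \<omega> * h (drift x 0 \<omega>))"
      using opt(3)[of n] by (simp add: Y_def)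
    also have "\<dots> = expectation (\<lambda>\<omega>. indicator A \<omega> * h x)"
      by (intro Bochner_Integration.integral_cong) auto
    finally show ?thesis by simp
  qed
  ultimately show "expectation (\<lambda>\<omega>. indicator A \<omega> * h (stopped_value W \<mu> \<sigma> x ?T \<omega>)) = prob A * h x"
    by (simp add: LIMSEQ_const_iff)
qed

text \<open>A function on two points is affine in \<open>h\<close>, so \<open>f\<close> at exit
  equals \<open>f (a \<omega>)\<close> plus a multiple \<open>C\<close> of the scale increment. As
  \<open>C\<close> is known at time 0, it can be pulled out of the conditional expectation. The
  integrand on the right is the gambler's-ruin formula for the ends drawn.\<close>

lemma expectation_at_exit:
  fixes f :: "real \<Rightarrow> real"
  assumes f[measurable]: "f \<in> borel_measurable borel" and K: "\<And>y. \<bar>f y\<bar> \<le> K"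
  shows "expectation (\<lambda>\<omega>. f (stopped_value W \<mu> \<sigma> x (exit_time x a b) \<omega>)) =
    expectation (\<lambda>\<omega>. if a \<omega> = b \<omega> then f x else
      (f (a \<omega>) * (h (b \<omega>) - h x) + f (b \<omega>) * (h x - h (a \<omega>))) / (h (b \<omega>) - h (a \<omega>)))"
proof -
  interpret F0: finite_measure_subalgebra M "\<FF> 0"
    by standard (rule subalgebra_\<FF>)
  let ?S = "stopped_value W \<mu> \<sigma> x (exit_time x a b)"
  note [measurable] = stopped_value_measurable[OF stopping_time_exit_time]
  \<comment> \<open>If the ends coincide, the quotient is 0 by convention; this is consistent, since
    the stopped value is then \<open>a \<omega>\<close>.\<close>
  define C where "C \<omega> = (f (b \<omega>) - f (a \<omega>)) / (h (b \<omega>) - h (a \<omega>))" for \<omega>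
  define g where "g \<omega> = h (?S \<omega>) - h (a \<omega>)" for \<omega>
  have C_meas: "C \<in> borel_measurable (\<FF> 0)" unfolding C_def[abs_def] using a_meas b_meas by measurable
  have [measurable]: "C \<in> borel_measurable M" "g \<in> borel_measurable M"
    unfolding C_def[abs_def] g_def[abs_def] by measurable
  have h_a_int: "integrable M (\<lambda>\<omega>. h (a \<omega>))"
    by (rule integrable_const_bound[where B = "h B"]) (use ab B_nonneg in \<open>force intro!: AE_I2\<close>)+
  have g_int: "integrable M g" unfolding g_def[abs_def]
    by (intro Bochner_Integration.integrable_diff scale_at_exit(1)[of "{}"] h_a_int) simp
  have eq: "AE \<omega> in M. C \<omega> * g \<omega> = f (?S \<omega>) - f (a \<omega>)"
    using exit_time_AE_finite AE_space
  proof eventually_elim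
    case (elim \<omega>)
    then have "?S \<omega> = a \<omega> \<or> ?S \<omega> = b \<omega>" using drift_at_exit[of \<omega>] by (simp add: stopped_value_exit)
    then show ?case by (cases "a \<omega> = b \<omega>") (auto simp: C_def g_def)
  qed
  \<comment> \<open>Testing on events of time 0 is precisely \<open>scale_at_exit\<close>.\<close>
  have rce: "AE \<omega> in M. real_cond_exp M (\<FF> 0) g \<omega> = h x - h (a \<omega>)"
  proof (rule F0.real_cond_exp_charact)
    fix A assume A: "A \<in> sets (\<FF> 0)"
    then have [measurable]: "A \<in> sets M" using subalgebra_\<FF> by (auto simp: subalgebra_def)
    have i: "integrable M (\<lambda>\<omega>. indicator A \<omega> * h (?S \<omega>))" "integrable M (\<lambda>\<omega>. indicator A \<omega> * h (a \<omega>))"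
      using integrable_mult_indicator[OF _ scale_at_exit(1)[OF A], of A] integrable_mult_indicator[OF _ h_a_int, of A]
      by simp_all
    have "(\<integral>\<omega>\<in>A. g \<omega> \<partial>M) = expectation (\<lambda>\<omega>. indicator A \<omega> * h (?S \<omega>) - indicator A \<omega> * h (a \<omega>))"
      by (simp add: set_lebesgue_integral_def g_def algebra_simps)
    also have "\<dots> = prob A * h x - expectation (\<lambda>\<omega>. indicator A \<omega> * h (a \<omega>))"
      using i scale_at_exit(2)[OF A] by simp
    also have "\<dots> = expectation (\<lambda>\<omega>. indicator A \<omega> * h x - indicator A \<omega> * h (a \<omega>))"
      using integrable_mult_indicator[of A M "\<lambda>_. h x"]
      by (subst Bochner_Integration.integral_diff) (use i in auto)
    also have "\<dots> = (\<integral>\<omega>\<in>A. (h x - h (a \<omega>)) \<partial>M)"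
      by (simp add: set_lebesgue_integral_def algebra_simps)
    finally show "(\<integral>\<omega>\<in>A. g \<omega> \<partial>M) = (\<integral>\<omega>\<in>A. (h x - h (a \<omega>)) \<partial>M)" .
  qed (use g_int h_a_int a_meas in \<open>simp_all, measurable\<close>)
  have f_int: "integrable M (\<lambda>\<omega>. f (?S \<omega>))" "integrable M (\<lambda>\<omega>. f (a \<omega>))"
    by (rule integrable_const_bound[where B = K]; use K in simp)+
  have Cg_int: "integrable M (\<lambda>\<omega>. C \<omega> * g \<omega>)"
    using Bochner_Integration.integrable_diff[OF f_int] by (subst integrable_cong_AE[OF _ _ eq]) auto
  note ce = F0.real_cond_exp_intg[OF Cg_int C_meas \<open>g \<in> borel_measurable M\<close>]
  have eq2: "AE \<omega> in M. C \<omega> * real_cond_exp M (\<FF> 0) g \<omega> = C \<omega> * (h x - h (a \<omega>))"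
    using rce by eventually_elim simp
  have i2: "integrable M (\<lambda>\<omega>. C \<omega> * (h x - h (a \<omega>)))"
    using ce(1) by (subst (asm) integrable_cong_AE[OF _ _ eq2]) auto
  have "expectation (\<lambda>\<omega>. f (?S \<omega>)) = expectation (\<lambda>\<omega>. C \<omega> * g \<omega>) + expectation (\<lambda>\<omega>. f (a \<omega>))"
    using f_int by (subst integral_cong_AE[OF _ _ eq]) auto
  also have "expectation (\<lambda>\<omega>. C \<omega> * g \<omega>) = expectation (\<lambda>\<omega>. C \<omega> * (h x - h (a \<omega>)))"
    unfolding ce(2)[symmetric] by (rule integral_cong_AE[OF _ _ eq2]) auto
  also have "\<dots> + expectation (\<lambda>\<omega>. f (a \<omega>)) = expectation (\<lambda>\<omega>. C \<omega> * (h x - h (a \<omega>)) + f (a \<omega>))"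
    using i2 f_int by simp
  also have "\<dots> = expectation (\<lambda>\<omega>. if a \<omega> = b \<omega> then f x else
      (f (a \<omega>) * (h (b \<omega>) - h x) + f (b \<omega>) * (h x - h (a \<omega>))) / (h (b \<omega>) - h (a \<omega>)))"
  proof (intro Bochner_Integration.integral_cong refl)
    fix \<omega> assume \<omega>: "\<omega> \<in> space M"
    show "C \<omega> * (h x - h (a \<omega>)) + f (a \<omega>) = (if a \<omega> = b \<omega> then f x else
      (f (a \<omega>) * (h (b \<omega>) - h x) + f (b \<omega>) * (h x - h (a \<omega>))) / (h (b \<omega>) - h (a \<omega>)))"
    proof (cases "a \<omega> = b \<omega>")
      case True
      then have "a \<omega> = x" using ab[OF \<omega>] by simp
      then show ?thesis using True by (simp add: C_def)
    next
      case False
      then have "h (b \<omega>) - h (a \<omega>) \<noteq> 0" by simp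
      then show ?thesis using False by (simp add: C_def field_simps)
    qed
  qed
  finally show ?thesis .
qed

end

end

section \<open>Randomized Skorokhod embedding\<close>

text \<open>The open interval is the natural domain of quantile functions, which may be infinite at
  0 and 1; it is also the space on which \<open>cdf_distribution\<close> represents a law by its
  quantile function \<open>I\<close>.\<close>

abbreviation unit_lebesgue :: "real measure" where
  "unit_lebesgue \<equiv> restrict_space lborel {0<..<1}"

lemma prob_space_unit_lebesgue: "prob_space unit_lebesgue"
  by (auto simp: emeasure_restrict_space space_restrict_space intro!: prob_spaceI)

lemma measurable_unit_lebesgue:
  "f \<in> measurable borel N \<Longrightarrow> f \<in> measurable unit_lebesgue N"
  by (rule measurable_restrict_space1) (simp add: measurable_lborel1)

lemma nn_integral_unit_lebesgue:
  "(\<integral>\<^sup>+u. f u \<partial>unit_lebesgue) = (\<integral>\<^sup>+u. f u * indicator {0<..<1} u \<partial>lborel)"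
  by (rule nn_integral_restrict_space) simp

text \<open>\<open>I\<close> is the quantile function and \<open>C\<close> the cdf of the law with
  density \<open>w\<close>. A density has no atoms, so the cdf is continuous and \<open>C\<close>
  inverts \<open>I\<close> from the left; this makes the coupling below computable from either
  coordinate.\<close>

lemma density_quantile:
  fixes w :: "real \<Rightarrow> real"
  assumes [measurable]: "w \<in> borel_measurable borel" and one: "(\<integral>\<^sup>+u. ennreal (w u) \<partial>lborel) = 1"
  obtains C I :: "real \<Rightarrow> real" where
    "C \<in> borel_measurable borel" "I \<in> borel_measurable borel"
    "\<And>v. 0 < v \<Longrightarrow> v < 1 \<Longrightarrow> C (I v) = v"
    "\<And>F. F \<in> borel_measurable borel \<Longrightarrow>
       (\<integral>\<^sup>+u. ennreal (w u) * F u \<partial>lborel) = (\<integral>\<^sup>+v. F (I v) \<partial>unit_lebesgue)"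
proof -
  define P where "P = density lborel (\<lambda>u. ennreal (w u))"
  have "prob_space P" by (rule prob_spaceI) (simp add: P_def emeasure_density one)
  then have "real_distribution P"
    by (rule real_distribution.intro) (rule real_distribution_axioms.intro, simp only: P_def sets_density sets_lborel)
  then interpret P: cdf_distribution P by (simp add: cdf_distribution_def)
  have cont: "isCont (cdf P) x" for x
  proof -
    have "emeasure P {x} = (\<integral>\<^sup>+u. ennreal (w u) * indicator {x} u \<partial>lborel)"
      by (simp add: P_def emeasure_density)
    also have "\<dots> = (\<integral>\<^sup>+(u::real). 0 \<partial>lborel)"
    proof (rule nn_integral_cong_AE)
      show "AE u in lborel. ennreal (w u) * indicator {x} u = 0"
        using AE_lborel_singleton[of x] by eventually_elim simp
    qed
    finally have "measure P {x} = 0" by (simp add: measure_def)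
    then show ?thesis by (simp add: finite_borel_measure.isCont_cdf[OF P.finite_borel_measure_M])
  qed
  \<comment> \<open>Extended by 0 outside the open unit interval to be Borel on the whole
    line.\<close>
  define I where "I v = (if 0 < v \<and> v < 1 then P.I v else 0)" for v
  have "{v::real. 0 < v \<and> v < 1} = {0<..<1}" by auto
  then have [measurable]: "I \<in> borel_measurable borel"
    unfolding I_def[abs_def] using P.measurable_CI by (subst measurable_If_restrict_space_iff) auto
  show ?thesis
  proof (rule that)
    show "cdf P \<in> borel_measurable borel" by (rule P.measurable_C)
    show "I \<in> borel_measurable borel" by fact
    fix v :: real assume v: "0 < v" "v < 1"
    have "v \<le> cdf P (P.I v)" using P.pseudoinverse[OF v, of "P.I v"] by blast
    moreover have "cdf P (P.I v) \<le> v"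
    proof (rule tendsto_upperbound)
      show "(cdf P \<longlongrightarrow> cdf P (P.I v)) (at_left (P.I v))"
        using cont[of "P.I v"] by (simp add: isCont_def filterlim_at_split)
      show "\<forall>\<^sub>F x in at_left (P.I v). cdf P x \<le> v"
      proof (rule eventually_at_leftI[of "P.I v - 1"])
        fix x assume "x \<in> {P.I v - 1<..<P.I v}"
        then have "\<not> P.I v \<le> x" by simp
        then show "cdf P x \<le> v" using P.pseudoinverse[OF v, of x] by linarith
      qed simp
    qed simp
    ultimately show "cdf P (I v) = v" using v by (simp add: I_def)
  next
    fix F :: "real \<Rightarrow> ennreal" assume [measurable]: "F \<in> borel_measurable borel"
    have "(\<integral>\<^sup>+u. ennreal (w u) * F u \<partial>lborel) = (\<integral>\<^sup>+u. F u \<partial>P)"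
      by (simp add: P_def nn_integral_density)
    also have "\<dots> = (\<integral>\<^sup>+u. F u \<partial>distr unit_lebesgue borel P.I)"
      by (simp add: P.distr_I_eq_M)
    also have "\<dots> = (\<integral>\<^sup>+v. F (P.I v) \<partial>unit_lebesgue)"
    proof (rule nn_integral_distr)
      show "P.I \<in> measurable unit_lebesgue borel"
        using P.measurable_CI by (simp cong: measurable_cong_sets add: sets_restrict_space)
    qed simp
    also have "\<dots> = (\<integral>\<^sup>+v. F (I v) \<partial>unit_lebesgue)"
      by (intro nn_integral_cong) (auto simp: I_def space_restrict_space)
    finally show "(\<integral>\<^sup>+u. ennreal (w u) * F u \<partial>lborel) = (\<integral>\<^sup>+v. F (I v) \<partial>unit_lebesgue)" .
  qed
qed

text \<open>
  The values below and above the mean are paired by coupling the measures with densities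
  \<open>(1 - G)\<^sup>+\<close> and \<open>(G - 1)\<^sup>+\<close>; leaving \<open>(G u, G (\<theta> u))\<close> from the mean \<open>1\<close> then redistributes the
  uniform law of \<open>u\<close> onto itself.
\<close>

lemma mean_pairing:
  fixes G :: "real \<Rightarrow> real"
  assumes G[measurable]: "G \<in> borel_measurable borel" and Gi: "integrable unit_lebesgue G"
    and mean: "(LINT u|unit_lebesgue. G u) = 1" and nontriv: "\<not> (AE u in unit_lebesgue. G u = 1)"
  obtains \<theta> :: "real \<Rightarrow> real" where "\<theta> \<in> borel_measurable borel"
    "AE u in unit_lebesgue. G u < 1 \<longrightarrow> 1 < G (\<theta> u)"
    "AE u in unit_lebesgue. 1 < G u \<longrightarrow> G (\<theta> u) < 1"
    "\<And>f c. f \<in> borel_measurable borel \<Longrightarrow> c = (\<lambda>u. \<bar>1 - G u\<bar> / \<bar>G (\<theta> u) - G u\<bar>) \<Longrightarrow>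
       (\<integral>\<^sup>+u. ennreal (1 - c u) * f u + ennreal (c u) * f (\<theta> u) \<partial>unit_lebesgue) = (\<integral>\<^sup>+u. f u \<partial>unit_lebesgue)"
proof -
  interpret \<Omega>: prob_space unit_lebesgue by (rule prob_space_unit_lebesgue)
  let ?\<Omega> = "unit_lebesgue"
  \<comment> \<open>The common mass of the positive parts below and above the mean; it is the same
    on both sides because the mean is 1, and it normalizes both densities.\<close>
  define m where "m = (LINT u|?\<Omega>. max 0 (1 - G u))"
  have pi: "integrable ?\<Omega> (\<lambda>u. max 0 (1 - G u))" "integrable ?\<Omega> (\<lambda>u. max 0 (G u - 1))"
    using Gi by (auto intro!: integrable_max)
  have "(LINT u|?\<Omega>. max 0 (G u - 1)) - m = (LINT u|?\<Omega>. max 0 (G u - 1) - max 0 (1 - G u))"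
    using pi by (simp add: m_def)
  also have "\<dots> = (LINT u|?\<Omega>. G u - 1)" by (intro Bochner_Integration.integral_cong) auto
  also have "\<dots> = 0" using Gi mean \<Omega>.prob_space by simp
  finally have m': "(LINT u|?\<Omega>. max 0 (G u - 1)) = m" by simp
  have "m \<noteq> 0"
  proof
    assume "m = 0"
    then have "AE u in ?\<Omega>. max 0 (1 - G u) = 0" "AE u in ?\<Omega>. max 0 (G u - 1) = 0"
      using integral_nonneg_eq_0_iff_AE[OF pi(1)] integral_nonneg_eq_0_iff_AE[OF pi(2)] m'
      by (simp_all add: m_def)
    then have "AE u in ?\<Omega>. G u = 1" by eventually_elim (auto simp: max_def split: if_splits)
    with nontriv show False ..
  qed
  moreover have "0 \<le> m" unfolding m_def by simp
  ultimately have m: "0 < m" by simp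
  define wA where "wA u = max 0 (1 - G u) / m * indicator {0<..<1} u" for u
  define wB where "wB u = max 0 (G u - 1) / m * indicator {0<..<1} u" for u
  have [measurable]: "wA \<in> borel_measurable borel" "wB \<in> borel_measurable borel"
    unfolding wA_def[abs_def] wB_def[abs_def] by measurable
  have one: "(\<integral>\<^sup>+u. ennreal (g u / m * indicator {0<..<1} u) \<partial>lborel) = 1"
    if "integrable ?\<Omega> g" "(LINT u|?\<Omega>. g u) = m" "\<And>u. 0 \<le> g u" for g
  proof -
    have "(\<integral>\<^sup>+u. ennreal (g u / m * indicator {0<..<1} u) \<partial>lborel) = (\<integral>\<^sup>+u. ennreal (g u / m) \<partial>?\<Omega>)"
      unfolding nn_integral_unit_lebesgue
      by (intro nn_integral_cong) (auto simp: indicator_def)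
    also have "\<dots> = ennreal (LINT u|?\<Omega>. g u / m)"
      using that m by (intro nn_integral_eq_integral) auto
    finally show ?thesis using that m by simp
  qed
  obtain CA IA where A[measurable]: "CA \<in> borel_measurable borel" "IA \<in> borel_measurable borel"
    and CIA: "\<And>v. 0 < v \<Longrightarrow> v < 1 \<Longrightarrow> CA (IA v) = v"
    and intA: "\<And>F. F \<in> borel_measurable borel \<Longrightarrow> (\<integral>\<^sup>+u. ennreal (wA u) * F u \<partial>lborel) = (\<integral>\<^sup>+v. F (IA v) \<partial>?\<Omega>)"
    by (rule density_quantile[of wA]) (use one[OF pi(1)] in \<open>simp_all add: m_def[symmetric] wA_def[abs_def] that\<close>)
  obtain CB IB where B[measurable]: "CB \<in> borel_measurable borel" "IB \<in> borel_measurable borel"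
    and CIB: "\<And>v. 0 < v \<Longrightarrow> v < 1 \<Longrightarrow> CB (IB v) = v"
    and intB: "\<And>F. F \<in> borel_measurable borel \<Longrightarrow> (\<integral>\<^sup>+u. ennreal (wB u) * F u \<partial>lborel) = (\<integral>\<^sup>+v. F (IB v) \<partial>?\<Omega>)"
    by (rule density_quantile[of wB]) (use one[OF pi(2) m'] in \<open>simp_all add: wB_def[abs_def] that\<close>)
  \<comment> \<open>The partner of \<open>u\<close> shares its uniform coordinate: \<open>CA\<close>
    reads it off on the lower side and \<open>IB\<close> places it on the upper side, and
    conversely.\<close>
  define \<theta> where "\<theta> u = (if G u < 1 then IB (CA u) else if 1 < G u then IA (CB u) else u)" for u
  have \<theta>_meas[measurable]: "\<theta> \<in> borel_measurable borel" unfolding \<theta>_def[abs_def] by measurable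
  have zeroA: "(\<integral>\<^sup>+v. indicator {v. 1 \<le> G v} (IA v) \<partial>?\<Omega>) = 0"
  proof -
    have "(\<integral>\<^sup>+v. indicator {v. 1 \<le> G v} (IA v) \<partial>?\<Omega>) = (\<integral>\<^sup>+u. ennreal (wA u) * indicator {v. 1 \<le> G v} u \<partial>lborel)"
      by (rule intA[symmetric]) measurable
    also have "\<dots> = (\<integral>\<^sup>+(u::real). 0 \<partial>lborel)"
      by (intro nn_integral_cong) (auto simp: wA_def indicator_def)
    finally show ?thesis by simp
  qed
  have zeroB: "(\<integral>\<^sup>+v. indicator {v. G v \<le> 1} (IB v) \<partial>?\<Omega>) = 0"
  proof -
    have "(\<integral>\<^sup>+v. indicator {v. G v \<le> 1} (IB v) \<partial>?\<Omega>) = (\<integral>\<^sup>+u. ennreal (wB u) * indicator {v. G v \<le> 1} u \<partial>lborel)"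
      by (rule intB[symmetric]) measurable
    also have "\<dots> = (\<integral>\<^sup>+(u::real). 0 \<partial>lborel)"
      by (intro nn_integral_cong) (auto simp: wB_def indicator_def)
    finally show ?thesis by simp
  qed
  have AE_of_zero: "AE u in ?\<Omega>. 0 < w u \<longrightarrow> u \<notin> S"
    if "(\<integral>\<^sup>+u. ennreal (w u) * indicator S u \<partial>lborel) = 0" and [measurable]: "w \<in> borel_measurable borel" "S \<in> sets borel" for w :: "real \<Rightarrow> real" and S
  proof -
    have "AE u in lborel. ennreal (w u) * indicator S u = 0"
      using that(1) by (subst (asm) nn_integral_0_iff_AE) auto
    then have "AE u in lborel. u \<in> {0<..<1} \<longrightarrow> 0 < w u \<longrightarrow> u \<notin> S"
      by eventually_elim (auto simp: indicator_def split: if_splits)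
    then show ?thesis by (subst AE_restrict_space_iff) auto
  qed
  have oppA: "AE u in ?\<Omega>. G u < 1 \<longrightarrow> 1 < G (\<theta> u)"
  proof -
    have "(\<integral>\<^sup>+u. ennreal (wA u) * indicator {u. G (IB (CA u)) \<le> 1} u \<partial>lborel)
      = (\<integral>\<^sup>+v. indicator {u. G (IB (CA u)) \<le> 1} (IA v) \<partial>?\<Omega>)" by (rule intA) measurable
    also have "\<dots> = (\<integral>\<^sup>+v. indicator {v. G v \<le> 1} (IB v) \<partial>?\<Omega>)"
      by (intro nn_integral_cong) (auto simp: CIA space_restrict_space indicator_def)
    finally have "AE u in ?\<Omega>. 0 < wA u \<longrightarrow> u \<notin> {u. G (IB (CA u)) \<le> 1}"
      unfolding zeroB by (rule AE_of_zero) measurable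
    with AE_space show ?thesis
      by eventually_elim (use m in \<open>auto simp: wA_def \<theta>_def space_restrict_space\<close>)
  qed
  have oppB: "AE u in ?\<Omega>. 1 < G u \<longrightarrow> G (\<theta> u) < 1"
  proof -
    have "(\<integral>\<^sup>+u. ennreal (wB u) * indicator {u. 1 \<le> G (IA (CB u))} u \<partial>lborel)
      = (\<integral>\<^sup>+v. indicator {u. 1 \<le> G (IA (CB u))} (IB v) \<partial>?\<Omega>)" by (rule intB) measurable
    also have "\<dots> = (\<integral>\<^sup>+v. indicator {v. 1 \<le> G v} (IA v) \<partial>?\<Omega>)"
      by (intro nn_integral_cong) (auto simp: CIB space_restrict_space indicator_def)
    finally have "AE u in ?\<Omega>. 0 < wB u \<longrightarrow> u \<notin> {u. 1 \<le> G (IA (CB u))}"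
      unfolding zeroA by (rule AE_of_zero) measurable
    with AE_space show ?thesis
      by eventually_elim (use m in \<open>auto simp: wB_def \<theta>_def space_restrict_space\<close>)
  qed
  define c where "c u = \<bar>1 - G u\<bar> / \<bar>G (\<theta> u) - G u\<bar>" for u
  have [measurable]: "c \<in> borel_measurable borel" unfolding c_def[abs_def] by measurable
  \<comment> \<open>The factor \<open>\<bar>1 - G u\<bar>\<close> in \<open>c u\<close> is absorbed
    by the density \<open>wA\<close> or \<open>wB\<close>. The remaining weight depends only on the
    unordered pair, so it is the same seen from both partners.\<close>
  define d where "d v = ennreal (m / \<bar>G (IB v) - G (IA v)\<bar>)" for v
  have [measurable]: "d \<in> borel_measurable borel" unfolding d_def[abs_def] by measurable
  have key: "(\<integral>\<^sup>+u. ennreal (c u) * (p u * q (\<theta> u)) \<partial>?\<Omega>)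
     = (\<integral>\<^sup>+v. d v * (p (IA v) * q (IB v)) \<partial>?\<Omega>) + (\<integral>\<^sup>+v. d v * (p (IB v) * q (IA v)) \<partial>?\<Omega>)"
    if [measurable]: "p \<in> borel_measurable borel" "q \<in> borel_measurable borel" for p q :: "real \<Rightarrow> ennreal"
  proof -
    let ?FA = "\<lambda>u. ennreal (m / \<bar>G (IB (CA u)) - G u\<bar>) * (p u * q (IB (CA u)))"
    let ?FB = "\<lambda>u. ennreal (m / \<bar>G (IA (CB u)) - G u\<bar>) * (p u * q (IA (CB u)))"
    have "(\<integral>\<^sup>+u. ennreal (c u) * (p u * q (\<theta> u)) \<partial>?\<Omega>) = (\<integral>\<^sup>+u. ennreal (wA u) * ?FA u + ennreal (wB u) * ?FB u \<partial>lborel)"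
      unfolding nn_integral_unit_lebesgue
    proof (rule nn_integral_cong)
      fix u
      consider "u \<notin> {0<..<1}" | "u \<in> {0<..<1}" "G u < 1" | "u \<in> {0<..<1}" "1 < G u" | "G u = 1" by fastforce
      then show "ennreal (c u) * (p u * q (\<theta> u)) * indicator {0<..<1} u = ennreal (wA u) * ?FA u + ennreal (wB u) * ?FB u"
      proof cases
        case 2
        then have "wA u = (1 - G u) / m" "wB u = 0" by (simp_all add: wA_def wB_def)
        moreover have "ennreal ((1 - G u) / m) * ennreal (m / \<bar>G (IB (CA u)) - G u\<bar>) = ennreal (c u)"
          using 2 m by (simp add: ennreal_mult'[symmetric] c_def \<theta>_def)
        ultimately show ?thesis using 2 by (simp add: \<theta>_def mult.assoc[symmetric])
      next
        case 3
        then have "wB u = (G u - 1) / m" "wA u = 0" by (simp_all add: wA_def wB_def)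
        moreover have "ennreal ((G u - 1) / m) * ennreal (m / \<bar>G (IA (CB u)) - G u\<bar>) = ennreal (c u)"
          using 3 m by (simp add: ennreal_mult'[symmetric] c_def \<theta>_def)
        ultimately show ?thesis using 3 by (simp add: \<theta>_def mult.assoc[symmetric])
      qed (simp_all add: wA_def wB_def c_def)
    qed
    also have "\<dots> = (\<integral>\<^sup>+u. ennreal (wA u) * ?FA u \<partial>lborel) + (\<integral>\<^sup>+u. ennreal (wB u) * ?FB u \<partial>lborel)"
      by (rule nn_integral_add) measurable
    also have "(\<integral>\<^sup>+u. ennreal (wA u) * ?FA u \<partial>lborel) = (\<integral>\<^sup>+v. ?FA (IA v) \<partial>?\<Omega>)" by (rule intA) measurable
    also have "\<dots> = (\<integral>\<^sup>+v. d v * (p (IA v) * q (IB v)) \<partial>?\<Omega>)"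
      by (intro nn_integral_cong) (auto simp: CIA space_restrict_space d_def)
    also have "(\<integral>\<^sup>+u. ennreal (wB u) * ?FB u \<partial>lborel) = (\<integral>\<^sup>+v. ?FB (IB v) \<partial>?\<Omega>)" by (rule intB) measurable
    also have "\<dots> = (\<integral>\<^sup>+v. d v * (p (IB v) * q (IA v)) \<partial>?\<Omega>)"
      by (intro nn_integral_cong) (auto simp: CIB space_restrict_space d_def abs_minus_commute)
    finally show ?thesis .
  qed
  have c01: "AE u in ?\<Omega>. 0 \<le> c u \<and> c u \<le> 1"
    using oppA oppB
  proof eventually_elim
    case (elim u)
    then show ?case
      by (cases "G u" "1 :: real" rule: linorder_cases) (auto simp: c_def divide_le_eq)
  qed
  show ?thesis
  proof (rule that[OF \<theta>_meas oppA oppB])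
    fix f :: "real \<Rightarrow> ennreal" and c' assume [measurable]: "f \<in> borel_measurable borel"
      and "c' = (\<lambda>u. \<bar>1 - G u\<bar> / \<bar>G (\<theta> u) - G u\<bar>)"
    then have c': "c' = c" by (simp add: c_def[abs_def])
    have "(\<integral>\<^sup>+u. ennreal (1 - c u) * f u + ennreal (c u) * f (\<theta> u) \<partial>?\<Omega>)
       = (\<integral>\<^sup>+u. ennreal (1 - c u) * f u \<partial>?\<Omega>) + (\<integral>\<^sup>+u. ennreal (c u) * f (\<theta> u) \<partial>?\<Omega>)"
      by (intro nn_integral_add measurable_unit_lebesgue) measurable
    \<comment> \<open>By the symmetry in \<open>key\<close>, exchanging the test functions
      \<open>p\<close> and \<open>q\<close> changes nothing: the mass sent from \<open>u\<close> to
      its partner equals the mass received.\<close>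
    also have "(\<integral>\<^sup>+u. ennreal (c u) * f (\<theta> u) \<partial>?\<Omega>) = (\<integral>\<^sup>+u. ennreal (c u) * f u \<partial>?\<Omega>)"
      using key[of "\<lambda>_. 1" f] key[of f "\<lambda>_. 1"] by (simp add: add.commute)
    also have "(\<integral>\<^sup>+u. ennreal (1 - c u) * f u \<partial>?\<Omega>) + \<dots> = (\<integral>\<^sup>+u. ennreal (1 - c u) * f u + ennreal (c u) * f u \<partial>?\<Omega>)"
      by (intro nn_integral_add[symmetric] measurable_unit_lebesgue) measurable
    also have "\<dots> = (\<integral>\<^sup>+u. f u \<partial>?\<Omega>)"
    proof (rule nn_integral_cong_AE)
      show "AE u in ?\<Omega>. ennreal (1 - c u) * f u + ennreal (c u) * f u = f u"
        using c01 by eventually_elim (simp add: distrib_right[symmetric] ennreal_plus[symmetric] del: ennreal_plus)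
    qed
    finally show "(\<integral>\<^sup>+u. ennreal (1 - c' u) * f u + ennreal (c' u) * f (\<theta> u) \<partial>?\<Omega>) = (\<integral>\<^sup>+u. f u \<partial>?\<Omega>)"
      by (simp add: c')
  qed
qed

section \<open>Embedding a bounded law by a randomized exit\<close>

context drifted_brownian_motion
begin

lemma expectation_U:
  fixes J :: "real \<Rightarrow> real"
  assumes [measurable]: "J \<in> borel_measurable borel"
  shows "expectation (\<lambda>\<omega>. J (U \<omega>)) = (LINT u|unit_lebesgue. J u)"
proof -
  have U: "distributed M lborel U (\<lambda>u. ennreal (indicator {0..1} u))"
    using U_uniform by (simp add: ennreal_indicator[abs_def])
  have "expectation (\<lambda>\<omega>. J (U \<omega>)) = (LINT u|lborel. indicator {0..1} u * J u)"
    by (rule distributed_integral[OF U, symmetric]) auto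
  also have "\<dots> = (LINT u|lborel. indicator {0<..<1} u * J u)"
  proof (rule integral_cong_AE)
    show "AE u in lborel. indicator {0..1} u * J u = indicator {0<..<1} u * J u"
      using AE_lborel_singleton[of "0::real"] AE_lborel_singleton[of "1::real"]
      by eventually_elim (auto simp: indicator_def)
  qed measurable
  also have "\<dots> = (LINT u|unit_lebesgue. J u)"
    by (subst integral_restrict_space) auto
  finally show ?thesis .
qed

text \<open>The interval drawn has ends \<open>Q u\<close> and \<open>Q (\<theta> u)\<close> for
  \<open>u = U \<omega>\<close>. Exit at the partner has probability \<open>c u\<close>, exactly the
  exchange weight of \<open>mean_pairing\<close>, so the uniform law of the label is restored. The
  point mass at \<open>x0\<close> is excluded because it leaves no mass to pair.\<close>

lemma skorokhod_embedding:
  fixes Q :: "real \<Rightarrow> real"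
  assumes Q[measurable]: "Q \<in> borel_measurable borel" and bounds: "\<And>u. 0 \<le> Q u" "\<And>u. Q u \<le> B" and x0B: "x0 \<le> B"
    and mean: "(LINT u|unit_lebesgue. h (Q u)) = 1" and nontriv: "\<not> (AE u in unit_lebesgue. h (Q u) = 1)"
  shows "\<exists>\<tau>\<in>finite_stopping_times M \<FF>.
    distr M borel (stopped_value W \<mu> \<sigma> x0 \<tau>) = distr unit_lebesgue borel Q"
proof -
  interpret \<Omega>: prob_space unit_lebesgue by (rule prob_space_unit_lebesgue)
  let ?G = "\<lambda>u. h (Q u)"
  have [measurable]: "?G \<in> borel_measurable unit_lebesgue"
    by (rule measurable_unit_lebesgue) measurable
  have Gi: "integrable unit_lebesgue ?G"
    by (rule \<Omega>.integrable_const_bound[where B = "h B"]) (use bounds in auto)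
  obtain \<theta> where \<theta>[measurable]: "\<theta> \<in> borel_measurable borel"
    and opp: "AE u in unit_lebesgue. ?G u < 1 \<longrightarrow> 1 < ?G (\<theta> u)" "AE u in unit_lebesgue. 1 < ?G u \<longrightarrow> ?G (\<theta> u) < 1"
    and pair: "\<And>f c. f \<in> borel_measurable borel \<Longrightarrow> c = (\<lambda>u. \<bar>1 - ?G u\<bar> / \<bar>?G (\<theta> u) - ?G u\<bar>) \<Longrightarrow>
       (\<integral>\<^sup>+u. ennreal (1 - c u) * f u + ennreal (c u) * f (\<theta> u) \<partial>unit_lebesgue) = (\<integral>\<^sup>+u. f u \<partial>unit_lebesgue)"
    by (rule mean_pairing[OF _ Gi mean nontriv, rotated]) (rule that, assumption+, measurable)
  define c where "c = (\<lambda>u. \<bar>1 - ?G u\<bar> / \<bar>?G (\<theta> u) - ?G u\<bar>)"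
  \<comment> \<open>Partners lie on opposite sides of \<open>x0\<close> only almost everywhere.
    Elsewhere the interval is collapsed to \<open>x0\<close>, so that the bounds on the ends hold
    for every outcome.\<close>
  define opposite where "opposite u \<longleftrightarrow> Q u < x0 \<and> x0 < Q (\<theta> u) \<or> x0 < Q u \<and> Q (\<theta> u) < x0" for u
  define l where "l u = (if opposite u then min (Q u) (Q (\<theta> u)) else x0)" for u
  define r where "r u = (if opposite u then max (Q u) (Q (\<theta> u)) else x0)" for u
  have [measurable]: "l \<in> borel_measurable borel" "r \<in> borel_measurable borel" "c \<in> borel_measurable borel"
    unfolding l_def[abs_def] r_def[abs_def] opposite_def c_def by measurable
  have h1: "h y < 1 \<longleftrightarrow> y < x0" "1 < h y \<longleftrightarrow> x0 < y" "h y = 1 \<longleftrightarrow> y = x0" for y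
    using h_less_iff[of y x0] h_less_iff[of x0 y] h_eq_iff[of y x0] by (simp_all del: h_less_iff h_eq_iff)
  define a where "a \<omega> = l (U \<omega>)" for \<omega>
  define b where "b \<omega> = r (U \<omega>)" for \<omega>
  have ab_meas: "a \<in> borel_measurable (\<FF> 0)" "b \<in> borel_measurable (\<FF> 0)"
    unfolding a_def[abs_def] b_def[abs_def] by (rule measurable_compose[OF U_measurable]; measurable)+
  have ab: "0 \<le> a \<omega> \<and> a \<omega> \<le> x0 \<and> x0 \<le> b \<omega> \<and> b \<omega> \<le> B" for \<omega>
    using bounds x0B x0_pos by (auto simp: a_def b_def l_def r_def opposite_def min_def max_def)
  let ?T = "exit_time x0 a b"
  have T: "?T \<in> finite_stopping_times M \<FF>"
    by (rule exit_time_finite_stopping[OF ab_meas ab])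
  then have sv: "stopped_value W \<mu> \<sigma> x0 ?T \<in> borel_measurable M"
    by (intro stopped_value_measurable) (simp add: finite_stopping_times_def)
  have "distr M borel (stopped_value W \<mu> \<sigma> x0 ?T) = distr unit_lebesgue borel Q"
  proof (rule measure_eqI)
    fix S assume "S \<in> sets (distr M borel (stopped_value W \<mu> \<sigma> x0 ?T))"
    then have [measurable]: "S \<in> sets borel" by simp
    define f :: "real \<Rightarrow> real" where "f = indicator S"
    have [measurable]: "f \<in> borel_measurable borel" unfolding f_def by measurable
    have f01: "0 \<le> f y" "f y \<le> 1" for y by (auto simp: f_def indicator_def)
    \<comment> \<open>The conditional probability of stopping inside \<open>S\<close>, given that
      \<open>U\<close> equals \<open>u\<close>.\<close>
    define J where "J u = (if l u = r u then f x0 else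
      (f (l u) * (h (r u) - h x0) + f (r u) * (h x0 - h (l u))) / (h (r u) - h (l u)))" for u
    have [measurable]: "J \<in> borel_measurable borel" unfolding J_def[abs_def] by measurable
    have [measurable]: "J \<in> borel_measurable unit_lebesgue" by (rule measurable_unit_lebesgue) measurable
    have J_eq: "AE u in unit_lebesgue. J u = (1 - c u) * f (Q u) + c u * f (Q (\<theta> u)) \<and> 0 \<le> c u \<and> c u \<le> 1"
      using opp
    proof eventually_elim
      case (elim u)
      consider "Q u = x0" | "Q u < x0" "x0 < Q (\<theta> u)" | "x0 < Q u" "Q (\<theta> u) < x0"
        using elim unfolding h1 by (metis linorder_neqE_linordered_idom)
      then show ?case
      proof cases
        case 1
        then show ?thesis by (simp add: J_def l_def r_def opposite_def c_def)
      next
        case 2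
        then have *: "?G u < 1" "1 < ?G (\<theta> u)" by (simp_all add: h1)
        have lr: "l u = Q u" "r u = Q (\<theta> u)" using 2 by (simp_all add: l_def r_def opposite_def)
        have c: "c u = (1 - ?G u) / (?G (\<theta> u) - ?G u)" using * by (simp add: c_def)
        have ne: "?G (\<theta> u) - ?G u \<noteq> 0" using * by linarith
        have "1 - c u = (?G (\<theta> u) - ?G u - (1 - ?G u)) / (?G (\<theta> u) - ?G u)"
          unfolding c by (simp only: diff_divide_distrib[of "?G (\<theta> u) - ?G u" "1 - ?G u"] divide_self[OF ne])
        then have c': "1 - c u = (?G (\<theta> u) - 1) / (?G (\<theta> u) - ?G u)" by simp
        have "0 \<le> c u" unfolding c by (rule divide_nonneg_nonneg; use * in linarith)
        moreover have "0 \<le> 1 - c u" unfolding c' by (rule divide_nonneg_nonneg; use * in linarith)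
        moreover have "J u = (1 - c u) * f (Q u) + c u * f (Q (\<theta> u))"
          unfolding J_def lr c' unfolding c using 2 by (simp add: add_divide_distrib mult.commute)
        ultimately show ?thesis by simp
      next
        case 3
        then have *: "1 < ?G u" "?G (\<theta> u) < 1" by (simp_all add: h1)
        have lr: "r u = Q u" "l u = Q (\<theta> u)" using 3 by (simp_all add: l_def r_def opposite_def)
        have c: "c u = (?G u - 1) / (?G u - ?G (\<theta> u))" using * by (simp add: c_def)
        have ne: "?G u - ?G (\<theta> u) \<noteq> 0" using * by linarith
        have "1 - c u = (?G u - ?G (\<theta> u) - (?G u - 1)) / (?G u - ?G (\<theta> u))"
          unfolding c by (simp only: diff_divide_distrib[of "?G u - ?G (\<theta> u)" "?G u - 1"] divide_self[OF ne])
        then have c': "1 - c u = (1 - ?G (\<theta> u)) / (?G u - ?G (\<theta> u))" by simp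
        have "0 \<le> c u" unfolding c by (rule divide_nonneg_nonneg; use * in linarith)
        moreover have "0 \<le> 1 - c u" unfolding c' by (rule divide_nonneg_nonneg; use * in linarith)
        moreover have "J u = (1 - c u) * f (Q u) + c u * f (Q (\<theta> u))"
          unfolding J_def lr c' unfolding c using 3 by (simp add: add_divide_distrib mult.commute)
        ultimately show ?thesis by simp
      qed
    qed
    have J_nonneg: "AE u in unit_lebesgue. 0 \<le> J u" "AE u in unit_lebesgue. J u \<le> 1"
    proof -
      show "AE u in unit_lebesgue. 0 \<le> J u"
        using J_eq by eventually_elim (use f01 in simp)
      show "AE u in unit_lebesgue. J u \<le> 1"
        using J_eq
      proof eventually_elim
        case (elim u)
        then show ?case
          using convex_bound_le[of "f (Q u)" 1 "f (Q (\<theta> u))" "1 - c u" "c u"] f01 by simp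
      qed
    qed
    have Ji: "integrable unit_lebesgue J"
    proof (rule \<Omega>.integrable_const_bound[where B = 1])
      show "AE u in unit_lebesgue. norm (J u) \<le> 1"
        using J_nonneg by eventually_elim simp
    qed measurable
    have "emeasure (distr M borel (stopped_value W \<mu> \<sigma> x0 ?T)) S = ennreal (expectation (\<lambda>\<omega>. f (stopped_value W \<mu> \<sigma> x0 ?T \<omega>)))"
    proof -
      have "expectation (\<lambda>\<omega>. f (stopped_value W \<mu> \<sigma> x0 ?T \<omega>)) = prob (stopped_value W \<mu> \<sigma> x0 ?T -` S \<inter> space M)"
      proof -
        have "expectation (\<lambda>\<omega>. f (stopped_value W \<mu> \<sigma> x0 ?T \<omega>)) = expectation (indicator (stopped_value W \<mu> \<sigma> x0 ?T -` S \<inter> space M))"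
          by (intro Bochner_Integration.integral_cong) (auto simp: f_def indicator_def)
        then show ?thesis by simp
      qed
      moreover have "emeasure (distr M borel (stopped_value W \<mu> \<sigma> x0 ?T)) S
          = emeasure M (stopped_value W \<mu> \<sigma> x0 ?T -` S \<inter> space M)"
        by (rule emeasure_distr[OF sv]) simp
      ultimately show ?thesis by (simp only: emeasure_eq_measure)
    qed
    also have "expectation (\<lambda>\<omega>. f (stopped_value W \<mu> \<sigma> x0 ?T \<omega>)) = expectation (\<lambda>\<omega>. J (U \<omega>))"
      unfolding J_def a_def[symmetric] b_def[symmetric]
      by (rule expectation_at_exit[OF ab_meas ab, where K = 1]) (use f01 in auto)
    also have "\<dots> = (LINT u|unit_lebesgue. J u)" by (rule expectation_U) measurable
    also have "ennreal \<dots> = (\<integral>\<^sup>+u. ennreal (J u) \<partial>unit_lebesgue)"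
      by (rule nn_integral_eq_integral[OF Ji J_nonneg(1), symmetric])
    also have "\<dots> = (\<integral>\<^sup>+u. ennreal (1 - c u) * ennreal (f (Q u)) + ennreal (c u) * ennreal (f (Q (\<theta> u))) \<partial>unit_lebesgue)"
    proof (rule nn_integral_cong_AE)
      show "AE u in unit_lebesgue. ennreal (J u) = ennreal (1 - c u) * ennreal (f (Q u)) + ennreal (c u) * ennreal (f (Q (\<theta> u)))"
        using J_eq by eventually_elim (use f01 in \<open>simp add: ennreal_mult' ennreal_plus\<close>)
    qed
    also have "\<dots> = (\<integral>\<^sup>+u. ennreal (f (Q u)) \<partial>unit_lebesgue)"
      by (rule pair[OF _ c_def]) measurable
    also have "\<dots> = (\<integral>\<^sup>+y. indicator S y \<partial>distr unit_lebesgue borel Q)"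
      by (subst nn_integral_distr) (auto simp: f_def ennreal_indicator intro: measurable_unit_lebesgue)
    also have "\<dots> = emeasure (distr unit_lebesgue borel Q) S"
      by simp
    finally show "emeasure (distr M borel (stopped_value W \<mu> \<sigma> x0 ?T)) S = emeasure (distr unit_lebesgue borel Q) S" .
  qed simp
  with T show ?thesis by blast
qed

end

section \<open>Rewards and payoffs\<close>

lemma AE_unit_lebesgue_ex:
  assumes AE: "AE u in unit_lebesgue. P u" and ab: "0 \<le> a" "a < b" "b \<le> 1"
  shows "\<exists>u. a < u \<and> u < b \<and> P u"
proof (rule ccontr)
  assume no: "\<not> ?thesis"
  have "AE u in lborel. u \<in> {0<..<1} \<longrightarrow> P u"
    using AE by (subst (asm) AE_restrict_space_iff) auto
  then have "AE u in lborel. u \<notin> {a<..<b}"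
    by eventually_elim (use no ab in auto)
  then have "emeasure lborel {a<..<b} = 0"
    by (subst (asm) AE_iff_measurable[OF _ refl])
       (auto simp: greaterThanLessThan_def greaterThan_def lessThan_def Int_def)
  then show False using ab by simp
qed

lemma measure_unit_lebesgue_Ioo:
  assumes "0 \<le> a" "a \<le> b" "b \<le> 1"
  shows "measure unit_lebesgue {a<..<b} = b - a"
proof -
  have "{a<..<b} \<inter> {0<..<1} = {a<..<b}" using assms by auto
  then show ?thesis
    using assms by (subst measure_restrict_space) auto
qed

text \<open>Extending \<open>rev_reward R\<close> constantly outside the unit interval makes it monotone and left-continuous on the whole line.\<close>

definition rev_ext :: "(real \<Rightarrow> real) \<Rightarrow> real \<Rightarrow> real" where
  "rev_ext R y = rev_reward R (max 0 (min 1 y))"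

section \<open>Rewards as monotone left-continuous functions of the rank\<close>

locale reward =
  fixes R :: "real \<Rightarrow> real"
  assumes reward: "reward_function R"
begin

abbreviation g :: "real \<Rightarrow> real" where "g \<equiv> rev_ext R"

lemma R_antimono: "0 \<le> r \<Longrightarrow> r \<le> s \<Longrightarrow> s \<le> 1 \<Longrightarrow> R s \<le> R r"
  using reward by (auto simp: reward_function_def dest: monotone_onD[where x = r and y = s])

lemma g_unit: "0 \<le> y \<Longrightarrow> y \<le> 1 \<Longrightarrow> g y = R (1 - y)"
  by (simp add: rev_ext_def rev_reward_def)

lemma g_mono: "x \<le> y \<Longrightarrow> g x \<le> g y"
  unfolding rev_ext_def rev_reward_def by (rule R_antimono) auto

lemma g_measurable [measurable]: "g \<in> borel_measurable borel"
  by (intro borel_measurable_mono monoI g_mono)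

lemma g_0 [simp]: "g 0 = R 1" and g_1 [simp]: "g 1 = R 0"
  by (simp_all add: g_unit)

lemma g_bounds: "R 1 \<le> g y" "g y \<le> R 0"
  unfolding rev_ext_def rev_reward_def by (rule R_antimono; simp)+

lemma R1_nonneg: "0 \<le> R 1"
  using reward by (simp add: reward_function_def)

text \<open>\<open>left_lim\<close> is defined by \<open>Lim\<close>, so existence of the limit has
  to be established before its value can be used; monotonicity supplies the infimum.\<close>

lemma R1_eq_Inf: "R 1 = Inf (R ` {0..<1})"
proof -
  let ?L = "Inf (R ` {0..<1})"
  have bdd: "bdd_below (R ` {0..<1})"
    using R_antimono[of _ 1] by (intro bdd_belowI[of _ "R 1"]) auto
  have "(R \<longlongrightarrow> ?L) (at_left 1)"
  proof (rule order_tendstoI)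
    fix a assume "a < ?L"
    then show "\<forall>\<^sub>F x in at_left 1. a < R x"
      by (intro eventually_at_leftI[of 0]) (auto intro!: less_le_trans[OF _ cInf_lower[OF _ bdd]])
  next
    fix a assume "?L < a"
    then obtain r where r: "0 \<le> r" "r < 1" "R r < a"
      using bdd by (subst (asm) cInf_less_iff) auto
    then show "\<forall>\<^sub>F x in at_left 1. R x < a"
      by (intro eventually_at_leftI[of r]) (auto intro: le_less_trans[OF R_antimono[of r]])
  qed
  then have "left_lim R 1 = ?L" unfolding left_lim_def by (intro tendsto_Lim) auto
  then show ?thesis using reward by (simp add: reward_function_def)
qed

lemma R1_less_R0: "R 1 < R 0"
  using reward by (simp add: reward_function_def)

text \<open>Continuity of \<open>R\<close> at 1, seen in the reversed variable. It pins the
  supporting line at 0 to \<open>R 1\<close> and places 0 in the support.\<close>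

lemma g_near_0:
  assumes "R 1 < c"
  obtains y where "0 < y" "y \<le> 1" "g y < c"
proof -
  have "bdd_below (R ` {0..<1})"
    using R_antimono[of _ 1] by (intro bdd_belowI[of _ "R 1"]) auto
  then obtain r where "0 \<le> r" "r < 1" "R r < c"
    using assms unfolding R1_eq_Inf by (subst (asm) cInf_less_iff) auto
  then show ?thesis using that[of "1 - r"] by (simp add: g_unit)
qed

text \<open>Right-continuity of \<open>R\<close> becomes left-continuity of \<open>g\<close> under
  reversal; to the left of 0 and to the right of 1 the extension is constant.\<close>

lemma g_left_limit_le:
  assumes "a < y" and le: "\<And>z. a < z \<Longrightarrow> z < y \<Longrightarrow> g z \<le> c"
  shows "g y \<le> c"
proof -
  consider "y \<le> 0" | "1 < y" | "0 < y" "y \<le> 1" by linarith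
  then show ?thesis
  proof cases
    case 1
    define z where "z = (a + y) / 2"
    have "a < z" "z < y" using assms(1) by (auto simp: z_def)
    moreover have "g y = g z" using 1 \<open>z < y\<close> by (simp add: rev_ext_def)
    ultimately show ?thesis using le[of z] by simp
  next
    case 2
    define z where "z = max ((a + y) / 2) ((1 + y) / 2)"
    have "a < z" "z < y" "1 < z" using assms(1) 2 by (auto simp: z_def max_def)
    moreover have "g y = g z" using 2 \<open>1 < z\<close> by (simp add: rev_ext_def)
    ultimately show ?thesis using le[of z] by simp
  next
    case 3
    then have "continuous (at_right (1 - y)) R"
      using reward by (simp add: reward_function_def)
    then have lim: "(R \<longlongrightarrow> R (1 - y)) (at_right (1 - y))" by (simp add: continuous_within)
    have "R (1 - y) \<le> c"
    proof (rule tendsto_upperbound[OF lim])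
      show "\<forall>\<^sub>F x in at_right (1 - y). R x \<le> c"
      proof (rule eventually_at_rightI[of _ "min 1 (1 - a)"])
        fix x assume "x \<in> {1 - y<..<min 1 (1 - a)}"
        then show "R x \<le> c" using le[of "1 - x"] g_unit[of "1 - x"] 3 by auto
      qed (use 3 assms(1) in auto)
    qed simp
    then show ?thesis using 3 by (simp add: g_unit)
  qed
qed

lemma g_integrable: "integrable unit_lebesgue g"
proof -
  interpret \<Omega>: prob_space unit_lebesgue by (rule prob_space_unit_lebesgue)
  show ?thesis
    by (rule \<Omega>.integrable_const_bound[where B = "R 0"])
       (use g_bounds R1_nonneg order_trans[OF R1_nonneg g_bounds(1)] in \<open>auto intro: measurable_unit_lebesgue\<close>)
qed

lemma mean_reward_eq: "mean_reward R = (LINT y|unit_lebesgue. g y)"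
proof -
  have "mean_reward R = (LINT r|lborel. indicator {0<..<1} r * g (1 - r))"
    unfolding mean_reward_def set_lebesgue_integral_def
  proof (rule integral_cong_AE)
    have eq: "indicator {0..1} r *\<^sub>R R r = indicator {0..1} r * g (1 - r)" for r
      by (auto simp: g_unit indicator_def)
    show "(\<lambda>r. indicator {0..1} r *\<^sub>R R r) \<in> borel_measurable lborel"
      unfolding eq by measurable
    show "AE r in lborel. indicator {0..1} r *\<^sub>R R r = indicator {0<..<1} r * g (1 - r)"
      using AE_lborel_singleton[of "0::real"] AE_lborel_singleton[of "1::real"]
      unfolding eq by eventually_elim (auto simp: indicator_def)
  qed measurable
  also have "\<dots> = (LINT y|lborel. indicator {0<..<1} (1 + (-1) * y) * g (1 - (1 + (-1) * y)))"
    by (subst lborel_integral_real_affine[of "-1" _ 1]) auto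
  also have "\<dots> = (LINT y|lborel. indicator {0<..<1} y *\<^sub>R g y)"
    by (intro Bochner_Integration.integral_cong) (auto simp: indicator_def)
  also have "\<dots> = (LINT y|unit_lebesgue. g y)"
    by (subst integral_restrict_space) auto
  finally show ?thesis .
qed

text \<open>The two strict bounds use the two ends of the unit interval: left-continuity of
  \<open>g\<close> at 1 excludes that \<open>g\<close> is almost everywhere \<open>R 1\<close>, and
  \<open>g_near_0\<close> excludes that it is almost everywhere \<open>R 0\<close>.\<close>

lemma mean_reward_bounds: "R 1 < mean_reward R" "mean_reward R < R 0"
proof -
  interpret \<Omega>: prob_space unit_lebesgue by (rule prob_space_unit_lebesgue)
  have i: "integrable unit_lebesgue (\<lambda>y. g y - R 1)" "integrable unit_lebesgue (\<lambda>y. R 0 - g y)"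
    using g_integrable by auto
  have e: "(LINT y|unit_lebesgue. g y - R 1) = mean_reward R - R 1"
    "(LINT y|unit_lebesgue. R 0 - g y) = R 0 - mean_reward R"
    using g_integrable \<Omega>.prob_space by (simp_all add: mean_reward_eq)
  have "mean_reward R - R 1 \<noteq> 0"
  proof
    assume "mean_reward R - R 1 = 0"
    then have AE: "AE y in unit_lebesgue. g y - R 1 = 0"
      using integral_nonneg_eq_0_iff_AE[OF i(1)] g_bounds by (simp add: e)
    have "g 1 \<le> R 1"
    proof (rule g_left_limit_le[of 0])
      fix z :: real assume "0 < z" "z < 1"
      with AE_unit_lebesgue_ex[OF AE, of z 1] obtain u where "z < u" "g u = R 1" by auto
      then show "g z \<le> R 1" using g_mono[of z u] by simp
    qed simp
    then show False using R1_less_R0 by simp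
  qed
  moreover have "0 \<le> mean_reward R - R 1" unfolding e(1)[symmetric] using g_bounds by simp
  ultimately show "R 1 < mean_reward R" by simp
  have "R 0 - mean_reward R \<noteq> 0"
  proof
    assume eq0: "R 0 - mean_reward R = 0"
    have AE: "AE y in unit_lebesgue. R 0 - g y = 0"
      by (rule iffD1[OF integral_nonneg_eq_0_iff_AE[OF i(2)]]) (simp add: g_bounds, simp only: e eq0)
    obtain y where y: "0 < y" "y \<le> 1" "g y < R 0" using g_near_0[OF R1_less_R0] .
    with AE_unit_lebesgue_ex[OF AE, of 0 y] obtain u where "u < y" "g u = R 0" by auto
    then show False using g_mono[of u y] y by simp
  qed
  moreover have "0 \<le> R 0 - mean_reward R" unfolding e(2)[symmetric] using g_bounds by simp
  ultimately show "mean_reward R < R 0" by simp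
qed

text \<open>The third part splits the interval at \<open>y\<close>; it is sharp enough to detect
  where an average of \<open>g\<close> can equal its right end value.\<close>

lemma average_le:
  assumes ab: "0 \<le> a" "a < b" "b \<le> 1"
  shows "(LBINT y:{a..b}. rev_reward R y) = (LBINT y:{a..b}. g y)"
    "(b - a) * g a \<le> (LBINT y:{a..b}. g y)"
    "a \<le> y \<Longrightarrow> y \<le> b \<Longrightarrow> (LBINT y:{a..b}. g y) \<le> (y - a) * g y + (b - y) * g b"
proof -
  show "(LBINT y:{a..b}. rev_reward R y) = (LBINT y:{a..b}. g y)"
    by (rule set_lebesgue_integral_cong) (use ab in \<open>auto simp: rev_ext_def\<close>)
  have gi: "integrable lborel (\<lambda>y. indicator {a..b} y * g y)"
  proof (rule Bochner_Integration.integrable_bound)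
    show "integrable lborel (\<lambda>y. indicator {a..b} y * R 0)"
      using ab by (intro integrable_mult_left) (auto simp: integrable_indicator_iff)
    show "AE y in lborel. norm (indicator {a..b} y * g y) \<le> norm (indicator {a..b} y * R 0)"
    proof (rule AE_I2)
      fix y show "norm (indicator {a..b} y * g y) \<le> norm (indicator {a..b} y * R 0)"
        using g_bounds[of y] R1_nonneg by (simp add: indicator_def)
    qed
  qed measurable
  have ii: "integrable lborel (\<lambda>y. indicator {c..d} y * v)" for c d v :: real
    by (intro integrable_mult_left) (auto simp: integrable_indicator_iff emeasure_lborel_Icc_eq)
  have ii2: "integrable lborel (\<lambda>y. indicator {c<..d} y * v)" if "c \<le> d" for c d v :: real
    using that by (intro integrable_mult_left) (auto simp: integrable_indicator_iff)
  have "(b - a) * g a = (LINT y|lborel. indicator {a..b} y * g a)"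
    using ab by simp
  also have "\<dots> \<le> (LINT y|lborel. indicator {a..b} y * g y)"
    by (rule integral_mono[OF ii gi]) (auto simp: indicator_def g_mono)
  finally show "(b - a) * g a \<le> (LBINT y:{a..b}. g y)"
    by (simp add: set_lebesgue_integral_def)
  assume y: "a \<le> y" "y \<le> b"
  have "(LINT u|lborel. indicator {a..b} u * g u)
      \<le> (LINT u|lborel. indicator {a..y} u * g y + indicator {y<..b} u * g b)"
  proof (rule integral_mono[OF gi])
    show "integrable lborel (\<lambda>u. indicator {a..y} u * g y + indicator {y<..b} u * g b)"
      by (intro Bochner_Integration.integrable_add ii ii2 y)
    fix u
    show "indicator {a..b} u * g u \<le> indicator {a..y} u * g y + indicator {y<..b} u * g b"
      using y by (auto simp: indicator_def g_mono)
  qed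
  also have "\<dots> = (y - a) * g y + (b - y) * g b"
    using y by (subst Bochner_Integration.integral_add[OF ii ii2]) simp_all
  finally show "(LBINT y:{a..b}. g y) \<le> (y - a) * g y + (b - y) * g b"
    by (simp add: set_lebesgue_integral_def)
qed

lemma average_const:
  assumes ab: "0 \<le> a" "a < b" "b \<le> 1" and const: "\<And>y. a < y \<Longrightarrow> y < b \<Longrightarrow> g y = v"
  shows "(LBINT y:{a..b}. g y) = (b - a) * v"
proof -
  have "(LBINT y:{a..b}. g y) = (LINT y|lborel. indicator {a..b} y * v)"
    unfolding set_lebesgue_integral_def
  proof (rule integral_cong_AE)
    show "AE y in lborel. indicator {a..b} y *\<^sub>R g y = indicator {a..b} y * v"
      using AE_lborel_singleton[of a] AE_lborel_singleton[of b]
      by eventually_elim (use const in \<open>auto simp: indicator_def\<close>)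
  qed measurable
  then show ?thesis using ab by simp
qed

end

section \<open>Payoffs against a fixed distribution\<close>

locale reward_distribution = reward R + cdf_distribution F for R :: "real \<Rightarrow> real" and F :: "real measure"
begin

abbreviation Cl :: "real \<Rightarrow> real" where "Cl x \<equiv> measure F {..<x}"

lemma left_lim_cdf: "left_lim C x = Cl x"
  unfolding left_lim_def
  by (intro tendsto_Lim finite_borel_measure.cdf_at_left[OF finite_borel_measure_M]) simp

lemma Cl_bounds: "0 \<le> Cl x" "Cl x \<le> C x" "C x \<le> 1"
  using cdf_bounded_prob by (auto simp: cdf_def intro: finite_measure_mono)

lemma C_le_Cl: "x < y \<Longrightarrow> C x \<le> Cl y"
  by (auto simp: cdf_def intro!: finite_measure_mono)

lemma payoff_eq: "payoff R F x = (if C x = Cl x then g (C x) else 1 / (C x - Cl x) * (LBINT y:{Cl x..C x}. g y))"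
proof -
  have "0 \<le> C x" using Cl_bounds[of x] by linarith
  then have "rev_reward R (C x) = g (C x)" using g_unit[of "C x"] Cl_bounds(3)[of x] by (simp add: rev_reward_def)
  then show ?thesis
    using Cl_bounds[of x] average_le(1)[of "Cl x" "C x"] by (auto simp: payoff_def Let_def left_lim_cdf)
qed

lemma payoff_bounds: "g (Cl x) \<le> payoff R F x" "payoff R F x \<le> g (C x)"
proof -
  have "g (Cl x) \<le> payoff R F x \<and> payoff R F x \<le> g (C x)"
  proof (cases "C x = Cl x")
    case True
    then show ?thesis by (simp add: payoff_eq)
  next
    case False
    then have ab: "0 \<le> Cl x" "Cl x < C x" "C x \<le> 1" using Cl_bounds[of x] by auto
    show ?thesis
      using average_le(2)[OF ab] average_le(3)[OF ab, of "C x"] False ab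
      by (simp add: payoff_eq field_simps)
  qed
  then show "g (Cl x) \<le> payoff R F x" "payoff R F x \<le> g (C x)" by auto
qed

lemma payoff_mono: "x \<le> y \<Longrightarrow> payoff R F x \<le> payoff R F y"
  using payoff_bounds[of x] payoff_bounds[of y] C_le_Cl[of x y] g_mono[of "C x" "Cl y"]
  by (cases "x = y") auto

lemma payoff_measurable [measurable]: "payoff R F \<in> borel_measurable borel"
  by (intro borel_measurable_mono monoI payoff_mono)

lemma payoff_range: "R 1 \<le> payoff R F x" "payoff R F x \<le> R 0"
  using payoff_bounds[of x] g_bounds order_trans by blast+

lemma abs_payoff_le: "\<bar>payoff R F x\<bar> \<le> R 0"
  using payoff_range[of x] R1_nonneg by simp

text \<open>An average of a monotone function reaches the right end value only if the function is
  constant up to that end: a smaller value at \<open>y\<close> lowers it on all of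
  \<open>(Cl x, y]\<close>.\<close>

lemma payoff_maximal_imp_flat:
  assumes "payoff R F x = g (C x)" "Cl x < y" "y \<le> C x"
  shows "g y = g (C x)"
proof (rule ccontr)
  assume "g y \<noteq> g (C x)"
  then have less: "g y < g (C x)" using g_mono[OF assms(3)] by simp
  have ab: "0 \<le> Cl x" "Cl x < C x" "C x \<le> 1" using Cl_bounds[of x] assms by auto
  have "(C x - Cl x) * g (C x) = (LBINT y:{Cl x..C x}. g y)"
    using assms(1) ab by (simp add: payoff_eq field_simps)
  also have "\<dots> \<le> (y - Cl x) * g y + (C x - y) * g (C x)"
    using assms by (intro average_le(3)[OF ab]) auto
  also have "\<dots> < (y - Cl x) * g (C x) + (C x - y) * g (C x)"
    using less assms by (intro add_strict_right_mono mult_strict_left_mono) auto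
  finally show False by (simp add: algebra_simps)
qed

lemma payoff_flat:
  assumes "g (C x) = v" "\<And>y. Cl x < y \<Longrightarrow> y < C x \<Longrightarrow> g y = v"
  shows "payoff R F x = v"
proof (cases "C x = Cl x")
  case True
  then show ?thesis using assms by (simp add: payoff_eq)
next
  case False
  then have "0 \<le> Cl x" "Cl x < C x" "C x \<le> 1" using Cl_bounds[of x] by auto
  from average_const[OF this assms(2)] show ?thesis using False by (simp add: payoff_eq)
qed

lemma quantile_bounds:
  assumes y: "0 < y" "y < 1"
  shows "y \<le> C (I y)" "Cl (I y) \<le> y"
proof -
  show "y \<le> C (I y)" using pseudoinverse[OF y, of "I y"] by blast
  show "Cl (I y) \<le> y"
  proof (rule tendsto_upperbound)
    show "(C \<longlongrightarrow> Cl (I y)) (at_left (I y))"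
      by (rule finite_borel_measure.cdf_at_left[OF finite_borel_measure_M])
    show "\<forall>\<^sub>F x in at_left (I y). C x \<le> y"
    proof (rule eventually_at_leftI[of "I y - 1"])
      fix x assume "x \<in> {I y - 1<..<I y}"
      then have "\<not> I y \<le> x" by simp
      then show "C x \<le> y" using pseudoinverse[OF y, of x] by linarith
    qed simp
  qed simp
qed

end

section \<open>The equilibrium distribution\<close>

locale stopping_game = drifted_brownian_motion M \<FF> W U \<mu> \<sigma> x0 + reward R
  for M :: "'w measure" and \<FF> :: "ennreal \<Rightarrow> 'w measure"
    and W :: "real \<Rightarrow> 'w \<Rightarrow> real" and U :: "'w \<Rightarrow> real" and \<mu> \<sigma> x0 :: real and R :: "real \<Rightarrow> real" +
  assumes drift_small: "\<mu> < mu_bar R x0 \<sigma>"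
begin

definition c where "c = mean_reward R - R 1"
definition z where "z = (R 0 - R 1) / c"
text \<open>The affine function of \<open>h\<close> with value \<open>R 1\<close> at 0 and
  \<open>mean_reward R\<close> at \<open>x0\<close>; it reaches \<open>R 0\<close> where
  \<open>h\<close> equals \<open>z\<close>.\<close>

definition ell where "ell x = R 1 + c * h x"
definition ustar where "ustar x = min (ell x) (R 0)"

lemma c_pos: "0 < c" using mean_reward_bounds by (simp add: c_def)

lemma z_gt_1: "1 < z" using mean_reward_bounds c_pos by (simp add: z_def c_def)

lemma ell_le_iff [simp]: "ell x \<le> ell y \<longleftrightarrow> x \<le> y"
  using c_pos by (simp add: ell_def)

lemma ell_less_iff [simp]: "ell x < ell y \<longleftrightarrow> x < y"
  using c_pos by (simp add: ell_def)

lemma ell_0 [simp]: "ell 0 = R 1" by (simp add: ell_def)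

text \<open>Here \<open>drift_small\<close> enters. For nonpositive \<open>\<mu>\<close> the scale
  function is unbounded on the half-line. For positive \<open>\<mu>\<close> its supremum is
  \<open>- 1 / D\<close>, and the bound on \<open>\<mu>\<close> says that \<open>z\<close> lies
  below it, that is, \<open>0 < 1 + z * D\<close>.\<close>

lemma z_in_range: "z \<in> h ` {0..}"
proof (cases "\<mu> = 0")
  case True
  then have "h (z * x0) = z" using x0_pos by (simp add: scale_fun_def)
  moreover have "0 \<le> z * x0" using x0_pos z_gt_1 by simp
  ultimately show ?thesis by (metis atLeast_iff imageI)
next
  case False
  define k where "k = - 2 * \<mu> / \<sigma>\<^sup>2"
  define D where "D = exp (k * x0) - 1"
  have h: "h y = (exp (k * y) - 1) / D" for y
    using False by (simp add: scale_fun_def k_def D_def)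
  have k: "k \<noteq> 0" using False \<sigma>_pos by (simp add: k_def)
  then have D: "D \<noteq> 0" using x0_pos by (simp add: D_def)
  have pos: "0 < 1 + z * D"
  proof (cases "\<mu> < 0")
    case True
    then have "0 < k" using \<sigma>_pos unfolding k_def by (intro divide_pos_pos) auto
    then have "0 < k * x0" using x0_pos by simp
    then have "0 < D" by (simp add: D_def)
    then show ?thesis using z_gt_1 by (simp add: add_pos_nonneg)
  next
    case False
    define A where "A = (R 0 - R 1) / (R 0 - mean_reward R)"
    have A: "0 < A" using R1_less_R0 mean_reward_bounds by (simp add: A_def)
    have "\<mu> < \<sigma>\<^sup>2 / (2 * x0) * ln A" using drift_small by (simp add: mu_bar_def A_def)
    then have "\<mu> * (2 * x0) < \<sigma>\<^sup>2 * ln A" using x0_pos by (simp add: field_simps)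
    then have "- ln A < k * x0" using \<sigma>_pos by (simp add: k_def field_simps)
    then have "exp (- ln A) < exp (k * x0)" by simp
    then have "1 / A < exp (k * x0)" using A by (simp add: exp_minus inverse_eq_divide)
    then have "z * (1 / A - 1) < z * D" using z_gt_1 by (simp add: D_def)
    \<comment> \<open>\<open>A\<close> is the argument of the logarithm in \<open>mu_bar\<close>; by
      the definitions of \<open>A\<close>, \<open>c\<close> and \<open>z\<close>,
      \<open>1 / A - 1\<close> is \<open>- 1 / z\<close>.\<close>
    moreover have "z * (1 / A - 1) = - 1"
    proof -
      have "1 / A - 1 = - c / (R 0 - R 1)"
        using R1_less_R0 mean_reward_bounds by (simp add: A_def c_def field_simps)
      then show ?thesis using R1_less_R0 c_pos by (simp add: z_def)
    qed
    ultimately show ?thesis by linarith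
  qed
  define y where "y = ln (1 + z * D) / k"
  have hy: "h y = z" unfolding h using pos k D by (simp add: y_def)
  moreover have "0 \<le> y" using hy z_gt_1 h_nonneg_iff[of y] by simp
  ultimately show ?thesis by (metis atLeast_iff imageI)
qed

lemma h_inj_on: "inj_on h S"
  by (auto intro: inj_onI)

definition xbar where "xbar = the_inv_into {0..} h z"

lemma xbar: "0 \<le> xbar" "h xbar = z"
  using the_inv_into_into[OF h_inj_on z_in_range order_refl] f_the_inv_into_f[OF h_inj_on z_in_range]
  by (simp_all add: xbar_def)

lemma xbar_pos: "0 < xbar"
  using xbar z_gt_1 by (cases "xbar = 0") auto

lemma ell_xbar [simp]: "ell xbar = R 0"
  using c_pos by (simp add: ell_def xbar z_def)

lemma ustar_below: "x \<le> xbar \<Longrightarrow> ustar x = ell x"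
  using ell_le_iff[of x xbar] by (simp add: ustar_def del: ell_le_iff)

lemma ustar_above: "xbar \<le> x \<Longrightarrow> ustar x = R 0"
  using ell_le_iff[of xbar x] by (simp add: ustar_def del: ell_le_iff)

text \<open>The solution of \<open>ell (Q y) = g y\<close>, hence the only possible quantile
  function once the line \<open>l\<close> is known to be \<open>ell\<close>.\<close>

definition Q where "Q y = the_inv_into {0..} h ((g y - R 1) / c)"

lemma Q_range_aux: "(g y - R 1) / c \<in> h ` {0..}"
proof -
  have "0 \<le> (g y - R 1) / c" "(g y - R 1) / c \<le> z"
    using g_bounds c_pos by (auto simp: z_def intro!: divide_right_mono)
  then have "\<exists>x\<ge>0. x \<le> xbar \<and> h x = (g y - R 1) / c"
    using xbar by (intro IVT' continuous_on_scale_fun) auto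
  then show ?thesis by force
qed

lemma ell_Q [simp]: "ell (Q y) = g y"
  using f_the_inv_into_f[OF h_inj_on Q_range_aux] c_pos by (simp add: ell_def Q_def)

lemma Q_nonneg: "0 \<le> Q y"
  using g_bounds[of y] ell_le_iff[of 0 "Q y"] by (simp del: ell_le_iff)

lemma Q_le_xbar: "Q y \<le> xbar"
  using g_bounds[of y] ell_le_iff[of "Q y" xbar] by (simp del: ell_le_iff)

lemma Q_le_iff: "Q y \<le> x \<longleftrightarrow> g y \<le> ell x"
  using ell_le_iff[of "Q y" x] by (simp del: ell_le_iff)

lemma Q_less_iff: "Q y < x \<longleftrightarrow> g y < ell x"
  using ell_less_iff[of "Q y" x] by (simp del: ell_less_iff)

lemma Q_eq_iff: "Q y = x \<longleftrightarrow> g y = ell x"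
  using Q_le_iff[of y x] Q_less_iff[of y x] by auto

lemma Q_0: "Q 0 = 0" and Q_1: "Q 1 = xbar"
  by (simp_all add: Q_eq_iff)

lemma Q_mono: "x \<le> y \<Longrightarrow> Q x \<le> Q y"
  by (simp add: Q_le_iff g_mono)

lemma Q_measurable [measurable]: "Q \<in> borel_measurable borel"
  by (intro borel_measurable_mono monoI Q_mono)

lemma Q_measurable' [measurable]: "Q \<in> borel_measurable unit_lebesgue"
  by (rule measurable_unit_lebesgue[OF Q_measurable])

definition Fstar where "Fstar = distr unit_lebesgue borel Q"

lemma measure_Fstar: "S \<in> sets borel \<Longrightarrow> measure Fstar S = measure unit_lebesgue {y\<in>{0<..<1}. Q y \<in> S}"
proof -
  assume S: "S \<in> sets borel"
  have "Q -` S \<inter> space unit_lebesgue = {y\<in>{0<..<1}. Q y \<in> S}" by (auto simp: space_restrict_space)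
  then show ?thesis unfolding Fstar_def measure_distr[OF Q_measurable' S] by simp
qed

lemma cdf_distribution_Fstar: "cdf_distribution Fstar"
proof -
  interpret \<Omega>: prob_space unit_lebesgue by (rule prob_space_unit_lebesgue)
  show ?thesis unfolding Fstar_def cdf_distribution_def by (rule \<Omega>.real_distribution_distr) measurable
qed

sublocale Fs: reward_distribution R Fstar
  unfolding reward_distribution_def using reward_axioms cdf_distribution_Fstar by blast

text \<open>\<open>h (Q y)\<close> is \<open>(g y - R 1) / c\<close>, so
  \<open>c = mean_reward R - R 1\<close> is exactly the slope for which the scale mean is 1. By
  \<open>g_near_0\<close> the law is not the point mass at \<open>x0\<close>.\<close>

lemma Fstar_feasible: "Fstar \<in> feasible_distributions M \<FF> W \<mu> \<sigma> x0"
proof -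
  interpret \<Omega>: prob_space unit_lebesgue by (rule prob_space_unit_lebesgue)
  have hQ: "h (Q y) = (g y - R 1) / c" for y
    using ell_Q[of y] c_pos by (simp add: ell_def field_simps)
  have "\<exists>\<tau>\<in>finite_stopping_times M \<FF>. distr M borel (stopped_value W \<mu> \<sigma> x0 \<tau>) = distr unit_lebesgue borel Q"
  proof (rule skorokhod_embedding[where B = xbar])
    show "x0 \<le> xbar" using h_le_iff[of x0 xbar] z_gt_1 xbar by (simp del: h_le_iff)
    show "(LINT u|unit_lebesgue. h (Q u)) = 1"
      using g_integrable \<Omega>.prob_space c_pos by (simp add: hQ mean_reward_eq[symmetric] c_def)
    show "\<not> (AE u in unit_lebesgue. h (Q u) = 1)"
    proof
      assume "AE u in unit_lebesgue. h (Q u) = 1"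
      then have AE: "AE u in unit_lebesgue. g u = mean_reward R"
        using c_pos by (auto simp: hQ c_def)
      obtain y where y: "0 < y" "y \<le> 1" "g y < mean_reward R" using g_near_0[OF mean_reward_bounds(1)] .
      obtain u where "u < y" "g u = mean_reward R"
        using AE_unit_lebesgue_ex[OF AE order_refl y(1,2)] by blast
      then show False using g_mono[of u y] y by simp
    qed
  qed (auto simp: Q_nonneg Q_le_xbar)
  then show ?thesis unfolding feasible_distributions_def Fstar_def by (metis (no_types, lifting) imageI)
qed

lemma measure_unit_mono_le:
  assumes S: "{y\<in>{0<..<1}. P y} \<in> sets borel" and le: "\<And>y. 0 < y \<Longrightarrow> y < 1 \<Longrightarrow> P y \<Longrightarrow> y \<le> b" and b: "0 \<le> b"
  shows "measure unit_lebesgue {y\<in>{0<..<1}. P y} \<le> b"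
proof -
  let ?S = "{y\<in>{0<..<1}. P y}"
  have sub: "?S \<subseteq> {0..b}"
  proof
    fix y assume "y \<in> ?S"
    then show "y \<in> {0..b}" using le[of y] by simp
  qed
  have "measure unit_lebesgue ?S = measure lborel ?S"
    by (rule measure_restrict_space) auto
  also have "\<dots> \<le> measure lborel {0..b}"
  proof (rule measure_mono_fmeasurable[OF sub])
    show "?S \<in> sets lborel" using S by (simp only: sets_lborel)
    show "{0..b} \<in> fmeasurable lborel" using b by (intro fmeasurableI) simp_all
  qed
  also have "\<dots> = b" using b by simp
  finally show ?thesis .
qed

lemma measure_unit_mono_ge:
  assumes S: "{y\<in>{0<..<1}. P y} \<in> sets borel" and P: "\<And>y. a < y \<Longrightarrow> y < b \<Longrightarrow> P y"
    and ab: "0 \<le> a" "a \<le> b" "b \<le> 1"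
  shows "b - a \<le> measure unit_lebesgue {y\<in>{0<..<1}. P y}"
proof -
  interpret \<Omega>: prob_space unit_lebesgue by (rule prob_space_unit_lebesgue)
  let ?S = "{y\<in>{0<..<1}. P y}"
  have sub: "{a<..<b} \<subseteq> ?S"
  proof
    fix y assume "y \<in> {a<..<b}"
    then show "y \<in> ?S" using P[of y] ab by simp
  qed
  have "b - a = measure unit_lebesgue {a<..<b}" using ab by (simp add: measure_unit_lebesgue_Ioo)
  also have "\<dots> \<le> measure unit_lebesgue ?S"
  proof (rule \<Omega>.finite_measure_mono[OF sub])
    have "?S \<in> sets lborel" using S by (simp only: sets_lborel)
    moreover have "?S \<subseteq> {0<..<1}" by blast
    moreover have "{0<..<1::real} \<inter> space lborel \<in> sets lborel" by simp
    ultimately show "?S \<in> sets unit_lebesgue" by (simp only: sets_restrict_space_iff)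
  qed
  finally show ?thesis .
qed

section \<open>The cdf of the candidate and the payoff against it\<close>

lemma cdf_Fstar_ge:
  assumes "g y \<le> ell x" "0 \<le> y" "y \<le> 1"
  shows "y \<le> cdf Fstar x"
proof -
  have "y - 0 \<le> measure unit_lebesgue {y\<in>{0<..<1}. Q y \<in> {..x}}"
  proof (rule measure_unit_mono_ge)
    fix u assume "u < y"
    then show "Q u \<in> {..x}" using assms(1) g_mono[of u y] by (simp add: Q_le_iff)
  qed (use assms in simp_all)
  then show ?thesis by (simp add: cdf_def measure_Fstar)
qed

lemma cdf_Fstar_le:
  assumes "ell x < g y" "0 \<le> y"
  shows "cdf Fstar x \<le> y"
proof -
  have "measure unit_lebesgue {y\<in>{0<..<1}. Q y \<in> {..x}} \<le> y"
  proof (rule measure_unit_mono_le)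
    fix u assume "Q u \<in> {..x}"
    then show "u \<le> y" using assms g_mono[of y u] by (cases "u \<le> y") (auto simp: Q_le_iff)
  qed (use assms in auto)
  then show ?thesis by (simp add: cdf_def measure_Fstar)
qed

text \<open>Every \<open>u\<close> below the cdf value satisfies \<open>g u \<le> ell x\<close>, and
  left-continuity passes this on to the cdf value itself. At cdf value 0 there is nothing to the
  left, but \<open>g 0 = R 1\<close> suffices.\<close>

lemma g_cdf_Fstar_le:
  assumes "0 \<le> x"
  shows "g (cdf Fstar x) \<le> ell x"
proof (cases "cdf Fstar x = 0")
  case True
  then show ?thesis using assms ell_le_iff[of 0 x] by (simp del: ell_le_iff)
next
  case False
  then have "0 < cdf Fstar x" using Fs.Cl_bounds[of x] by linarith
  then show ?thesis
  proof (rule g_left_limit_le)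
    fix u assume "0 < u" "u < cdf Fstar x"
    then show "g u \<le> ell x" using cdf_Fstar_le[of x u] by (cases "g u \<le> ell x") auto
  qed
qed

lemma payoff_Fstar_le: "0 \<le> x \<Longrightarrow> payoff R Fstar x \<le> ustar x"
  using Fs.payoff_bounds(2)[of x] g_cdf_Fstar_le[of x] g_bounds(2)[of "cdf Fstar x"]
  by (simp add: ustar_def)

lemma Cl_Fstar_ge:
  assumes "g y < ell x" "0 \<le> y" "y \<le> 1"
  shows "y \<le> Fs.Cl x"
proof -
  have "y - 0 \<le> measure unit_lebesgue {y\<in>{0<..<1}. Q y \<in> {..<x}}"
  proof (rule measure_unit_mono_ge)
    fix u assume "u < y"
    then show "Q u \<in> {..<x}" using assms(1) g_mono[of u y] by (simp add: Q_less_iff)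
  qed (use assms in simp_all)
  then show ?thesis by (simp add: measure_Fstar)
qed

text \<open>A jump of the cdf at \<open>Q y\<close> spans a flat piece of \<open>g\<close> at level
  \<open>g y\<close>, so averaging over ties changes nothing. The closed range of \<open>y\<close>
  matters: \<open>y = 0\<close> and \<open>y = 1\<close> give the payoffs at 0 and
  \<open>xbar\<close> even if these are not atoms.\<close>

lemma payoff_Fstar_Q:
  assumes y: "0 \<le> y" "y \<le> 1"
  shows "payoff R Fstar (Q y) = g y"
proof (rule Fs.payoff_flat)
  have C: "y \<le> cdf Fstar (Q y)" by (rule cdf_Fstar_ge[OF _ y]) simp
  show eq: "g (cdf Fstar (Q y)) = g y"
    using g_cdf_Fstar_le[OF Q_nonneg, of y] g_mono[OF C] by simp
  fix u assume u: "Fs.Cl (Q y) < u" "u < cdf Fstar (Q y)"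
  then have u01: "0 \<le> u" "u \<le> 1" using Fs.Cl_bounds[of "Q y"] by linarith+
  have "g u \<le> g y" using g_mono[of u "cdf Fstar (Q y)"] u eq by simp
  moreover have "g y \<le> g u"
    using Cl_Fstar_ge[OF _ u01, of "Q y"] u by (cases "g y \<le> g u") auto
  ultimately show "g u = g y" by simp
qed

lemma payoff_Fstar_0: "payoff R Fstar 0 = R 1"
  using payoff_Fstar_Q[of 0] by (simp add: Q_0)

lemma payoff_Fstar_xbar: "payoff R Fstar xbar = R 0"
  using payoff_Fstar_Q[of 1] by (simp add: Q_1)

section \<open>Optimality of the candidate and its value function\<close>

lemma expected_payoff_le:
  assumes \<tau>: "\<tau> \<in> finite_stopping_times M \<FF>" and x: "0 \<le> x"
  shows "expectation (\<lambda>\<omega>. payoff R Fstar (stopped_value W \<mu> \<sigma> x \<tau> \<omega>)) \<le> ustar x"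
proof -
  let ?S = "stopped_value W \<mu> \<sigma> x \<tau>"
  have S: "?S \<in> borel_measurable M"
    by (rule stopped_value_measurable) (use \<tau> in \<open>simp add: finite_stopping_times_def\<close>)
  have "(\<lambda>\<omega>. payoff R Fstar (?S \<omega>)) \<in> borel_measurable M"
    by (rule measurable_compose[OF S Fs.payoff_measurable])
  then have int: "integrable M (\<lambda>\<omega>. payoff R Fstar (?S \<omega>))"
    by (rule integrable_const_bound[where B = "R 0", rotated]) (simp add: Fs.abs_payoff_le)
  note hs = scale_stopped_value_le[OF \<tau> x]
  \<comment> \<open>The payoff lies below a line in \<open>h\<close> with positive slope, and
    stopping cannot raise the mean of \<open>h\<close>; the cap \<open>R 0\<close> is the trivial
    bound.\<close>
  have "expectation (\<lambda>\<omega>. payoff R Fstar (?S \<omega>)) \<le> expectation (\<lambda>\<omega>. R 1 + c * h (?S \<omega>))"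
  proof (rule integral_mono[OF int])
    show "integrable M (\<lambda>\<omega>. R 1 + c * h (?S \<omega>))" using hs by simp
    fix \<omega> assume "\<omega> \<in> space M"
    then show "payoff R Fstar (?S \<omega>) \<le> R 1 + c * h (?S \<omega>)"
      using payoff_Fstar_le[OF stopped_value_nonneg[OF _ x], of \<omega> \<tau>] by (simp add: ustar_def ell_def)
  qed
  also have "\<dots> = R 1 + c * expectation (\<lambda>\<omega>. h (?S \<omega>))" using hs by (simp add: prob_space)
  also have "\<dots> \<le> ell x" using hs c_pos by (simp add: ell_def)
  finally have "expectation (\<lambda>\<omega>. payoff R Fstar (?S \<omega>)) \<le> ell x" .
  moreover have "expectation (\<lambda>\<omega>. payoff R Fstar (?S \<omega>)) \<le> expectation (\<lambda>\<omega>. R 0)"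
    by (intro integral_mono int) (auto simp: Fs.payoff_range)
  ultimately show ?thesis by (simp add: ustar_def prob_space)
qed

lemma ustar_x0: "ustar x0 = mean_reward R"
  using mean_reward_bounds by (simp add: ustar_def ell_def c_def)

lemma integral_feasible:
  fixes f :: "real \<Rightarrow> real"
  assumes \<tau>: "\<tau> \<in> finite_stopping_times M \<FF>" and [measurable]: "f \<in> borel_measurable borel"
  shows "(LINT x|distr M borel (stopped_value W \<mu> \<sigma> x0 \<tau>). f x) = expectation (\<lambda>\<omega>. f (stopped_value W \<mu> \<sigma> x0 \<tau> \<omega>))"
proof (rule integral_distr)
  show "stopped_value W \<mu> \<sigma> x0 \<tau> \<in> borel_measurable M"
    by (rule stopped_value_measurable) (use \<tau> in \<open>simp add: finite_stopping_times_def\<close>)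
qed measurable

text \<open>No deviation from \<open>x0\<close> earns more than
  \<open>ustar x0 = mean_reward R\<close>, while under \<open>Fstar\<close> the payoff at
  \<open>Q y\<close> is \<open>g y\<close>, whose mean is that same number.\<close>

lemma Fstar_equilibrium: "mean_field_equilibrium M \<FF> W \<mu> \<sigma> x0 R Fstar"
  unfolding mean_field_equilibrium_def
proof (intro conjI ballI Fstar_feasible)
  fix F' assume "F' \<in> feasible_distributions M \<FF> W \<mu> \<sigma> x0"
  then obtain \<tau> where \<tau>: "\<tau> \<in> finite_stopping_times M \<FF>" "F' = distr M borel (stopped_value W \<mu> \<sigma> x0 \<tau>)"
    by (auto simp: feasible_distributions_def)
  have "(LINT x|F'. payoff R Fstar x) \<le> mean_reward R"
    unfolding \<tau>(2) integral_feasible[OF \<tau>(1) Fs.payoff_measurable]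
    using expected_payoff_le[OF \<tau>(1), of x0] x0_pos by (simp add: ustar_x0)
  also have "mean_reward R = (LINT y|unit_lebesgue. payoff R Fstar (Q y))"
    unfolding mean_reward_eq
    by (intro Bochner_Integration.integral_cong) (auto simp: payoff_Fstar_Q space_restrict_space)
  also have "\<dots> = (LINT x|Fstar. payoff R Fstar x)"
    unfolding Fstar_def[symmetric] by (subst (2) Fstar_def) (rule integral_distr[symmetric]; measurable)
  finally show "(LINT x|F'. payoff R Fstar x) \<le> (LINT x|Fstar. payoff R Fstar x)" .
qed

lemma cdf_Fstar: 
  assumes x: "0 \<le> x"
  shows "cdf Fstar x = rev_reward_inv R (ustar x)"
proof (cases "R 0 \<le> ell x")
  case True
  \<comment> \<open>From \<open>xbar\<close> on \<open>ustar\<close> equals \<open>R 0\<close>, the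
    argument at which \<open>rev_reward_inv\<close> takes its separately defined value 1.\<close>
  have "1 \<le> cdf Fstar x" by (rule cdf_Fstar_ge) (use True in auto)
  then show ?thesis using True Fs.Cl_bounds[of x] by (simp add: ustar_def rev_reward_inv_def)
next
  case False
  then have u: "ustar x = ell x" "ell x \<noteq> R 0" by (simp_all add: ustar_def)
  let ?S = "{y \<in> {0..1}. rev_reward R y > ell x}"
  have S: "y \<in> ?S \<longleftrightarrow> 0 \<le> y \<and> y \<le> 1 \<and> ell x < g y" for y
    by (auto simp: rev_ext_def)
  have "Inf ?S = cdf Fstar x"
  proof (rule cInf_eq_non_empty)
    have "1 \<in> ?S" unfolding S using False by simp
    then show "?S \<noteq> {}" by blast
    fix y assume "y \<in> ?S"
    then show "cdf Fstar x \<le> y" unfolding S using cdf_Fstar_le[of x y] by simp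
  next
    fix b assume b: "\<And>y. y \<in> ?S \<Longrightarrow> b \<le> y"
    show "b \<le> cdf Fstar x"
    proof (rule ccontr)
      assume "\<not> b \<le> cdf Fstar x"
      then obtain u where u: "cdf Fstar x < u" "u < b" using dense[of "cdf Fstar x" b] by auto
      have "b \<le> 1" using b[of 1] False unfolding S by simp
      have u01: "0 \<le> u" "u \<le> 1" using u \<open>b \<le> 1\<close> Fs.Cl_bounds[of x] by linarith+
      have "u \<notin> ?S" using b[of u] u by auto
      then have "g u \<le> ell x" unfolding S using u01 by auto
      from cdf_Fstar_ge[OF this u01] u show False by simp
    qed
  qed
  then show ?thesis using u by (simp add: rev_reward_inv_def)
qed

text \<open>The supremum is attained. Up to \<open>xbar\<close> one waits for exit from the interval
  between 0 and \<open>xbar\<close>, at whose ends the payoff equals \<open>ell\<close>; beyond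
  \<open>xbar\<close> the payoff is already \<open>R 0\<close>.\<close>

lemma value_function_Fstar:
  assumes x: "0 \<le> x"
  shows "value_function M \<FF> W \<mu> \<sigma> R Fstar x = ustar x"
proof -
  let ?V = "\<lambda>\<tau>. expectation (\<lambda>\<omega>. payoff R Fstar (stopped_value W \<mu> \<sigma> x \<tau> \<omega>))"
  have "\<exists>\<tau>\<in>finite_stopping_times M \<FF>. ?V \<tau> = ustar x"
  proof (cases "x \<le> xbar")
    case True
    have ab: "0 \<le> (0::real) \<and> 0 \<le> x \<and> x \<le> xbar \<and> xbar \<le> xbar" using x True by simp
    let ?T = "exit_time x (\<lambda>_. 0) (\<lambda>_. xbar)"
    have T: "?T \<in> finite_stopping_times M \<FF>"
      by (rule exit_time_finite_stopping[where B = xbar]) (use ab in auto)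
    have "?V ?T = expectation (\<lambda>\<omega>. if 0 = xbar then payoff R Fstar x else
        (payoff R Fstar 0 * (h xbar - h x) + payoff R Fstar xbar * (h x - h 0)) / (h xbar - h 0))"
      by (rule expectation_at_exit[where B = xbar and K = "R 0"]) (use ab in \<open>auto simp: Fs.abs_payoff_le\<close>)
    also have "\<dots> = (R 1 * (z - h x) + R 0 * h x) / z"
      using xbar_pos by (simp add: payoff_Fstar_0 payoff_Fstar_xbar xbar prob_space)
    also have "\<dots> = R 1 + (R 0 - R 1) / z * h x"
      using z_gt_1 by (simp add: field_simps)
    also have "(R 0 - R 1) / z = c" using R1_less_R0 c_pos by (simp add: z_def)
    finally show ?thesis using T ustar_below[OF True] by (auto simp: ell_def)
  next
    case False
    \<comment> \<open>The degenerate interval at \<open>x\<close> realizes immediate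
      stopping.\<close>
    let ?T = "exit_time x (\<lambda>_. x) (\<lambda>_. x)"
    have T: "?T \<in> finite_stopping_times M \<FF>"
      by (rule exit_time_finite_stopping[where B = x]) (use x in auto)
    have "?V ?T = expectation (\<lambda>\<omega>. if x = x then payoff R Fstar x else
        (payoff R Fstar x * (h x - h x) + payoff R Fstar x * (h x - h x)) / (h x - h x))"
      by (rule expectation_at_exit[where B = x and K = "R 0"]) (use x in \<open>auto simp: Fs.abs_payoff_le\<close>)
    also have "\<dots> = payoff R Fstar x" by (simp add: prob_space)
    also have "\<dots> = R 0"
      using Fs.payoff_mono[of xbar x] Fs.payoff_range(2)[of x] False by (simp add: payoff_Fstar_xbar)
    finally show ?thesis using T ustar_above[of x] False by auto
  qed
  then obtain \<tau> where \<tau>: "\<tau> \<in> finite_stopping_times M \<FF>" "?V \<tau> = ustar x" by blast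
  have "(SUP \<tau> \<in> finite_stopping_times M \<FF>. ?V \<tau>) = ustar x"
  proof (rule cSup_eq_maximum)
    show "ustar x \<in> ?V ` finite_stopping_times M \<FF>"
      unfolding \<tau>(2)[symmetric] using \<tau>(1) by (rule imageI)
  qed (use expected_payoff_le[OF _ x] in auto)
  then show ?thesis by (simp add: value_function_def)
qed

section \<open>Uniqueness\<close>

text \<open>The only deviations tested for uniqueness: exit from a fixed interval around
  \<open>x0\<close>, and stopping at once.\<close>

lemma two_point_payoff_le:
  assumes F: "mean_field_equilibrium M \<FF> W \<mu> \<sigma> x0 R F" and "reward_distribution R F"
    and ab: "0 \<le> a" "a < x0" "x0 < b"
  shows "(payoff R F a * (h b - 1) + payoff R F b * (1 - h a)) / (h b - h a) \<le> (LINT x|F. payoff R F x)"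
    and "payoff R F x0 \<le> (LINT x|F. payoff R F x)"
proof -
  interpret F: reward_distribution R F by fact
  have V: "expectation (\<lambda>\<omega>. payoff R F (stopped_value W \<mu> \<sigma> x0 \<tau> \<omega>)) \<le> (LINT x|F. payoff R F x)"
    if \<tau>: "\<tau> \<in> finite_stopping_times M \<FF>" for \<tau>
    using F \<tau> unfolding mean_field_equilibrium_def integral_feasible[OF \<tau> F.payoff_measurable, symmetric]
    by (auto simp: feasible_distributions_def)
  have "expectation (\<lambda>\<omega>. payoff R F (stopped_value W \<mu> \<sigma> x0 (exit_time x0 (\<lambda>_. a) (\<lambda>_. b)) \<omega>))
    = expectation (\<lambda>\<omega>. if a = b then payoff R F x0 else
        (payoff R F a * (h b - h x0) + payoff R F b * (h x0 - h a)) / (h b - h a))"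
    by (rule expectation_at_exit[where B = b and K = "R 0"]) (use ab in \<open>auto simp: F.abs_payoff_le\<close>)
  also have "\<dots> = (payoff R F a * (h b - 1) + payoff R F b * (1 - h a)) / (h b - h a)"
    using ab by (simp add: prob_space)
  finally show "(payoff R F a * (h b - 1) + payoff R F b * (1 - h a)) / (h b - h a) \<le> (LINT x|F. payoff R F x)"
    using V[OF exit_time_finite_stopping[of "\<lambda>_. a" "\<lambda>_. b" x0 b]] ab by simp
  have "expectation (\<lambda>\<omega>. payoff R F (stopped_value W \<mu> \<sigma> x0 (exit_time x0 (\<lambda>_. x0) (\<lambda>_. x0)) \<omega>))
    = expectation (\<lambda>\<omega>. if x0 = x0 then payoff R F x0 else
        (payoff R F x0 * (h x0 - h x0) + payoff R F x0 * (h x0 - h x0)) / (h x0 - h x0))"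
    by (rule expectation_at_exit[where B = x0 and K = "R 0"]) (use x0_pos in \<open>auto simp: F.abs_payoff_le\<close>)
  also have "\<dots> = payoff R F x0" by (simp add: prob_space)
  finally show "payoff R F x0 \<le> (LINT x|F. payoff R F x)"
    using V[OF exit_time_finite_stopping[of "\<lambda>_. x0" "\<lambda>_. x0" x0 x0]] x0_pos by simp
qed

text \<open>In the coordinate \<open>h\<close> the payoff need not be concave, but by
  \<open>two_point_payoff_le\<close> every chord across \<open>h = 1\<close> passes at or below
  \<open>V\<close>. Hence each slope to the point \<open>(1, V)\<close> from the left dominates each
  slope from it to the right, and the infimum of the former separates them. Monotonicity of the
  payoff makes it nonnegative.\<close>

lemma supporting_line:
  assumes F: "mean_field_equilibrium M \<FF> W \<mu> \<sigma> x0 R F" and rd: "reward_distribution R F"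
  defines "V \<equiv> (LINT x|F. payoff R F x)"
  obtains s where "0 \<le> s" "\<And>x. 0 \<le> x \<Longrightarrow> payoff R F x \<le> V + s * (h x - 1)"
proof -
  interpret F: reward_distribution R F by (rule rd)
  define S where "S = (\<lambda>a. (V - payoff R F a) / (1 - h a)) ` {0..<x0}"
  have h1: "h y < 1 \<longleftrightarrow> y < x0" "1 < h y \<longleftrightarrow> x0 < y" for y
    using h_less_iff[of y x0] h_less_iff[of x0 y] by (simp_all del: h_less_iff)
  have x0: "payoff R F x0 \<le> V"
    using two_point_payoff_le(2)[OF F rd, of 0 "x0 + 1"] x0_pos by (simp add: V_def)
  have ne: "S \<noteq> {}" using x0_pos by (auto simp: S_def)
  have nonneg: "0 \<le> v" if "v \<in> S" for v
    using that x0 F.payoff_mono[of _ x0]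
    by (auto simp: S_def h1 intro!: divide_nonneg_pos order_trans[of _ "payoff R F x0" V])
  have bdd: "bdd_below S" using nonneg by (rule bdd_belowI)
  show ?thesis
  proof (rule that[of "Inf S"])
    show "0 \<le> Inf S" using ne nonneg by (rule cInf_greatest)
    fix x :: real assume x: "0 \<le> x"
    consider "x < x0" | "x = x0" | "x0 < x" by linarith
    then show "payoff R F x \<le> V + Inf S * (h x - 1)"
    proof cases
      case 1
      then have "Inf S \<le> (V - payoff R F x) / (1 - h x)"
        using x by (intro cInf_lower bdd) (auto simp: S_def)
      then show ?thesis using h1(1)[of x] 1 by (simp add: pos_le_divide_eq algebra_simps)
    next
      case 2
      then show ?thesis using x0 by simp
    next
      case 3
      have "(payoff R F x - V) / (h x - 1) \<le> Inf S"
      proof (rule cInf_greatest[OF ne])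
        fix v assume "v \<in> S"
        then obtain a where a: "0 \<le> a" "a < x0" "v = (V - payoff R F a) / (1 - h a)" by (auto simp: S_def)
        have pos: "0 < 1 - h a" "0 < h x - 1" "0 < h x - h a" using a 3 h1[of a] h1[of x] by simp_all
        have "payoff R F a * (h x - 1) + payoff R F x * (1 - h a) \<le> V * (h x - h a)"
          using two_point_payoff_le(1)[OF F rd a(1,2) 3] pos by (simp add: V_def pos_divide_le_eq)
        then have "(payoff R F x - V) * (1 - h a) \<le> (V - payoff R F a) * (h x - 1)"
          by (simp add: algebra_simps)
        then show "(payoff R F x - V) / (h x - 1) \<le> v"
          using pos by (simp add: a(3) pos_divide_le_eq pos_le_divide_eq mult.commute)
      qed
      then show ?thesis using h1(2)[of x] 3 by (simp add: pos_divide_le_eq algebra_simps)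
    qed
  qed
qed

lemma equilibrium_unique:
  assumes F: "mean_field_equilibrium M \<FF> W \<mu> \<sigma> x0 R F"
  shows "F = Fstar"
proof -
  obtain \<tau> where \<tau>: "\<tau> \<in> finite_stopping_times M \<FF>" and F_def: "F = distr M borel (stopped_value W \<mu> \<sigma> x0 \<tau>)"
    using F by (auto simp: mean_field_equilibrium_def feasible_distributions_def)
  have S: "stopped_value W \<mu> \<sigma> x0 \<tau> \<in> borel_measurable M"
    by (rule stopped_value_measurable) (use \<tau> in \<open>simp add: finite_stopping_times_def\<close>)
  have "real_distribution F" unfolding F_def by (rule real_distribution_distr[OF S])
  then have rd: "reward_distribution R F"
    by (intro reward_distribution.intro reward_axioms cdf_distribution.intro)
  then interpret F: reward_distribution R F .
  have nonneg: "AE x in F. 0 \<le> x"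
    unfolding F_def by (subst AE_distr_iff[OF S]) (use stopped_value_nonneg x0_pos in auto)
  have h_meas: "h \<in> borel_measurable borel" by (rule scale_fun_measurable)
  have h_int: "integrable F h" "(LINT x|F. h x) \<le> 1"
    unfolding F_def integrable_distr_eq[OF S h_meas] integral_distr[OF S h_meas]
    using scale_stopped_value_le[OF \<tau>, of x0] x0_pos by simp_all
  define V where "V = (LINT x|F. payoff R F x)"
  obtain s where s: "0 \<le> s" "\<And>x. 0 \<le> x \<Longrightarrow> payoff R F x \<le> V + s * (h x - 1)"
    by (rule supporting_line[OF F rd]) (auto simp: V_def)
  define l where "l x = V + s * (h x - 1)" for x
  have l_mono: "x \<le> y \<Longrightarrow> l x \<le> l y" for x y
    using s(1) by (simp add: l_def mult_left_mono)
  have l_cont: "continuous_on UNIV l"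
    unfolding l_def[abs_def] by (intro continuous_intros continuous_on_scale_fun)
  have p_int: "integrable F (payoff R F)"
    by (rule F.integrable_const_bound[where B = "R 0"]) (auto simp: F.abs_payoff_le)
  have l_int: "integrable F l" unfolding l_def[abs_def] using h_int by simp
  \<comment> \<open>Only \<open>E h \<le> 1\<close> is known for \<open>F\<close>; the sign of
    \<open>s\<close> turns this into the bound needed.\<close>
  have l_V: "(LINT x|F. l x) \<le> V"
  proof -
    have "(LINT x|F. l x) = V + s * ((LINT x|F. h x) - 1)"
      unfolding l_def using h_int F.prob_space by simp
    then show ?thesis using h_int s(1) by (simp add: mult_nonneg_nonpos)
  qed
  have le: "AE x in F. 0 \<le> l x - payoff R F x"
    using nonneg by eventually_elim (use s in \<open>simp add: l_def\<close>)
  have d_int: "integrable F (\<lambda>x. l x - payoff R F x)" using l_int p_int by simp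
  have "(LINT x|F. l x - payoff R F x) \<le> 0" using l_int p_int l_V by (simp add: V_def)
  then have "(LINT x|F. l x - payoff R F x) = 0" using integral_nonneg_AE[OF le] by linarith
  then have eq: "AE x in F. payoff R F x = l x"
    using integral_nonneg_eq_0_iff_AE[OF d_int le] by (auto elim!: eventually_mono)
  \<comment> \<open>At an atom the payoff may lie below \<open>g (F.C x)\<close>, so the bound is
    taken from points just to the right, whose payoff is at least \<open>g (F.C x)\<close>, and
    transferred by continuity of \<open>l\<close>.\<close>
  have gC_le: "g (F.C x) \<le> l x" if x: "0 \<le> x" for x
  proof (rule tendsto_lowerbound)
    show "(l \<longlongrightarrow> l x) (at_right x)"
      using l_cont by (auto simp: continuous_on_def intro: tendsto_within_subset)
    show "\<forall>\<^sub>F y in at_right x. g (F.C x) \<le> l y"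
    proof (rule eventually_at_rightI[of _ "x + 1"])
      fix y assume y: "y \<in> {x<..<x + 1}"
      have "g (F.C x) \<le> g (F.Cl y)" using F.C_le_Cl[of x y] y by (intro g_mono) simp
      also have "\<dots> \<le> payoff R F y" by (rule F.payoff_bounds)
      also have "\<dots> \<le> l y" using s(2)[of y] x y by (simp add: l_def)
      finally show "g (F.C x) \<le> l y" .
    qed simp
  qed simp
  have I_meas: "F.I \<in> borel_measurable unit_lebesgue"
    using F.measurable_CI by (simp cong: measurable_cong_sets add: sets_restrict_space)
  have C_neg: "F.C x = 0" if "x < 0" for x
  proof -
    have "AE y in F. \<not> y \<le> x" using nonneg by eventually_elim (use that in auto)
    then show ?thesis unfolding cdf_def by (subst F.prob_eq_0) auto
  qed
  have I_nonneg: "0 \<le> F.I y" if "0 < y" "y < 1" for y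
    using F.quantile_bounds(1)[OF that] C_neg[of "F.I y"] that by (cases "F.I y < 0") auto
  have good: "AE y in unit_lebesgue. payoff R F (F.I y) = l (F.I y)"
    by (rule AE_distrD[OF I_meas]) (unfold F.distr_I_eq_M, rule eq)
  \<comment> \<open>The almost-everywhere identity becomes pointwise: one inequality is
    \<open>gC_le\<close>, the other approaches \<open>F.I y\<close> from the left through levels
    where the identity holds.\<close>
  have g_eq: "g y = l (F.I y)" if y: "0 < y" "y < 1" for y
  proof (rule antisym)
    have "g y \<le> g (F.C (F.I y))" by (rule g_mono[OF F.quantile_bounds(1)[OF y]])
    also have "\<dots> \<le> l (F.I y)" by (rule gC_le[OF I_nonneg[OF y]])
    finally show "g y \<le> l (F.I y)" .
    show "l (F.I y) \<le> g y"
    proof (rule tendsto_upperbound)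
      show "(l \<longlongrightarrow> l (F.I y)) (at_left (F.I y))"
        using l_cont by (auto simp: continuous_on_def intro: tendsto_within_subset)
      show "\<forall>\<^sub>F x in at_left (F.I y). l x \<le> g y"
      proof (rule eventually_at_leftI[of "F.I y - 1"])
        fix x assume "x \<in> {F.I y - 1<..<F.I y}"
        then have nle: "\<not> F.I y \<le> x" by simp
        then have less: "F.C x < y" using F.pseudoinverse[OF y, of x] by linarith
        have "0 \<le> F.C x" using F.Cl_bounds[of x] by linarith
        \<comment> \<open>Good levels are dense, so one can be chosen below \<open>y\<close> yet
          above \<open>F.C x\<close>, which keeps \<open>F.I w\<close> to the right of
          \<open>x\<close>.\<close>
        then obtain w where w: "F.C x < w" "w < y" "payoff R F (F.I w) = l (F.I w)"
          using AE_unit_lebesgue_ex[OF good \<open>0 \<le> F.C x\<close> less less_imp_le[OF y(2)]] by blast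
        have w01: "0 < w" "w < 1" using w y \<open>0 \<le> F.C x\<close> by auto
        have gw: "payoff R F (F.I w) = g (F.C (F.I w))" "g (F.C (F.I w)) = l (F.I w)"
          using F.payoff_bounds(2)[of "F.I w"] gC_le[OF I_nonneg[OF w01]] w(3) by auto
        have "\<not> F.I w \<le> x" using F.pseudoinverse[OF w01, of x] w(1) by linarith
        then have "l x \<le> l (F.I w)" by (intro l_mono) simp
        also have "\<dots> \<le> g y"
        \<comment> \<open>Either \<open>y\<close> lies in the jump of the cdf at
          \<open>F.I w\<close>, over which \<open>g\<close> is flat, or the cdf at
          \<open>F.I w\<close> has not yet reached \<open>y\<close>.\<close>
        proof (cases "F.I y \<le> F.I w")
          case True
          then have "y \<le> F.C (F.I w)" using F.pseudoinverse[OF y, of "F.I w"] by blast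
          then have "g y = g (F.C (F.I w))"
            using F.quantile_bounds(2)[OF w01] w(2) by (intro F.payoff_maximal_imp_flat[OF gw(1)]) auto
          then show ?thesis using gw by simp
        next
          case False
          then have "F.C (F.I w) < y" using F.pseudoinverse[OF y, of "F.I w"] by linarith
          then show ?thesis using g_mono[of "F.C (F.I w)" y] gw by simp
        qed
        finally show "l x \<le> g y" .
      qed simp
    qed simp
  qed
  \<comment> \<open>Uniform quantiles have law \<open>F\<close>, so integrating \<open>g_eq\<close>
    identifies the equilibrium value \<open>V\<close>, the first of the two unknowns of the
    line.\<close>
  have "mean_reward R = (LINT y|unit_lebesgue. l (F.I y))"
    unfolding mean_reward_eq
    by (intro Bochner_Integration.integral_cong) (auto simp: g_eq space_restrict_space)
  also have "\<dots> = (LINT x|distr unit_lebesgue borel F.I. l x)"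
  proof (rule integral_distr[symmetric, OF I_meas])
    show "l \<in> borel_measurable borel" unfolding l_def[abs_def] by measurable
  qed
  also have "\<dots> = (LINT x|F. l x)" by (simp only: F.distr_I_eq_M)
  also have "\<dots> = (LINT x|F. payoff R F x)"
  proof (rule integral_cong_AE)
    show "AE x in F. l x = payoff R F x" using eq by eventually_elim simp
  qed (use l_int p_int in auto)
  finally have V: "V = mean_reward R" by (simp add: V_def)
  \<comment> \<open>The second condition on the line. Since \<open>h 0 = 0\<close>, it reads
    \<open>V - s = R 1\<close> and determines the slope.\<close>
  have l0: "l 0 = R 1"
  proof (rule antisym)
    show "l 0 \<le> R 1"
    proof (rule ccontr)
      assume "\<not> l 0 \<le> R 1"
      then obtain y where y: "0 < y" "y \<le> 1" "g y < l 0" using g_near_0[of "l 0"] by auto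
      have y2: "0 < y / 2" "y / 2 < 1" using y by auto
      have "l 0 \<le> g (y / 2)" unfolding g_eq[OF y2] by (rule l_mono[OF I_nonneg[OF y2]])
      also have "\<dots> \<le> g y" using y by (intro g_mono) simp
      finally show False using y by simp
    qed
    show "R 1 \<le> l 0" using gC_le[of 0] g_bounds(1)[of "F.C 0"] by simp
  qed
  then have "s = c" using V by (simp add: l_def c_def)
  moreover have "mean_reward R = R 1 + c" by (simp add: c_def)
  ultimately have l_ell: "l x = ell x" for x using V by (simp add: l_def ell_def algebra_simps)
  have "F = distr unit_lebesgue borel F.I" by (simp only: F.distr_I_eq_M)
  also have "\<dots> = Fstar"
    unfolding Fstar_def
  proof (rule distr_cong[OF refl refl])
    fix y assume "y \<in> space unit_lebesgue"
    then have "0 < y" "y < 1" by (auto simp: space_restrict_space)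
    from g_eq[OF this] have "Q y = F.I y" by (simp add: Q_eq_iff l_ell)
    then show "F.I y = Q y" ..
  qed
  finally show ?thesis .
qed

section \<open>Support and atoms\<close>

lemma measure_Fstar_pos:
  assumes "open V" "0 \<le> a" "a < b" "b \<le> 1" "\<And>y. a < y \<Longrightarrow> y < b \<Longrightarrow> Q y \<in> V"
  shows "0 < measure Fstar V"
proof -
  have V: "V \<in> sets borel" using assms(1) by (rule borel_open)
  have "b - a \<le> measure unit_lebesgue {y\<in>{0<..<1}. Q y \<in> V}"
  proof (rule measure_unit_mono_ge)
    have "{y\<in>{0<..<1}. Q y \<in> V} = {0<..<1} \<inter> (Q -` V)" by blast
    moreover have "Q -` V \<in> sets borel" using measurable_sets[OF Q_measurable V] by simp
    ultimately show "{y\<in>{0<..<1}. Q y \<in> V} \<in> sets borel" by simp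
  qed (rule assms(5), assumption+, use assms in simp_all)
  then show ?thesis using assms(3) measure_Fstar[OF V] by linarith
qed

lemma closed_topological_support: "closed (topological_support F)"
proof -
  have "- topological_support F = \<Union>{V. open V \<and> \<not> 0 < measure F V}"
    by (auto simp: topological_support_def)
  then show ?thesis unfolding closed_def by (metis (no_types, lifting) mem_Collect_eq open_Union)
qed

lemma support_Fstar_subset: "topological_support Fstar \<subseteq> {0..xbar}"
proof (rule ccontr)
  assume "\<not> ?thesis"
  then obtain x where x: "x \<in> topological_support Fstar" "x \<in> - {0..xbar}" by blast
  have op: "open (- {0..xbar})" by (rule open_Compl) simp
  then have "0 < measure Fstar (- {0..xbar})" using x by (auto simp: topological_support_def)
  also have "measure Fstar (- {0..xbar}) = measure unit_lebesgue {y\<in>{0<..<1}. Q y \<in> - {0..xbar}}"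
    by (rule measure_Fstar[OF borel_open[OF op]])
  also have "{y\<in>{0<..<1}. Q y \<in> - {0..xbar}} = {}" using Q_nonneg Q_le_xbar by auto
  finally show False by simp
qed

lemma zero_in_support: "0 \<in> topological_support Fstar"
  unfolding topological_support_def
proof safe
  fix V :: "real set" assume V: "open V" "0 \<in> V"
  then obtain e where e: "0 < e" "\<And>x. dist x 0 < e \<Longrightarrow> x \<in> V" by (auto simp: open_dist)
  have "ell 0 < ell e" using e(1) by (simp only: ell_less_iff)
  then obtain y where y: "0 < y" "y \<le> 1" "g y < ell e" using g_near_0[of "ell e"] by (auto simp del: ell_less_iff)
  show "0 < measure Fstar V"
  proof (rule measure_Fstar_pos[OF V(1) order_refl y(1,2)])
    fix u assume "u < y"
    then have "Q u < e" using g_mono[of u y] y(3) by (simp add: Q_less_iff)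
    then show "Q u \<in> V" using e(2)[of "Q u"] Q_nonneg[of u] by (simp add: dist_real_def)
  qed
qed

text \<open>Mirror image of \<open>zero_in_support\<close>, with left-continuity of \<open>g\<close>
  at 1 in place of \<open>g_near_0\<close>.\<close>

lemma xbar_in_support: "xbar \<in> topological_support Fstar"
  unfolding topological_support_def
proof safe
  fix V :: "real set" assume V: "open V" "xbar \<in> V"
  then obtain e where e: "0 < e" "\<And>x. dist x xbar < e \<Longrightarrow> x \<in> V" by (auto simp: open_dist)
  have less: "ell (xbar - e) < R 0" using e(1) ell_less_iff[of "xbar - e" xbar] by (simp del: ell_less_iff)
  have "\<exists>y. 0 < y \<and> y < 1 \<and> ell (xbar - e) < g y"
  proof (rule ccontr)
    assume no: "\<not> ?thesis"
    have "g 1 \<le> ell (xbar - e)"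
    proof (rule g_left_limit_le[of 0])
      fix y :: real assume "0 < y" "y < 1"
      then have "\<not> ell (xbar - e) < g y" using no by blast
      then show "g y \<le> ell (xbar - e)" by linarith
    qed simp
    then show False using less by simp
  qed
  then obtain y where y: "0 < y" "y < 1" "ell (xbar - e) < g y" by blast
  show "0 < measure Fstar V"
  proof (rule measure_Fstar_pos[OF V(1) less_imp_le[OF y(1)] y(2) order_refl])
    fix u assume "y < u"
    then have "ell (xbar - e) < g u" using g_mono[of y u] y(3) by simp
    then have "\<not> Q u \<le> xbar - e" by (simp add: Q_le_iff)
    then show "Q u \<in> V" using e(2)[of "Q u"] Q_le_xbar[of u] by (simp add: dist_real_def)
  qed
qed

text \<open>A jump of \<open>R\<close> makes \<open>Q\<close> skip an interval, so the support
  itself may have gaps; the hull is determined by the extreme points 0 and \<open>xbar\<close>,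
  which always belong to it.\<close>

lemma convex_hull_support: "convex hull (topological_support Fstar) = {0..xbar}"
proof
  show "convex hull (topological_support Fstar) \<subseteq> {0..xbar}"
    by (rule hull_minimal[OF support_Fstar_subset]) (rule convex_real_interval)
  have "{0, xbar} \<subseteq> topological_support Fstar" using zero_in_support xbar_in_support by simp
  then have "convex hull {0, xbar} \<subseteq> convex hull (topological_support Fstar)" by (rule hull_mono)
  then show "{0..xbar} \<subseteq> convex hull (topological_support Fstar)"
    using xbar(1) by (simp add: segment_convex_hull[symmetric] closed_segment_eq_real_ivl)
qed

lemma compact_support: "compact (topological_support Fstar)"
  using closed_topological_support[of Fstar] bounded_subset[OF bounded_closed_interval support_Fstar_subset]
  by (simp add: compact_eq_bounded_closed)

text \<open>Without jumps \<open>g\<close> takes every level between \<open>R 1\<close> and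
  \<open>R 0\<close>, hence \<open>Q\<close> takes every value between 0 and
  \<open>xbar\<close>.\<close>

lemma support_continuous:
  assumes R: "continuous_on {0..1} R"
  shows "topological_support Fstar = {0..xbar}"
proof (rule antisym[OF support_Fstar_subset], rule subsetI)
  have g_cont: "continuous_on {0..1} g"
  proof -
    have "continuous_on {0..1} (\<lambda>y. R (1 - y))"
      by (intro continuous_on_compose2[OF R] continuous_intros) auto
    then show ?thesis by (rule continuous_on_eq) (simp add: g_unit)
  qed
  fix x assume x: "x \<in> {0..xbar}"
  show "x \<in> topological_support Fstar"
  proof (cases "x = 0 \<or> x = xbar")
    case True
    then show ?thesis using zero_in_support xbar_in_support by auto
  next
    case False
    then have x: "0 < x" "x < xbar" using x by auto
    show ?thesis
      unfolding topological_support_def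
    proof safe
      fix V :: "real set" assume V: "open V" "x \<in> V"
      then obtain e where e: "0 < e" "\<And>w. dist w x < e \<Longrightarrow> w \<in> V" by (auto simp: open_dist)
      have ell_x: "ell 0 < ell x" "ell x < ell xbar" using x by (simp_all only: ell_less_iff)
      have "\<exists>y\<ge>0. y \<le> 1 \<and> g y = ell x"
        using ell_x by (intro IVT' g_cont) (simp_all del: ell_less_iff)
      then obtain y where y: "0 \<le> y" "y \<le> 1" "g y = ell x" by blast
      have y1: "y < 1" using y ell_x by (cases "y = 1") (auto simp del: ell_less_iff)
      have gap: "0 < ell (x + e) - ell x" using e(1) by simp
      obtain d where d: "0 < d" "\<And>u. u \<in> {0..1} \<Longrightarrow> dist u y < d \<Longrightarrow> dist (g u) (g y) < ell (x + e) - ell x"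
        using g_cont[unfolded continuous_on_iff, rule_format, OF _ gap, of y] y by auto
      show "0 < measure Fstar V"
      \<comment> \<open>Only levels to the right of \<open>y\<close> are used: there monotonicity
        gives \<open>x \<le> Q u\<close>, and continuity is needed for the upper bound
        alone.\<close>
      proof (rule measure_Fstar_pos[OF V(1) y(1), of "min 1 (y + d)"])
        show "y < min 1 (y + d)" using d y1 by simp
        show "min 1 (y + d) \<le> 1" by simp
        fix u assume u: "y < u" "u < min 1 (y + d)"
        have "dist (g u) (g y) < ell (x + e) - ell x"
          by (rule d(2)) (use u y in \<open>auto simp: dist_real_def\<close>)
        then have "g u < ell (x + e)" using y(3) by (simp add: dist_real_def)
        then have "Q u < x + e" by (simp add: Q_less_iff)
        moreover have "x \<le> Q u"
        proof -
          have "Q y = x" using y(3) by (simp add: Q_eq_iff)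
          then show ?thesis using Q_mono[of y u] u by simp
        qed
        ultimately show "Q u \<in> V" using e(2)[of "Q u"] by (simp add: dist_real_def)
      qed
    qed
  qed
qed

section \<open>Maximal flat intervals of the reward and atoms\<close>

definition level :: "real \<Rightarrow> real set" where
  "level v = {r \<in> {0..1}. R r = v}"

lemma is_interval_level: "is_interval (level v)"
  unfolding is_interval_1
proof (intro ballI allI impI)
  fix a b x assume ab: "a \<in> level v" "b \<in> level v" and x: "a \<le> x \<and> x \<le> b"
  then have "R b \<le> R x" "R x \<le> R a"
    using R_antimono[of x b] R_antimono[of a x] by (simp_all add: level_def)
  then show "x \<in> level v" using ab x by (auto simp: level_def)
qed

text \<open>Level sets of a monotone function are intervals, so a maximal interval of constancy is a
  whole level set; maximality becomes automatic.\<close>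

lemma flat_interval_iff: "flat_interval R I \<longleftrightarrow> (\<exists>v. I = level v \<and> (\<exists>a\<in>I. \<exists>b\<in>I. a < b))"
proof
  assume I: "flat_interval R I"
  then obtain v where v: "\<And>r. r \<in> I \<Longrightarrow> R r = v" by (auto simp: flat_interval_def constant_on_def)
  have "I \<subseteq> {0..1}" using I unfolding flat_interval_def by blast
  then have sub: "I \<subseteq> level v" using v unfolding level_def by blast
  have "level v \<subseteq> {0..1}" "R constant_on level v" by (auto simp: level_def constant_on_def)
  then have "level v = I" using I is_interval_level[of v] sub unfolding flat_interval_def by blast
  then show "\<exists>v. I = level v \<and> (\<exists>a\<in>I. \<exists>b\<in>I. a < b)" using I unfolding flat_interval_def by blast
next
  assume "\<exists>v. I = level v \<and> (\<exists>a\<in>I. \<exists>b\<in>I. a < b)"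
  then obtain v a b where I: "I = level v" and ab: "a \<in> I" "b \<in> I" "a < b" by blast
  have "J = I" if J: "J \<subseteq> {0..1}" "R constant_on J" "I \<subseteq> J" for J
  proof -
    obtain w where w: "\<And>r. r \<in> J \<Longrightarrow> R r = w" using J(2) by (auto simp: constant_on_def)
    have "R a = w" using w ab(1) J(3) by blast
    moreover have "R a = v" using ab(1) I by (simp add: level_def)
    ultimately have "J \<subseteq> I" using w J(1) unfolding I level_def by blast
    then show ?thesis using J(3) by blast
  qed
  moreover have "I \<subseteq> {0..1}" "R constant_on I" using I by (auto simp: level_def constant_on_def)
  ultimately show "flat_interval R I"
    unfolding flat_interval_def using is_interval_level[of v] ab I by blast
qed

text \<open>The levels that \<open>Q\<close> sends to \<open>x\<close> are those where
  \<open>g\<close> equals \<open>ell x\<close>. By monotonicity two such levels enclose an interval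
  of them, while a set with at most one point is null.\<close>

lemma atoms_Fstar_iff:
  "x \<in> atoms Fstar \<longleftrightarrow> (\<exists>a b. 0 \<le> a \<and> a < b \<and> b \<le> 1 \<and> g a = ell x \<and> g b = ell x)"
proof -
  have m: "measure Fstar {x} = measure unit_lebesgue {y\<in>{0<..<1}. Q y \<in> {x}}"
    by (rule measure_Fstar) simp
  let ?S = "{y\<in>{0<..<1}. Q y \<in> {x}}"
  have S: "?S \<in> sets borel"
  proof -
    have "?S = {0<..<1} \<inter> (Q -` {x})" by blast
    moreover have "Q -` {x} \<in> sets borel" using measurable_sets[OF Q_measurable, of "{x}"] by simp
    ultimately show ?thesis by simp
  qed
  show ?thesis
  proof
    assume "x \<in> atoms Fstar"
    then have pos: "0 < measure unit_lebesgue ?S" by (simp add: atoms_def m)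
    have "\<exists>a b. a \<in> ?S \<and> b \<in> ?S \<and> a < b"
    proof (rule ccontr)
      assume no: "\<not> ?thesis"
      then have "finite ?S" by (metis (no_types, lifting) finite.emptyI finite_insert linorder_neqE_linordered_idom is_singletonI' is_singleton_def)
      then have "emeasure lborel ?S = 0" by (rule emeasure_lborel_countable[OF countable_finite])
      moreover have "measure unit_lebesgue ?S = measure lborel ?S"
        by (rule measure_restrict_space) auto
      ultimately show False using pos by (simp add: measure_def)
    qed
    then obtain a b where "a \<in> ?S" "b \<in> ?S" "a < b" by blast
    then show "\<exists>a b. 0 \<le> a \<and> a < b \<and> b \<le> 1 \<and> g a = ell x \<and> g b = ell x"
      by (intro exI[of _ a] exI[of _ b]) (auto simp: Q_eq_iff)
  next
    assume "\<exists>a b. 0 \<le> a \<and> a < b \<and> b \<le> 1 \<and> g a = ell x \<and> g b = ell x"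
    then obtain a b where ab: "0 \<le> a" "a < b" "b \<le> 1" "g a = ell x" "g b = ell x" by blast
    have "b - a \<le> measure unit_lebesgue ?S"
    proof (rule measure_unit_mono_ge[OF S _ ab(1) less_imp_le[OF ab(2)] ab(3)])
      fix y assume "a < y" "y < b"
      then have "g y = ell x" using g_mono[of a y] g_mono[of y b] ab(4,5) by simp
      then show "Q y \<in> {x}" by (simp add: Q_eq_iff)
    qed
    then show "x \<in> atoms Fstar" using ab(2) by (simp add: atoms_def m)
  qed
qed

lemma ustar_atom:
  assumes "x \<in> atoms Fstar"
  shows "ustar x = ell x" "\<exists>a\<in>level (ustar x). \<exists>b\<in>level (ustar x). a < b"
proof -
  obtain a b where ab: "0 \<le> a" "a < b" "b \<le> 1" "g a = ell x" "g b = ell x"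
    using assms unfolding atoms_Fstar_iff by blast
  show u: "ustar x = ell x" using g_bounds(2)[of a] ab(4) by (simp add: ustar_def)
  have "1 - b \<in> level (ustar x)" "1 - a \<in> level (ustar x)"
    using ab g_unit[of a] g_unit[of b] by (simp_all add: level_def u)
  moreover have "1 - b < 1 - a" using ab by simp
  ultimately show "\<exists>a\<in>level (ustar x). \<exists>b\<in>level (ustar x). a < b" by blast
qed

text \<open>An atom lies where \<open>ell\<close> meets a level of \<open>g\<close>, so the cap in
  \<open>ustar\<close> is inactive there and the level set determines the atom by strict
  monotonicity of \<open>ell\<close>.\<close>

lemma bij_betw_atoms: "bij_betw (\<lambda>x. level (ustar x)) (atoms Fstar) {I. flat_interval R I}"
proof (rule bij_betw_imageI)
  show "inj_on (\<lambda>x. level (ustar x)) (atoms Fstar)"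
  proof (rule inj_onI)
    fix x y assume x: "x \<in> atoms Fstar" and y: "y \<in> atoms Fstar" and eq: "level (ustar x) = level (ustar y)"
    obtain r where "r \<in> level (ustar x)" using ustar_atom(2)[OF x] by blast
    moreover from this have "r \<in> level (ustar y)" using eq by simp
    ultimately have "ell x = ell y"
      using ustar_atom(1)[OF x] ustar_atom(1)[OF y] by (simp add: level_def)
    then show "x = y" using c_pos by (simp add: ell_def)
  qed
  show "(\<lambda>x. level (ustar x)) ` atoms Fstar = {I. flat_interval R I}"
  proof (intro equalityI subsetI)
    fix I assume "I \<in> (\<lambda>x. level (ustar x)) ` atoms Fstar"
    then show "I \<in> {I. flat_interval R I}"
      using ustar_atom(2) by (auto simp: flat_interval_iff)
  next
    fix I assume "I \<in> {I. flat_interval R I}"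
    then obtain v a b where I: "I = level v" and ab: "a \<in> level v" "b \<in> level v" "a < b"
      by (auto simp: flat_interval_iff)
    \<comment> \<open>The point at which \<open>ell\<close> takes the constant value
      \<open>v\<close> of the flat piece.\<close>
    define x where "x = Q (1 - a)"
    have ga: "g (1 - a) = v" "g (1 - b) = v" using ab g_unit[of "1 - a"] g_unit[of "1 - b"] by (simp_all add: level_def)
    then have v: "ell x = v" by (simp add: x_def)
    have x: "x \<in> atoms Fstar"
      unfolding atoms_Fstar_iff v
      by (rule exI[of _ "1 - b"], rule exI[of _ "1 - a"]) (use ab ga in \<open>simp add: level_def\<close>)
    then have "I = level (ustar x)" using ustar_atom(1)[OF x] v I by simp
    then show "I \<in> (\<lambda>x. level (ustar x)) ` atoms Fstar" using x by (rule image_eqI)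
  qed
qed

end

theorem theorem2p2:
  fixes M :: "'w measure" and \<FF> :: "ennreal \<Rightarrow> 'w measure"
    and W :: "real \<Rightarrow> 'w \<Rightarrow> real" and U :: "'w \<Rightarrow> real"
    and R :: "real \<Rightarrow> real" and x0 \<mu> \<sigma> :: real
  defines "h \<equiv> scale_fun \<mu> \<sigma> x0"
    and "ustar \<equiv> (\<lambda>x. min (R 1 + (mean_reward R - R 1) * scale_fun \<mu> \<sigma> x0 x) (R 0))"
    and "z \<equiv> (R 0 - R 1) / (mean_reward R - R 1)"
  assumes "randomized_brownian_motion M \<FF> W U"
    and "0 < x0" and "0 < \<sigma>"
    and "reward_function R"
    and "\<mu> < mu_bar R x0 \<sigma>"
  shows "(\<exists>!F. mean_field_equilibrium M \<FF> W \<mu> \<sigma> x0 R F) \<and>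
    (\<forall>F. mean_field_equilibrium M \<FF> W \<mu> \<sigma> x0 R F \<longrightarrow>
      (\<forall>x\<ge>0. cdf F x = rev_reward_inv R (ustar x)) \<and>
      (\<forall>x\<ge>0. value_function M \<FF> W \<mu> \<sigma> R F x = ustar x) \<and>
      z \<in> h ` {0..} \<and>
      (let xbar = the_inv_into {0..} h z in
         compact (topological_support F) \<and>
         convex hull (topological_support F) = {0..xbar} \<and>
         (continuous_on {0..1} R \<longrightarrow> topological_support F = {0..xbar})) \<and>
      bij_betw (\<lambda>x. {r \<in> {0..1}. R r = ustar x}) (atoms F) {I. flat_interval R I})"
proof -
  interpret G: stopping_game M \<FF> W U \<mu> \<sigma> x0 R
    using assms(4-8)
    by (intro stopping_game.intro drifted_brownian_motion.intro drifted_brownian_motion_axioms.intro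
        reward.intro stopping_game_axioms.intro)
  have z: "z = G.z" by (simp add: z_def G.z_def G.c_def)
  have ustar: "ustar = G.ustar"
    by (rule ext) (simp add: ustar_def G.ustar_def G.ell_def G.c_def)
  have xbar: "the_inv_into {0..} h z = G.xbar" by (simp add: z G.xbar_def h_def)
  have atoms: "bij_betw (\<lambda>x. {r \<in> {0..1}. R r = ustar x}) (atoms G.Fstar) {I. flat_interval R I}"
    using G.bij_betw_atoms unfolding G.level_def ustar .
  have eq: "mean_field_equilibrium M \<FF> W \<mu> \<sigma> x0 R F \<longleftrightarrow> F = G.Fstar" for F
    using G.Fstar_equilibrium G.equilibrium_unique by blast
  show ?thesis
    unfolding eq Let_def xbar
    using G.cdf_Fstar G.value_function_Fstar G.z_in_range G.compact_support G.convex_hull_support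
      G.support_continuous atoms
    by (simp add: z ustar h_def)
qed

end
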